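(* Let $\alpha\in(0,1)$ and $A\in\mathbb{R}^{d\times d}$. The inhomogeneous system \[ {}^{C}D^\alpha_{0+}x(t)=Ax(t)+f(t),\qquad t\ge0, \] has at least one solution bounded on $\mathbb{R}_{\ge0}$ for every $f\in C_\infty(\mathbb{R}_{\ge0};\mathbb{R}^d)$ if and only if $\sigma(A)\subset\Lambda_\alpha^u\cup\Lambda_\alpha^s$, i.e. $A$ has no eigenvalue $\lambda$ with $\lambda=0$ or $|\arg\lambda|=\alpha\pi/2$.
   Context: For $\alpha\in(0,1)$ the Caputo derivative of a sufficiently regular function on $[0,\infty)$ is ${}^{C}D^\alpha_{0+}x(t)=\frac{1}{\Gamma(1-\alpha)}\int_0^t(t-\tau)^{-\alpha}x'(\tau)\,d\tau$, applied componentwise. Arguments of nonzero complex numbers are in $(-\pi,\pi]$; $\Lambda_\alpha^u:=\{\lambda\in\mathbb{C}\setminus\{0\}:|\arg\lambda|<\alpha\pi/2\}$ and $\Lambda_\alpha^s:=\{\lambda\in\mathbb{C}\setminus\{0\}:|\arg\lambda|>\alpha\pi/2\}$; $\sigma(A)$ is the set of (complex) eigenvalues of $A$. $C_\infty(\mathbb{R}_{\ge0};\mathbb{R}^d)$ is the space of bounded continuous functions $\mathbb{R}_{\ge0}\to\mathbb{R}^d$. Solutions with initial value $x_0$ are given by $x(t)=E_\alpha(t^\alpha A)x_0+\int_0^t(t-\tau)^{\alpha-1}E_{\alpha,\alpha}((t-\tau)^\alpha A)f(\tau)\,d\tau$, where $E_{\alpha,\beta}(z)=\sum_{k\ge0}z^k/\Gamma(\alpha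 k+\beta)$, $E_\alpha=E_{\alpha,1}$. *)

theory Defs
  imports "HOL-Analysis.Analysis"
begin

primrec mat_pow :: "real^'n^'n \<Rightarrow> nat \<Rightarrow> real^'n^'n" where
  "mat_pow M 0 = mat 1"
| "mat_pow M (Suc k) = M ** mat_pow M k"

definition mittag_leffler_mat :: "real \<Rightarrow> real \<Rightarrow> real^'n^'n \<Rightarrow> real^'n^'n" where
  "mittag_leffler_mat a b M = (\<Sum>k. (1 / Gamma (a * real k + b)) *\<^sub>R mat_pow M k)"

text \<open>The solution of  C D^alpha x = A x + f  with initial value x0
  (variation of constants formula).\<close>
definition frac_sol ::
  "real \<Rightarrow> real^'n^'n \<Rightarrow> (real \<Rightarrow> real^'n) \<Rightarrow> real^'n \<Rightarrow> real \<Rightarrow> real^'n" where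
  "frac_sol a A f x0 t =
     mittag_leffler_mat a 1 ((t powr a) *\<^sub>R A) *v x0
     + integral {0..t} (\<lambda>\<tau>. ((t - \<tau>) powr (a - 1)) *\<^sub>R
                           (mittag_leffler_mat a a (((t - \<tau>) powr a) *\<^sub>R A) *v f \<tau>))"

definition cspectrum :: "real^'n^'n \<Rightarrow> complex set" where
  "cspectrum A = {z. \<exists>v :: complex^'n. v \<noteq> 0 \<and>
                      map_matrix complex_of_real A *v v = z *s v}"

definition Lambda_u :: "real \<Rightarrow> complex set" where
  "Lambda_u a = {z. z \<noteq> 0 \<and> \<bar>Arg z\<bar> < a * pi / 2}"

definition Lambda_s :: "real \<Rightarrow> complex set" where
  "Lambda_s a = {z. z \<noteq> 0 \<and> \<bar>Arg z\<bar> > a * pi / 2}"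

end

theory Submission
  imports Defs "HOL-Complex_Analysis.Complex_Analysis" "HOL-Real_Asymp.Real_Asymp"
    "HOL-Computational_Algebra.Fundamental_Theorem_Algebra"
begin

text \<open>
  On the Laplace side the variation of constants formula reads
  $(s^\alpha - A) X(s) = s^{\alpha-1} x_0 + F(s)$ for all large real $s$, and by Lerch's uniqueness
  theorem this equation determines a continuous solution.

  Necessity: pair a bounded solution with a left eigenvector $w$ for a critical eigenvalue $\lambda$.
  The transform of the resulting bounded scalar function continues analytically to
  $\mathrm{Re}\, s > 0$ and is $O(1/\mathrm{Re}\, s)$. Choose $\omega$ with
  $s^\alpha \to \lambda$ as $s \to i\omega$ (and $\omega = 0$ if $\lambda = 0$). For the forcing
  $\cos(\omega t)$ the right-hand side has a simple pole at $i\omega$, while on the left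
  $s^\alpha - \lambda$ vanishes there, a contradiction.

  Sufficiency: for $\lambda$ off the critical rays, collapsing the Bromwich contour onto two rays
  of slope $\pm\theta$ with $\theta > \pi/2$ gives
  $1/(s^\alpha - \lambda) = \hat q(s) + c/(s-\mu)$ with $q \in L^1$ and $\mathrm{Re}\, \mu > 0$.
  So the scalar equation has a bounded solution, with initial value chosen to cancel the unstable
  mode. A vector forcing is then treated one eigenvalue at a time, along a polynomial in $A$ that
  annihilates it.
\<close>

section \<open>Uniqueness of the Laplace transform\<close>

text \<open>The growth of Mittag-Leffler functions at large arguments is hard to read off their
  defining series, where large terms cancel. Under the Laplace transform the series becomes
  geometric. The price is that the transformed equation is known only for real s beyond a threshold
  depending on A; necessity leaves this range by analytic continuation, sufficiency by uniqueness.

  The initial value is absorbed by (s^\<alpha> y0 / s + F) / (s^\<alpha> - \<lambda>) = y0 / s + (F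
  + \<lambda> y0 / s) / (s^\<alpha> - \<lambda>): it adds one constant to the solution and another
  to the forcing, so a single kernel governs both terms of the formula.

  Eigenvalues may be complex and A need not be diagonalizable. Solutions are therefore built over
  the complex numbers, with the real part taken only at the end, and an annihilating polynomial of
  each basis vector replaces the Jordan form. The solution of one scalar equation then becomes the
  forcing of the next, which is why the scalar result is proved for every bounded continuous
  forcing.\<close>

lemma integral_continuous_exp_eq_0:
  fixes g :: "real \<Rightarrow> real" and \<phi> :: "real \<Rightarrow> real"
  assumes g: "set_integrable lborel {0..} g"
    and moments: "\<And>n::nat. (LBINT t:{0..}. exp (- (real n * t)) * g t) = 0"
    and \<phi>: "continuous_on {0..1} \<phi>"
  shows "(LBINT t:{0..}. \<phi> (exp (- t)) * g t) = 0"
proof -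
  define N where "N = (LBINT t:{0..}. \<bar>g t\<bar>)"
  have N0: "N \<ge> 0"
    unfolding N_def set_lebesgue_integral_def by (rule integral_nonneg_AE) auto
  have gm: "set_borel_measurable lborel {0..} g"
    using g unfolding set_integrable_def set_borel_measurable_def by auto
  have int: "set_integrable lborel {0..} (\<lambda>t. \<psi> (exp (- t)) * g t)"
    if \<psi>: "continuous_on {0..1} \<psi>" for \<psi> :: "real \<Rightarrow> real"
  proof -
    obtain B where B: "\<And>x. x \<in> {0..1} \<Longrightarrow> norm (\<psi> x) \<le> B"
      using continuous_on_compact_bound[OF _ \<psi>] by blast
    have "continuous_on {0..} (\<lambda>t. \<psi> (exp (- t)))"
      by (rule continuous_on_compose2[OF \<psi>]) (auto intro!: continuous_intros)
    then have "set_borel_measurable lborel {0..} (\<lambda>t. \<psi> (exp (- t)))"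
      unfolding set_borel_measurable_def
      using borel_measurable_continuous_on_indicator[of "{0..}" "\<lambda>t. \<psi> (exp (- t))"] by simp
    then have m: "set_borel_measurable lborel {0..} (\<lambda>t. \<psi> (exp (- t)) * g t)"
    proof -
      assume a: "set_borel_measurable lborel {0..} (\<lambda>t. \<psi> (exp (- t)))"
      have "(\<lambda>t. (indicator {0..} t *\<^sub>R \<psi> (exp (- t))) * (indicator {0..} t *\<^sub>R g t)) \<in> borel_measurable lborel"
        using a gm unfolding set_borel_measurable_def by (intro borel_measurable_times)
      also have "(\<lambda>t. (indicator {0..} t *\<^sub>R \<psi> (exp (- t))) * (indicator {0..} t *\<^sub>R g t))
          = (\<lambda>t. indicator {0..} t *\<^sub>R (\<psi> (exp (- t)) * g t))"
        by (auto simp: indicator_def)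
      finally show ?thesis unfolding set_borel_measurable_def .
    qed
    have "set_integrable lborel {0..} (\<lambda>t. B * g t)"
      using g by simp
    then show ?thesis
    proof (rule set_integrable_bound[OF _ m])
      show "AE x in lborel. x \<in> {0..} \<longrightarrow> norm (\<psi> (exp (- x)) * g x) \<le> norm (B * g x)"
      proof (rule AE_I2, rule impI)
        fix x :: real assume "x \<in> {0..}"
        then have "norm (\<psi> (exp (- x))) \<le> B" by (intro B) auto
        then have "norm (\<psi> (exp (- x))) \<le> \<bar>B\<bar>" by linarith
        then show "norm (\<psi> (exp (- x)) * g x) \<le> norm (B * g x)"
          by (simp add: abs_mult mult_right_mono)
      qed
    qed
  qed
  \<comment> \<open>Weierstrass: a polynomial in \<open>exp (- t)\<close> integrates to 0 against
    \<open>g\<close>, being a combination of the given moments, so replacing \<phi> by a polynomial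
    within e costs at most e times the L^1 norm of \<open>g\<close>.\<close>
  have "\<bar>LBINT t:{0..}. \<phi> (exp (- t)) * g t\<bar> \<le> e * N" if e: "e > 0" for e
  proof -
    obtain p where p: "real_polynomial_function p" "\<And>x. x \<in> {0..1} \<Longrightarrow> \<bar>\<phi> x - p x\<bar> < e"
      using Stone_Weierstrass_real_polynomial_function[OF compact_Icc \<phi> e] by metis
    obtain a m where am: "p = (\<lambda>x. \<Sum>i\<le>m. a i * x ^ i)"
      using p(1) real_polynomial_function_iff_sum by blast
    have pc: "continuous_on {0..1} p"
      unfolding am by (intro continuous_intros)
    have pz: "(LBINT t:{0..}. p (exp (- t)) * g t) = 0"
    proof -
      have i1: "set_integrable lborel {0..} (\<lambda>t. exp (- (real i * t)) * g t)" for i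
      proof -
        have "set_integrable lborel {0..} (\<lambda>t. exp (- t) ^ i * g t)"
          by (rule int[of "\<lambda>x. x ^ i"]) (intro continuous_intros)
        then show ?thesis by (simp add: exp_of_nat_mult[symmetric])
      qed
      have "(LBINT t:{0..}. p (exp (- t)) * g t)
          = (LBINT t:{0..}. (\<Sum>i\<le>m. a i * (exp (- (real i * t)) * g t)))"
        by (simp add: am sum_distrib_right exp_of_nat_mult[symmetric] mult.assoc)
      also have "\<dots> = (\<Sum>i\<le>m. LBINT t:{0..}. a i * (exp (- (real i * t)) * g t))"
        unfolding set_lebesgue_integral_def scaleR_sum_right
        by (intro Bochner_Integration.integral_sum
              set_integrable_mult_right[OF i1, unfolded set_integrable_def])
      also have "\<dots> = 0"
        by (simp add: moments)
      finally show ?thesis .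
    qed
    have "(LBINT t:{0..}. \<phi> (exp (- t)) * g t)
        = (LBINT t:{0..}. \<phi> (exp (- t)) * g t - p (exp (- t)) * g t)"
      by (subst set_integral_diff(2)[OF int[OF \<phi>] int[OF pc]]) (simp add: pz)
    also have "\<dots> = (LBINT t:{0..}. (\<phi> (exp (- t)) - p (exp (- t))) * g t)"
      by (simp add: algebra_simps)
    also have "\<bar>\<dots>\<bar> \<le> (LBINT t:{0..}. e * \<bar>g t\<bar>)"
    proof -
      have "continuous_on {0..1} (\<lambda>x. \<phi> x - p x)"
        by (intro continuous_intros \<phi> pc)
      note i = int[OF this]
      have "\<bar>LBINT t:{0..}. (\<phi> (exp (- t)) - p (exp (- t))) * g t\<bar>
          \<le> (LBINT t:{0..}. \<bar>(\<phi> (exp (- t)) - p (exp (- t))) * g t\<bar>)"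
        using set_integral_norm_bound[OF i] by simp
      also have "\<dots> \<le> (LBINT t:{0..}. e * \<bar>g t\<bar>)"
      proof (rule set_integral_mono)
        show "set_integrable lborel {0..} (\<lambda>t. \<bar>(\<phi> (exp (- t)) - p (exp (- t))) * g t\<bar>)"
          using set_integrable_norm[OF i] by simp
        show "set_integrable lborel {0..} (\<lambda>t. e * \<bar>g t\<bar>)"
          using set_integrable_norm[OF g] by simp
        show "\<bar>(\<phi> (exp (- t)) - p (exp (- t))) * g t\<bar> \<le> e * \<bar>g t\<bar>" if "t \<in> {0..}" for t
          using p(2)[of "exp (- t)"] that by (simp add: abs_mult mult_right_mono less_imp_le)
      qed
      finally show ?thesis .
    qed
    also have "\<dots> = e * N" by (simp add: N_def)
    finally show ?thesis .
  qed
  note * = this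
  have "\<bar>LBINT t:{0..}. \<phi> (exp (- t)) * g t\<bar> \<le> 0"
  proof (rule field_le_epsilon)
    fix e :: real assume "e > 0"
    have "\<bar>LBINT t:{0..}. \<phi> (exp (- t)) * g t\<bar> \<le> e / (N + 1) * N"
      using \<open>e > 0\<close> N0 by (intro *) simp
    also have "\<dots> \<le> e" using \<open>e > 0\<close> N0 by (simp add: field_simps)
    finally show "\<bar>LBINT t:{0..}. \<phi> (exp (- t)) * g t\<bar> \<le> 0 + e" by simp
  qed
  then show ?thesis by simp
qed

text \<open>The values at s0 + n are the moments of g(t) = e^{-s0 t} d(t) in the variable u =
  e^{-t}, so g is orthogonal to every continuous function of u. Testing it against a cut-off copy of
  itself leaves the integral of a nonnegative continuous function, which must then vanish
  pointwise.\<close>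

theorem lerch:
  fixes d :: "real \<Rightarrow> real"
  assumes cont: "continuous_on {0..} d"
    and int: "set_integrable lborel {0..} (\<lambda>t. exp (- (s0 * t)) * d t)"
    and zero: "\<And>s. s \<ge> s0 \<Longrightarrow> (LBINT t:{0..}. exp (- (s * t)) * d t) = 0"
    and t: "t \<ge> 0"
  shows "d t = 0"
proof -
  define g where "g = (\<lambda>t. exp (- (s0 * t)) * d t)"
  define T where "T = t + 1"
  \<comment> \<open>In the variable u = e^{-t} this is (T - t) g(t) up to time T and 0 afterwards.
    Clamping u at e^{-T} keeps the logarithm away from u = 0, and the weight makes the cut-off
    continuous. By the choice of T the weight is 1 at the given point.\<close>
  define \<phi> where "\<phi> = (\<lambda>u. g (- ln (max u (exp (- T)))) * (T + ln (max u (exp (- T)))))"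
  have T: "T > 0" using t by (simp add: T_def)
  have gc: "continuous_on {0..} g" unfolding g_def by (intro continuous_intros cont)
  have lnle: "ln (max u (exp (- T))) \<le> 0" if "u \<le> 1" for u
  proof -
    have "max u (exp (- T)) \<le> 1" using that T by simp
    then show ?thesis
      by (meson exp_gt_zero ln_le_zero_iff less_max_iff_disj)
  qed
  have \<phi>c: "continuous_on {0..1} \<phi>"
  proof -
    have "max u (exp (- T)) > 0" for u :: real by (simp add: less_max_iff_disj)
    then have "max u (exp (- T)) \<noteq> 0" for u :: real by (metis less_irrefl)
    then show ?thesis
      unfolding \<phi>_def
      by (intro continuous_intros continuous_on_compose2[OF gc]) (auto simp: lnle)
  qed
  have mom: "(LBINT t:{0..}. exp (- (real n * t)) * g t) = 0" for n
  proof -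
    have "(\<lambda>t. exp (- (real n * t)) * g t) = (\<lambda>t. exp (- ((s0 + real n) * t)) * d t)"
      by (auto simp: g_def algebra_simps exp_add[symmetric] mult.assoc[symmetric])
    then show ?thesis using zero[of "s0 + real n"] by simp
  qed
  have "(LBINT t:{0..}. \<phi> (exp (- t)) * g t) = 0"
    by (rule integral_continuous_exp_eq_0[OF _ mom \<phi>c]) (use int in \<open>simp add: g_def\<close>)
  also have "(LBINT t:{0..}. \<phi> (exp (- t)) * g t) = (LBINT t:{0..T}. (T - t) * (g t)\<^sup>2)"
    unfolding set_lebesgue_integral_def
  proof (rule Bochner_Integration.integral_cong[OF refl])
    fix x :: real
    have "max (exp (- x)) (exp (- T)) = exp (- min x T)"
      by (auto simp: max_def min_def)
    then show "indicator {0..} x *\<^sub>R (\<phi> (exp (- x)) * g x) = indicator {0..T} x *\<^sub>R ((T - x) * (g x)\<^sup>2)"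
      using T by (auto simp: \<phi>_def indicator_def power2_eq_square)
  qed
  also have "\<dots> = integral {0..T} (\<lambda>t. (T - t) * (g t)\<^sup>2)"
    by (intro set_borel_integral_eq_integral borel_integrable_atLeastAtMost')
       (auto intro!: continuous_intros continuous_on_subset[OF gc])
  finally have z: "integral {0..T} (\<lambda>t. (T - t) * (g t)\<^sup>2) = 0" .
  have "(T - t) * (g t)\<^sup>2 = 0"
  proof -
    have "continuous_on {0..T} (\<lambda>t. (T - t) * (g t)\<^sup>2)"
      by (auto intro!: continuous_intros continuous_on_subset[OF gc])
    from integral_eq_0_iff[OF this T] z have "\<forall>x\<in>{0..T}. (T - x) * (g x)\<^sup>2 = 0" by simp
    moreover have "t \<in> {0..T}" using t by (simp add: T_def)
    ultimately show ?thesis by blast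
  qed
  then show ?thesis by (simp add: T_def g_def)
qed

section \<open>Laplace transforms and convolutions\<close>

definition laplace :: "(real \<Rightarrow> complex) \<Rightarrow> complex \<Rightarrow> complex" where
  "laplace f s = (LBINT t:{0..}. exp (- (s * of_real t)) * f t)"

text \<open>A Bochner integral that does not converge is 0 by convention, so the value of
  \<open>laplace f s\<close> says nothing without this.\<close>

definition laplace_exists :: "(real \<Rightarrow> complex) \<Rightarrow> complex \<Rightarrow> bool" where
  "laplace_exists f s \<longleftrightarrow> set_integrable lborel {0..} (\<lambda>t. exp (- (s * of_real t)) * f t)"

lemma laplace_add:
  assumes "laplace_exists f s" "laplace_exists g s"
  shows "laplace_exists (\<lambda>t. f t + g t) s" "laplace (\<lambda>t. f t + g t) s = laplace f s + laplace g s"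
  using assms unfolding laplace_def laplace_exists_def by (simp_all add: ring_distribs)

lemma laplace_cmult:
  assumes "laplace_exists f s"
  shows "laplace_exists (\<lambda>t. c * f t) s" "laplace (\<lambda>t. c * f t) s = c * laplace f s"
  using assms unfolding laplace_def laplace_exists_def
  by (simp_all add: mult.left_commute[of _ c])

lemma laplace_sum:
  assumes "\<And>i. i \<in> I \<Longrightarrow> laplace_exists (f i) s"
  shows "laplace_exists (\<lambda>t. \<Sum>i\<in>I. f i t) s"
    and "laplace (\<lambda>t. \<Sum>i\<in>I. f i t) s = (\<Sum>i\<in>I. laplace (f i) s)"
  using assms unfolding laplace_def laplace_exists_def set_integrable_def set_lebesgue_integral_def
  by (simp_all add: sum_distrib_left scaleR_sum_right)

lemma laplace_cong:
  assumes "\<And>t. t \<ge> 0 \<Longrightarrow> f t = g t"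
  shows "laplace_exists f s \<longleftrightarrow> laplace_exists g s" "laplace f s = laplace g s"
proof -
  show "laplace_exists f s \<longleftrightarrow> laplace_exists g s"
    unfolding laplace_exists_def by (rule set_integrable_cong) (use assms in auto)
  show "laplace f s = laplace g s"
    unfolding laplace_def by (rule set_lebesgue_integral_cong) (use assms in auto)
qed

text \<open>Euler's integral for Gamma after the substitution t -> s t.\<close>

lemma integral_powr_exp:
  fixes b s :: real
  assumes b: "b > 0" and s: "s > 0"
  shows "set_integrable lborel {0..} (\<lambda>t. exp (- (s * t)) * t powr (b - 1))"
    and "(LBINT t:{0..}. exp (- (s * t)) * t powr (b - 1)) = Gamma b / s powr b"
proof -
  define f where "f = (\<lambda>t. indicator {0..} t * t powr (b - 1) / exp t :: real)"
  have nn: "(\<integral>\<^sup>+t. ennreal (f t) \<partial>lborel) = Gamma b"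
    using Gamma_conv_nn_integral_real[OF b] by (simp add: f_def)
  have fm: "f \<in> borel_measurable lborel" unfolding f_def by measurable
  have f0: "f t \<ge> 0" for t unfolding f_def by auto
  have "integrable lborel f"
    by (rule integrableI_nonneg[OF fm]) (use f0 nn in auto)
  moreover have "integral\<^sup>L lborel f = Gamma b"
    using b by (subst integral_eq_nn_integral) (use f0 fm nn in \<open>auto simp: Gamma_real_pos less_imp_le\<close>)
  ultimately have 1: "integrable lborel (\<lambda>t. f (0 + s * t))" "Gamma b = s * integral\<^sup>L lborel (\<lambda>t. f (0 + s * t))"
    using lborel_integrable_real_affine[of f s 0] lborel_integral_real_affine[of s f 0] s by auto
  have eq: "f (0 + s * t) = s powr (b - 1) * (indicator {0..} t *\<^sub>R (exp (- (s * t)) * t powr (b - 1)))" for t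
    using s by (auto simp: f_def indicator_def powr_mult exp_minus field_simps zero_le_mult_iff)
  have sp: "s powr (b - 1) \<noteq> 0" using s by simp
  show "set_integrable lborel {0..} (\<lambda>t. exp (- (s * t)) * t powr (b - 1))"
    using 1(1) sp unfolding eq set_integrable_def by simp
  have "Gamma b = s * (s powr (b - 1) * (LBINT t:{0..}. exp (- (s * t)) * t powr (b - 1)))"
    using 1(2) unfolding eq set_lebesgue_integral_def by simp
  also have "\<dots> = s powr b * (LBINT t:{0..}. exp (- (s * t)) * t powr (b - 1))"
    using s by (simp add: powr_diff)
  finally show "(LBINT t:{0..}. exp (- (s * t)) * t powr (b - 1)) = Gamma b / s powr b"
    using s by simp
qed

lemma integral_exp_decay:
  fixes s :: real
  assumes s: "s > 0"
  shows "set_integrable lborel {0..} (\<lambda>t. exp (- (s * t)))" "(LBINT t:{0..}. exp (- (s * t))) = 1 / s"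
proof -
  \<comment> \<open>\<open>0 powr 0\<close> is 0, so the integrand of
    \<open>integral_powr_exp\<close> with b = 1 differs from the exponential at t = 0, and the two
    agree only almost everywhere.\<close>
  have ae: "AE t in lborel. indicator {0..} t *\<^sub>R (exp (- (s * t)) * t powr (1 - 1))
      = indicator {0..} t *\<^sub>R exp (- (s * t))"
    by (rule eventually_mono[OF AE_lborel_singleton[of 0]]) auto
  have *: "integrable lborel (\<lambda>t. indicator {0..} t *\<^sub>R (exp (- (s * t)) * t powr (1 - 1)))
      \<longleftrightarrow> integrable lborel (\<lambda>t. indicator {0..} t *\<^sub>R exp (- (s * t)))"
    "integral\<^sup>L lborel (\<lambda>t. indicator {0..} t *\<^sub>R (exp (- (s * t)) * t powr (1 - 1)))
      = integral\<^sup>L lborel (\<lambda>t. indicator {0..} t *\<^sub>R exp (- (s * t)))"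
    by (rule integrable_cong_AE[OF _ _ ae] integral_cong_AE[OF _ _ ae]; measurable)+
  show "set_integrable lborel {0..} (\<lambda>t. exp (- (s * t)))" "(LBINT t:{0..}. exp (- (s * t))) = 1 / s"
    using integral_powr_exp[of 1 s] s * unfolding set_integrable_def set_lebesgue_integral_def by auto
qed

lemma set_borel_measurable_half_line:
  fixes f :: "real \<Rightarrow> complex"
  assumes "continuous_on {0..} f"
  shows "set_borel_measurable lborel {0..} f"
  using borel_measurable_continuous_on_indicator[of "{0..}" f] assms
  unfolding set_borel_measurable_def by simp

lemma laplace_bounded:
  fixes f :: "real \<Rightarrow> complex"
  assumes f: "continuous_on {0..} f" and M: "\<And>t. t \<ge> 0 \<Longrightarrow> norm (f t) \<le> M" and s: "Re s > 0"
  shows "laplace_exists f s" "norm (laplace f s) \<le> M / Re s"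
proof -
  have i: "set_integrable lborel {0..} (\<lambda>t. M * exp (- (Re s * t)))"
    using integral_exp_decay(1)[OF s] by simp
  have le: "norm (exp (- (s * of_real t)) * f t) \<le> M * exp (- (Re s * t))" if "t \<ge> 0" for t
    using M[OF that] by (simp add: norm_mult mult.commute mult_right_mono)
  show ex: "laplace_exists f s"
    unfolding laplace_exists_def
  proof (rule set_integrable_bound[OF i])
    show "set_borel_measurable lborel {0..} (\<lambda>t. exp (- (s * of_real t)) * f t)"
      by (intro set_borel_measurable_half_line continuous_intros f)
    show "AE x in lborel. x \<in> {0..} \<longrightarrow>
        norm (exp (- (s * complex_of_real x)) * f x) \<le> norm (M * exp (- (Re s * x)))"
      using order_trans[OF le abs_ge_self] by (intro AE_I2) auto
  qed
  have "norm (laplace f s) \<le> (LBINT t:{0..}. norm (exp (- (s * of_real t)) * f t))"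
    using ex unfolding laplace_def laplace_exists_def by (rule set_integral_norm_bound)
  also have "\<dots> \<le> (LBINT t:{0..}. M * exp (- (Re s * t)))"
    using ex unfolding laplace_exists_def
    by (intro set_integral_mono set_integrable_norm i le) auto
  also have "\<dots> = M / Re s" using integral_exp_decay(2)[OF s] by simp
  finally show "norm (laplace f s) \<le> M / Re s" .
qed

text \<open>The transform of the tail is a shifted transform damped by e^{-sT}. This gives the
  truncation error in \<open>holomorphic_on_laplace\<close> and the variation of constants identity
  in \<open>unstable_bounded_solution\<close>.\<close>

lemma laplace_split:
  assumes y: "continuous_on {0..} y" and M: "\<And>t. t \<ge> 0 \<Longrightarrow> norm (y t) \<le> M"
    and s: "Re s > 0" and T: "T \<ge> 0"
  shows "laplace y s = (LBINT t:{0..T}. exp (- (s * of_real t)) * y t)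
    + exp (- (s * of_real T)) * laplace (\<lambda>t. y (T + t)) s"
proof -
  define h where "h = (\<lambda>t. exp (- (s * of_real t)) * y t)"
  have int: "set_integrable lborel {0..} h"
    using laplace_bounded(1)[OF y M s] by (simp add: laplace_exists_def h_def)
  have "laplace y s = (LBINT t:{0..T} \<union> {T<..}. h t)"
    unfolding laplace_def h_def
    by (rule arg_cong2[where f = "\<lambda>A f. set_lebesgue_integral lborel A f"]) (use T in auto)
  also have "\<dots> = (LBINT t:{0..T}. h t) + (LBINT t:{T<..}. h t)"
    by (rule set_integral_Un) (use T in \<open>auto intro!: set_integrable_subset[OF int]\<close>)
  also have "(LBINT t:{T<..}. h t) = (LBINT t. exp (- (s * of_real T)) * (indicator {0<..} t *\<^sub>R (exp (- (s * of_real t)) * y (T + t))))"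
    unfolding set_lebesgue_integral_def h_def
    by (subst lborel_integral_real_affine[of 1 _ T])
       (auto simp: indicator_def exp_add[symmetric] algebra_simps intro!: Bochner_Integration.integral_cong)
  also have "\<dots> = exp (- (s * of_real T)) * (LBINT t. indicator {0<..} t *\<^sub>R (exp (- (s * of_real t)) * y (T + t)))"
    by (rule integral_mult_right_zero)
  also have "(LBINT t. indicator {0<..} t *\<^sub>R (exp (- (s * of_real t)) * y (T + t))) = laplace (\<lambda>t. y (T + t)) s"
  proof -
    have ym: "(\<lambda>t. indicator {0..} t *\<^sub>R (exp (- (s * of_real t)) * y (T + t))) \<in> borel_measurable borel"
      by (rule borel_measurable_continuous_on_indicator)
         (use T in \<open>auto intro!: continuous_intros continuous_on_compose2[OF y]\<close>)
    have "(\<lambda>t. indicator {0<..} t *\<^sub>R (indicator {0..} t *\<^sub>R (exp (- (s * of_real t)) * y (T + t)))) \<in> borel_measurable borel"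
      using ym by measurable
    then have ym': "(\<lambda>t. indicator {0<..} t *\<^sub>R (exp (- (s * of_real t)) * y (T + t))) \<in> borel_measurable borel"
      by (rule measurable_cong[THEN iffD1, rotated]) (auto simp: indicator_def)
    show ?thesis
      unfolding laplace_def set_lebesgue_integral_def
      by (rule integral_cong_AE)
         (use ym ym' in \<open>auto intro!: eventually_mono[OF AE_lborel_singleton[of 0]] simp: indicator_def\<close>)
  qed
  finally show ?thesis by (simp add: h_def)
qed

lemma laplace_L1:
  fixes q :: "real \<Rightarrow> complex"
  assumes q: "set_integrable lborel {0..} q" and s: "Re s \<ge> 0"
  shows "laplace_exists q s"
  unfolding laplace_exists_def
proof (rule set_integrable_bound[OF q])
  have "set_borel_measurable lborel {0..} (\<lambda>t. exp (- (s * of_real t)))"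
    by (intro set_borel_measurable_half_line continuous_intros)
  moreover have "set_borel_measurable lborel {0..} q"
    using q unfolding set_integrable_def set_borel_measurable_def by auto
  ultimately have "(\<lambda>t. (indicator {0..} t *\<^sub>R exp (- (s * of_real t))) * (indicator {0..} t *\<^sub>R q t))
      \<in> borel_measurable lborel"
    unfolding set_borel_measurable_def by (rule borel_measurable_times)
  also have "(\<lambda>t. (indicator {0..} t *\<^sub>R exp (- (s * of_real t))) * (indicator {0..} t *\<^sub>R q t))
      = (\<lambda>t. indicator {0..} t *\<^sub>R (exp (- (s * of_real t)) * q t))"
    by (auto simp: indicator_def)
  finally show "set_borel_measurable lborel {0..} (\<lambda>t. exp (- (s * of_real t)) * q t)"
    unfolding set_borel_measurable_def .
  show "AE x in lborel. x \<in> {0..} \<longrightarrow> norm (exp (- (s * complex_of_real x)) * q x) \<le> norm (q x)"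
    using s by (auto simp: norm_mult intro!: mult_left_le_one_le AE_I2)
qed

lemma laplace_exp:
  assumes "Re (s - z) > 0"
  shows "laplace_exists (\<lambda>t. exp (z * of_real t)) s" "laplace (\<lambda>t. exp (z * of_real t)) s = 1 / (s - z)"
proof -
  define c where "c = s - z"
  have e: "exp (- (s * of_real t)) * exp (z * of_real t) = exp (- (c * of_real t))" for t
    by (simp add: c_def mult_exp_exp algebra_simps)
  have c: "Re c > 0" using assms by (simp add: c_def)
  have "laplace_exists (\<lambda>_. 1) c"
    by (rule laplace_bounded[where M = 1]) (use c in auto)
  then have int: "set_integrable lborel {0..} (\<lambda>t. exp (- (c * of_real t)))"
    by (simp add: laplace_exists_def)
  then show "laplace_exists (\<lambda>t. exp (z * of_real t)) s"
    by (simp add: laplace_exists_def e)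
  have lim: "((\<lambda>n. LBINT t:{0..real n}. exp (- (c * of_real t))) \<longlongrightarrow> (LBINT t:{0..}. exp (- (c * of_real t)))) sequentially"
    (is "(?I \<longlongrightarrow> _) _")
  proof -
    have U: "(\<Union>n. {0..real n}) = {0..}" 
      using real_arch_simple by fastforce
    show ?thesis
      using set_integral_cont_up[of "\<lambda>n. {0..real n}" lborel "\<lambda>t. exp (- (c * of_real t))"] int
      unfolding U by (auto simp: incseq_def)
  qed
  have d: "((\<lambda>t. - exp (- (c * of_real t)) / c) has_vector_derivative exp (- (c * of_real x))) (at x within S)"
    for x S
    by (rule has_vector_derivative_real_field) (use c in \<open>auto intro!: derivative_eq_intros\<close>)
  have "?I n = (1 - exp (- (c * of_real (real n)))) / c" for n
  proof -
    have "((\<lambda>t. exp (- (c * of_real t))) has_integral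
        (- exp (- (c * of_real (real n))) / c) - (- exp (- (c * of_real 0)) / c)) {0..real n}"
      by (rule fundamental_theorem_of_calculus[OF _ d]) simp
    then show ?thesis
      by (simp add: set_borel_integral_eq_integral[OF borel_integrable_atLeastAtMost'] continuous_intros
          integral_unique diff_divide_distrib)
  qed
  moreover have "((\<lambda>n. (1 - exp (- (c * of_real (real n)))) / c) \<longlongrightarrow> (1 - 0) / c) sequentially"
  proof (intro tendsto_intros)
    have "((\<lambda>n. exp (- (Re c * real n))) \<longlongrightarrow> 0) sequentially"
      using c by real_asymp
    then show "((\<lambda>n. exp (- (c * of_real (real n)))) \<longlongrightarrow> 0) sequentially"
      by (subst tendsto_norm_zero_iff[symmetric]) simp
    show "c \<noteq> 0" using c by auto
  qed
  ultimately have "(LBINT t:{0..}. exp (- (c * of_real t))) = 1 / c"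
    using LIMSEQ_unique[OF lim] by simp
  then show "laplace (\<lambda>t. exp (z * of_real t)) s = 1 / (s - z)"
    by (simp add: laplace_def e c_def)
qed

section \<open>Convolution\<close>

lemma integrable_convolution:
  fixes K F :: "real \<Rightarrow> complex"
  assumes K: "integrable lborel K" and F: "integrable lborel F"
  shows "integrable (lborel \<Otimes>\<^sub>M lborel) (\<lambda>(u, t). K u * F (t - u))"
    and "(LBINT t. LBINT u. K u * F (t - u)) = integral\<^sup>L lborel K * integral\<^sup>L lborel F"
proof -
  have [measurable]: "K \<in> borel_measurable borel" "F \<in> borel_measurable borel"
    using K F by auto
  have F': "integrable lborel (\<lambda>t. F (t - u))" "(LBINT t. F (t - u)) = integral\<^sup>L lborel F" for u
    using lborel_integrable_real_affine[OF F, of 1 "- u"] lborel_integral_real_affine[of 1 F "- u"] by simp_all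
  \<comment> \<open>Translation invariance makes the inner integral of norms independent of u, so
    absolute integrability over the plane reduces to that of \<open>K\<close>.\<close>
  have nF: "(LBINT t. norm (F (t - u))) = (LBINT t. norm (F t))" for u
    using lborel_integral_real_affine[of 1 "\<lambda>t. norm (F t)" "- u"] by simp
  show int: "integrable (lborel \<Otimes>\<^sub>M lborel) (\<lambda>(u, t). K u * F (t - u))"
  proof (rule lborel_pair.Fubini_integrable)
    show "(\<lambda>(u, t). K u * F (t - u)) \<in> borel_measurable (lborel \<Otimes>\<^sub>M lborel)"
      by measurable
    show "integrable lborel (\<lambda>x. LBINT y. norm (case (x, y) of (u, t) \<Rightarrow> K u * F (t - u)))"
      using K by (simp add: norm_mult nF)
    show "AE x in lborel. integrable lborel (\<lambda>y. case (x, y) of (u, t) \<Rightarrow> K u * F (t - u))"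
      using F' by simp
  qed
  show "(LBINT t. LBINT u. K u * F (t - u)) = integral\<^sup>L lborel K * integral\<^sup>L lborel F"
    using lborel_pair.Fubini_integral[OF int] F' by simp
qed

definition conv :: "(real \<Rightarrow> complex) \<Rightarrow> (real \<Rightarrow> complex) \<Rightarrow> real \<Rightarrow> complex" where
  "conv k f t = (LBINT u:{0..t}. k u * f (t - u))"

text \<open>The weight e^{-st} is multiplicative along t = u + (t - u), so it distributes over the
  two factors; extending them by 0 to negative arguments turns the integral over [0, t] into a
  convolution on the line.\<close>

lemma laplace_conv:
  assumes k: "laplace_exists k s" and f: "laplace_exists f s"
  shows "laplace_exists (conv k f) s" "laplace (conv k f) s = laplace k s * laplace f s"
proof -
  define K where "K = (\<lambda>t. indicator {0..} t *\<^sub>R (exp (- (s * of_real t)) * k t))"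
  define F where "F = (\<lambda>t. indicator {0..} t *\<^sub>R (exp (- (s * of_real t)) * f t))"
  have K: "integrable lborel K" and F: "integrable lborel F"
    using k f by (simp_all add: laplace_exists_def set_integrable_def K_def F_def)
  have eq: "(LBINT u. K u * F (t - u)) = indicator {0..} t *\<^sub>R (exp (- (s * of_real t)) * conv k f t)" for t
  proof -
    have "K u * F (t - u) = (indicator {0..} t *\<^sub>R exp (- (s * of_real t))) * (indicator {0..t} u *\<^sub>R (k u * f (t - u)))" for u
      by (auto simp: K_def F_def indicator_def exp_minus exp_add[symmetric] exp_diff field_simps)
    then have "(LBINT u. K u * F (t - u))
        = (indicator {0..} t *\<^sub>R exp (- (s * of_real t))) * (LBINT u. indicator {0..t} u *\<^sub>R (k u * f (t - u)))"
      by (simp only: integral_mult_right_zero)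
    then show ?thesis
      by (simp add: conv_def set_lebesgue_integral_def)
  qed
  note 1 = lborel_pair.integrable_snd[OF integrable_convolution(1)[OF K F]]
  show "laplace_exists (conv k f) s"
    using 1 by (simp add: laplace_exists_def set_integrable_def eq)
  show "laplace (conv k f) s = laplace k s * laplace f s"
    using integrable_convolution(2)[OF K F] unfolding eq
    by (simp add: laplace_def set_lebesgue_integral_def K_def F_def)
qed

lemma conv_integrable:
  fixes k f :: "real \<Rightarrow> complex"
  assumes k: "set_integrable lborel {0..t} k"
    and f: "continuous_on {0..} f"
  shows "set_integrable lborel {0..t} (\<lambda>u. k u * f (t - u))"
proof -
  have c: "continuous_on {0..t} (\<lambda>u. f (t - u))"
    by (rule continuous_on_compose2[OF f]) (auto intro!: continuous_intros)
  obtain B where B: "\<And>u. u \<in> {0..t} \<Longrightarrow> norm (f (t - u)) \<le> B"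
    using continuous_on_compact_bound[OF compact_Icc c] by blast
  have "set_integrable lborel {0..t} (\<lambda>u. of_real B * k u)"
    using k by simp
  then show ?thesis
  proof (rule set_integrable_bound)
    have "(\<lambda>u. (indicator {0..t} u *\<^sub>R k u) * (indicator {0..t} u *\<^sub>R f (t - u))) \<in> borel_measurable lborel"
      using k borel_measurable_continuous_on_indicator[OF _ c] unfolding set_integrable_def
      by (intro borel_measurable_times) auto
    also have "(\<lambda>u. (indicator {0..t} u *\<^sub>R k u) * (indicator {0..t} u *\<^sub>R f (t - u)))
       = (\<lambda>u. indicator {0..t} u *\<^sub>R (k u * f (t - u)))"
      by (auto simp: indicator_def)
    finally show "set_borel_measurable lborel {0..t} (\<lambda>u. k u * f (t - u))"
      unfolding set_borel_measurable_def .
    show "AE x in lborel. x \<in> {0..t} \<longrightarrow> norm (k x * f (t - x)) \<le> norm (complex_of_real B * k x)"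
    proof (intro AE_I2 impI)
      fix x assume "x \<in> {0..t}"
      from B[OF this] have "norm (f (t - x)) \<le> \<bar>B\<bar>" by linarith
      then show "norm (k x * f (t - x)) \<le> norm (complex_of_real B * k x)"
        by (simp add: norm_mult mult.commute[of "norm (k x)"] mult_right_mono)
    qed
  qed
qed

text \<open>The kernels to be convolved may be unbounded at 0, like t^{\<alpha>-1}, so
  \<open>k\<close> is only locally integrable. Continuity comes from dominated convergence along
  sequences, with all regularity taken from \<open>f\<close>.\<close>

lemma continuous_on_conv:
  fixes k f :: "real \<Rightarrow> complex"
  assumes k: "\<And>T. set_integrable lborel {0..T} k"
    and f: "continuous_on {0..} f"
  shows "continuous_on {0..} (conv k f)"
  unfolding continuous_on_sequentially
proof (intro allI ballI impI, elim conjE)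
  fix x :: "nat \<Rightarrow> real" and t :: real assume t: "t \<in> {0..}" and x: "\<forall>n. x n \<in> {0..}" and lim: "x \<longlonglongrightarrow> t"
  obtain T where T: "\<And>n. \<bar>x n\<bar> \<le> T"
    using convergent_imp_Bseq[of x] lim unfolding Bseq_def convergent_def by auto
  have "continuous_on {0..T} f" by (rule continuous_on_subset[OF f]) auto
  then obtain M where M: "\<And>r. r \<in> {0..T} \<Longrightarrow> norm (f r) \<le> M"
    using continuous_on_compact_bound[OF compact_Icc] by blast
  have "0 \<le> T" using order_trans[OF abs_ge_zero T[of 0]] .
  then have "norm (f 0) \<le> M" by (intro M) simp
  then have M0: "M \<ge> 0" by (rule order_trans[OF norm_ge_zero])
  have m: "(\<lambda>u. indicator {0..t} u *\<^sub>R (k u * f (t - u))) \<in> borel_measurable lborel" for t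
    using conv_integrable[OF k f] unfolding set_integrable_def by auto
  have "(\<lambda>n. integral\<^sup>L lborel (\<lambda>u. indicator {0..x n} u *\<^sub>R (k u * f (x n - u))))
      \<longlonglongrightarrow> integral\<^sup>L lborel (\<lambda>u. indicator {0..t} u *\<^sub>R (k u * f (t - u)))"
  proof (rule integral_dominated_convergence[where w = "\<lambda>u. M * norm (indicator {0..T} u *\<^sub>R k u)"])
    show "integrable lborel (\<lambda>u. M * norm (indicator {0..T} u *\<^sub>R k u))"
      by (rule integrable_mult_right, rule integrable_norm) (use k[of T] in \<open>simp add: set_integrable_def\<close>)
    show "AE u in lborel. norm (indicator {0..x n} u *\<^sub>R (k u * f (x n - u)))
        \<le> M * norm (indicator {0..T} u *\<^sub>R k u)" for n
    proof (rule AE_I2)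
      fix u
      show "norm (indicator {0..x n} u *\<^sub>R (k u * f (x n - u))) \<le> M * norm (indicator {0..T} u *\<^sub>R k u)"
        using M[of "x n - u"] abs_le_D1[OF T[of n]] M0
        by (auto simp: indicator_def norm_mult mult.commute[of M] mult_left_mono)
    qed
    show "AE u in lborel. (\<lambda>n. indicator {0..x n} u *\<^sub>R (k u * f (x n - u)))
        \<longlonglongrightarrow> indicator {0..t} u *\<^sub>R (k u * f (t - u))"
    \<comment> \<open>Only at u = t can the moving indicator fail to converge.\<close>
    proof (rule eventually_mono[OF AE_lborel_singleton[of t]])
      fix u assume "u \<noteq> t"
      then consider "u < 0 \<or> u > t" | "0 \<le> u" "u < t" by linarith
      then show "(\<lambda>n. indicator {0..x n} u *\<^sub>R (k u * f (x n - u)))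
          \<longlonglongrightarrow> indicator {0..t} u *\<^sub>R (k u * f (t - u))"
      proof cases
        case 1
        have "eventually (\<lambda>n. u < 0 \<or> x n < u) sequentially"
          using 1 order_tendstoD(2)[OF lim, of u] by (auto elim: eventually_mono)
        then have "eventually (\<lambda>n. indicator {0..x n} u *\<^sub>R (k u * f (x n - u)) = 0) sequentially"
          by eventually_elim auto
        moreover have "indicator {0..t} u *\<^sub>R (k u * f (t - u)) = 0" using 1 by auto
        ultimately show ?thesis by (simp only: tendsto_eventually)
      next
        case 2
        have ev: "eventually (\<lambda>n. u < x n) sequentially"
          using order_tendstoD(1)[OF lim 2(2)] .
        then have "eventually (\<lambda>n. k u * f (x n - u) = indicator {0..x n} u *\<^sub>R (k u * f (x n - u))) sequentially"
          by eventually_elim (use 2 in auto)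
        moreover have "(\<lambda>n. k u * f (x n - u)) \<longlonglongrightarrow> k u * f (t - u)"
        proof (rule tendsto_mult[OF tendsto_const], rule continuous_on_tendsto_compose[OF f])
          show "(\<lambda>n. x n - u) \<longlonglongrightarrow> t - u" by (intro tendsto_intros lim)
          show "eventually (\<lambda>n. x n - u \<in> {0..}) sequentially"
            by (rule eventually_mono[OF ev]) auto
        qed (use 2 in auto)
        ultimately have "(\<lambda>n. indicator {0..x n} u *\<^sub>R (k u * f (x n - u))) \<longlonglongrightarrow> k u * f (t - u)"
          by (rule Lim_transform_eventually[rotated])
        then show ?thesis using 2 by simp
      qed
    qed
  qed (use m in auto)
  then show "(conv k f \<circ> x) \<longlonglongrightarrow> conv k f t"
    by (simp add: conv_def set_lebesgue_integral_def comp_def)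
qed

text \<open>Young's inequality for L^1 and L^infinity: this is where integrability of a kernel on
  the whole half-line becomes boundedness of a solution.\<close>

lemma conv_L1_bounded:
  fixes k f :: "real \<Rightarrow> complex"
  assumes k: "set_integrable lborel {0..} k"
    and f: "continuous_on {0..} f" and M: "\<And>t. t \<ge> 0 \<Longrightarrow> norm (f t) \<le> M"
    and t: "t \<ge> 0"
  shows "norm (conv k f t) \<le> M * (LBINT u:{0..}. norm (k u))"
proof -
  have kt: "set_integrable lborel {0..t} k"
    by (rule set_integrable_subset[OF k]) auto
  have M0: "M \<ge> 0" using M[of 0] norm_ge_zero order_trans by blast
  note i = conv_integrable[OF kt f]
  have "norm (conv k f t) \<le> (LBINT u:{0..t}. norm (k u * f (t - u)))"
    unfolding conv_def by (rule set_integral_norm_bound[OF i])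
  also have "\<dots> \<le> (LBINT u:{0..}. M * norm (k u))"
    unfolding set_lebesgue_integral_def
  proof (rule Bochner_Integration.integral_mono)
    show "integrable lborel (\<lambda>u. indicator {0..t} u *\<^sub>R norm (k u * f (t - u)))"
      using set_integrable_norm[OF i] unfolding set_integrable_def .
    show "integrable lborel (\<lambda>u. indicator {0..} u *\<^sub>R (M * norm (k u)))"
      using set_integrable_mult_right[OF set_integrable_norm[OF k], of M] unfolding set_integrable_def by simp
    show "indicator {0..t} u *\<^sub>R norm (k u * f (t - u)) \<le> indicator {0..} u *\<^sub>R (M * norm (k u))" for u
      using M[of "t - u"] M0 by (auto simp: indicator_def norm_mult mult.commute[of M] mult_left_mono)
  qed
  also have "\<dots> = M * (LBINT u:{0..}. norm (k u))" by simp
  finally show ?thesis .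
qed

section \<open>Mittag-Leffler series\<close>

text \<open>Only the stretch [R, R + 1] of Euler's integral is kept. Since R is free, this already
  shows that Gamma outgrows every geometric sequence.\<close>

lemma Gamma_lower_bound:
  fixes x R :: real
  assumes x: "x \<ge> 1" and R: "R > 0"
  shows "R powr (x - 1) * exp (- (R + 1)) \<le> Gamma x"
proof -
  have 1: "((\<lambda>t. t powr (x - 1) / exp t) has_integral Gamma x) {0..}"
    by (rule Gamma_integral_real) (use x in simp)
  have 2: "((\<lambda>t. if t \<in> {R..R+1} then R powr (x - 1) * exp (- (R + 1)) else 0) has_integral
      (R powr (x - 1) * exp (- (R + 1)))) {0..}"
  proof -
    have "((\<lambda>t. R powr (x - 1) * exp (- (R + 1))) has_integral
      (R + 1 - R) *\<^sub>R (R powr (x - 1) * exp (- (R + 1)))) {R..R+1}"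
      using has_integral_const_real[of _ R "R + 1"] by simp
    moreover have "{0..} \<inter> {R..R+1} = {R..R+1}" using R by auto
    ultimately show ?thesis
      by (subst has_integral_restrict_Int) (simp add: Int_commute)
  qed
  show ?thesis
  proof (rule has_integral_le[OF 2 1])
    fix t :: real assume "t \<in> {0..}"
    show "(if t \<in> {R..R+1} then R powr (x - 1) * exp (- (R + 1)) else 0) \<le> t powr (x - 1) / exp t"
    proof (cases "t \<in> {R..R+1}")
      case True
      then have "R powr (x - 1) * exp (- (R + 1)) \<le> t powr (x - 1) * exp (- t)"
        using R x by (intro mult_mono powr_mono2) auto
      then show ?thesis using True by (simp add: exp_minus field_simps)
    qed auto
  qed
qed

lemma summable_power_over_Gamma:
  fixes a b C :: real
  assumes a: "a > 0" and b: "b > 0" and C: "C \<ge> 0"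
  shows "summable (\<lambda>k. C ^ k / Gamma (a * real k + b))"
proof -
  \<comment> \<open>Chosen so that R^a = 2C + 1: the resulting majorant is geometric with ratio C /
    (2C + 1), at most 1/2. The summand 1 keeps the base positive for C = 0.\<close>
  define R where "R = (2 * C + 1) powr (1 / a)"
  have R: "R > 0" using C by (simp add: R_def)
  have Ra: "R powr a = 2 * C + 1" using a C by (simp add: R_def powr_powr)
  define K where "K = exp (R + 1) * R powr (1 - b)"
  have sg: "summable (\<lambda>k. K * (1 / 2) ^ k)"
    by (intro summable_mult summable_geometric) simp
  have "eventually (\<lambda>k. norm (C ^ k / Gamma (a * real k + b)) \<le> K * (1 / 2) ^ k) sequentially"
  proof -
    obtain N where N: "real N > (1 - b) / a" using reals_Archimedean2 by blast
    show ?thesis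
    proof (rule eventually_sequentiallyI[of N])
      fix k assume "k \<ge> N"
      then have "real k > (1 - b) / a" using N by (meson less_le_trans of_nat_le_iff)
      then have x1: "a * real k + b \<ge> 1" using a by (simp add: field_simps)
      have G: "Gamma (a * real k + b) > 0" using x1 by (intro Gamma_real_pos) simp
      have "R powr (a * real k + b - 1) = (2 * C + 1) ^ k / R powr (1 - b)"
      proof -
        have "R powr (a * real k + b - 1) = R powr (a * real k - (1 - b))" by (simp add: algebra_simps)
        also have "\<dots> = (R powr a) powr real k / R powr (1 - b)" 
          by (simp only: powr_diff powr_powr)
        also have "(R powr a) powr real k = (2 * C + 1) ^ k"
          using C by (simp add: Ra powr_realpow)
        finally show ?thesis .
      qed
      then have "(2 * C + 1) ^ k / K \<le> Gamma (a * real k + b)"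
        using Gamma_lower_bound[OF x1 R] unfolding K_def exp_minus by (simp add: divide_inverse mult_ac)
      then have "1 / Gamma (a * real k + b) \<le> K / (2 * C + 1) ^ k"
        using C G R by (simp add: field_simps K_def)
      then have "C ^ k * (1 / Gamma (a * real k + b)) \<le> C ^ k * (K / (2 * C + 1) ^ k)"
        using C by (intro mult_left_mono) auto
      also have "\<dots> = K * (C / (2 * C + 1)) ^ k" by (simp add: power_divide)
      also have "\<dots> \<le> K * (1 / 2) ^ k"
        using C R by (intro mult_left_mono power_mono) (auto simp: K_def field_simps)
      finally show "norm (C ^ k / Gamma (a * real k + b)) \<le> K * (1 / 2) ^ k"
        using C G by simp
    qed
  qed
  then show ?thesis by (rule summable_comparison_test_ev[OF _ sg])
qed

text \<open>General coefficients let each entry of a matrix Mittag-Leffler function be one scalar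
  power series: \<open>c k\<close> will be an entry of A^k, about which the estimates use only a
  bound C^k.\<close>

definition ml_series :: "real \<Rightarrow> real \<Rightarrow> (nat \<Rightarrow> real) \<Rightarrow> real \<Rightarrow> real" where
  "ml_series a b c x = (\<Sum>k. c k / Gamma (a * real k + b) * x ^ k)"

lemma ml_series_summable:
  fixes a b C :: real
  assumes a: "a > 0" and b: "b > 0" and c: "\<And>k. \<bar>c k\<bar> \<le> C ^ k"
  shows "summable (\<lambda>k. \<bar>c k / Gamma (a * real k + b) * x ^ k\<bar>)"
proof (rule summable_comparison_test')
  have C: "C \<ge> 0" using c[of 1] by simp
  show "summable (\<lambda>k. (C * \<bar>x\<bar>) ^ k / Gamma (a * real k + b))"
    by (rule summable_power_over_Gamma[OF a b]) (use C in simp)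
  show "norm \<bar>c k / Gamma (a * real k + b) * x ^ k\<bar> \<le> (C * \<bar>x\<bar>) ^ k / Gamma (a * real k + b)" for k
  proof -
    have G: "Gamma (a * real k + b) > 0" using a b by (intro Gamma_real_pos add_nonneg_pos) auto
    have "\<bar>c k\<bar> * \<bar>x\<bar> ^ k \<le> C ^ k * \<bar>x\<bar> ^ k"
      by (intro mult_right_mono c) auto
    then show ?thesis using G by (simp add: abs_mult power_abs power_mult_distrib divide_right_mono)
  qed
qed

lemma continuous_on_ml_series:
  fixes a b C :: real
  assumes "a > 0" "b > 0" "\<And>k. \<bar>c k\<bar> \<le> C ^ k"
  shows "continuous_on UNIV (ml_series a b c)"
proof -
  have "isCont (ml_series a b c) x" for x
    unfolding ml_series_def
    by (rule isCont_powser_converges_everywhere)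
       (rule summable_rabs_cancel[OF ml_series_summable[OF assms]])
  then show ?thesis by (simp add: continuous_on_eq_continuous_at)
qed

text \<open>The Gamma factor produced by each power of t cancels the one in the series, leaving a
  series dominated by a geometric one with ratio C / s^a < 1. The same majorant bounds the sum of
  the integrals of absolute values, which justifies exchanging sum and integral.\<close>

lemma integral_exp_ml_series:
  fixes a b s C :: real
  assumes a: "a > 0" and b: "b > 0" and s: "s > 0" and sC: "s powr a > C"
    and c: "\<And>k. \<bar>c k\<bar> \<le> C ^ k"
  shows "set_integrable lborel {0..} (\<lambda>t. exp (- (s * t)) * (t powr (b - 1) * ml_series a b c (t powr a)))"
    and "(\<lambda>k. c k / s powr (a * real k + b)) sums
      (LBINT t:{0..}. exp (- (s * t)) * (t powr (b - 1) * ml_series a b c (t powr a)))"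
proof -
  define G where "G = (\<lambda>k. Gamma (a * real k + b))"
  have pos: "a * real k + b > 0" for k using a b by (intro add_nonneg_pos) auto
  have G: "G k > 0" for k unfolding G_def by (intro Gamma_real_pos pos)
  define h where "h = (\<lambda>k t. indicator {0..} t *\<^sub>R (exp (- (s * t)) * t powr (a * real k + b - 1)) :: real)"
  have h: "integrable lborel (h k)" "integral\<^sup>L lborel (h k) = G k / s powr (a * real k + b)" for k
    using integral_powr_exp[OF pos s, of k]
    by (simp_all add: h_def G_def set_integrable_def set_lebesgue_integral_def)
  have h0: "h k t \<ge> 0" for k t by (simp add: h_def)
  define f where "f = (\<lambda>k t. c k / G k * h k t)"
  have fi: "integrable lborel (f k)" for k unfolding f_def using h by simp
  have nf: "norm (f k t) = \<bar>c k\<bar> / G k * h k t" for k t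
    using G[of k] h0 by (simp add: f_def abs_mult)
  have fI: "integral\<^sup>L lborel (f k) = c k / s powr (a * real k + b)" for k
    using h G[of k] by (simp add: f_def)
  have nfI: "(LBINT t. norm (f k t)) = \<bar>c k\<bar> / s powr (a * real k + b)" for k
    using h G[of k] unfolding nf by simp
  have eqf: "f k t = (c k / G k * (t powr a) ^ k) * (indicator {0..} t * (exp (- (s * t)) * t powr (b - 1)))" for k t
  proof (cases "t > 0")
    case True
    then have "t powr (a * real k + b - 1) = (t powr a) ^ k * t powr (b - 1)"
      by (simp add: powr_add[symmetric] powr_powr[symmetric] powr_realpow[symmetric] add_diff_eq)
         (simp add: powr_powr powr_add[symmetric] add_diff_eq)
    then show ?thesis by (simp add: f_def h_def)
  qed (auto simp: f_def h_def indicator_def)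
  have sm1: "summable (\<lambda>k. norm (f k t))" for t
  proof -
    have "norm (f k t) = \<bar>c k / G k * (t powr a) ^ k\<bar> * \<bar>indicator {0..} t * (exp (- (s * t)) * t powr (b - 1))\<bar>" for k
      by (simp only: eqf real_norm_def abs_mult)
    then show ?thesis
      using summable_mult2[OF ml_series_summable[OF a b c]] by (simp only: G_def)
  qed
  have sm2: "summable (\<lambda>k. LBINT t. norm (f k t))"
    unfolding nfI
  proof (rule summable_comparison_test')
    have C: "C \<ge> 0" using c[of 1] by simp
    show "summable (\<lambda>k. (C / s powr a) ^ k / s powr b)"
      using C sC by (intro summable_divide summable_geometric) (simp add: divide_less_eq)
    show "norm (\<bar>c k\<bar> / s powr (a * real k + b)) \<le> (C / s powr a) ^ k / s powr b" for k
    proof -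
      have "s powr (a * real k + b) = (s powr a) ^ k * s powr b"
        using s by (simp add: powr_add powr_powr[symmetric] powr_realpow)
      then show ?thesis using c[of k] s
        by (simp add: power_divide divide_right_mono)
    qed
  qed
  have sumf: "(\<Sum>k. f k t) = indicator {0..} t *\<^sub>R (exp (- (s * t)) * (t powr (b - 1) * ml_series a b c (t powr a)))" for t
  proof -
    have "(\<Sum>k. f k t) = ml_series a b c (t powr a) * (indicator {0..} t * (exp (- (s * t)) * t powr (b - 1)))"
      unfolding eqf ml_series_def G_def
      by (rule suminf_mult2[symmetric]) (rule summable_rabs_cancel[OF ml_series_summable[OF a b c]])
    then show ?thesis by simp
  qed
  show "set_integrable lborel {0..} (\<lambda>t. exp (- (s * t)) * (t powr (b - 1) * ml_series a b c (t powr a)))"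
    using integrable_suminf[of lborel f] fi sm1 sm2 
    unfolding set_integrable_def sumf[symmetric] by auto
  show "(\<lambda>k. c k / s powr (a * real k + b)) sums
      (LBINT t:{0..}. exp (- (s * t)) * (t powr (b - 1) * ml_series a b c (t powr a)))"
    using sums_integral[of lborel f] fi sm1 sm2 
    unfolding set_lebesgue_integral_def sumf[symmetric] fI by auto
qed

lemma laplace_of_real:
  fixes g :: "real \<Rightarrow> real" and s :: real
  shows "laplace_exists (\<lambda>t. of_real (g t)) (of_real s) \<longleftrightarrow> set_integrable lborel {0..} (\<lambda>t. exp (- (s * t)) * g t)"
    and "laplace (\<lambda>t. of_real (g t)) (of_real s) = of_real (LBINT t:{0..}. exp (- (s * t)) * g t)"
proof -
  have e: "exp (- (complex_of_real s * complex_of_real t)) * complex_of_real (g t)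
      = complex_of_real (exp (- (s * t)) * g t)" for t
    by (simp add: exp_of_real[symmetric])
  show "laplace_exists (\<lambda>t. of_real (g t)) (of_real s) \<longleftrightarrow> set_integrable lborel {0..} (\<lambda>t. exp (- (s * t)) * g t)"
  proof -
    have "(\<lambda>t. indicator {0..} t *\<^sub>R complex_of_real (exp (- (s * t)) * g t))
        = (\<lambda>t. complex_of_real (indicator {0..} t *\<^sub>R (exp (- (s * t)) * g t)))"
      by (simp add: scaleR_conv_of_real)
    then show ?thesis
      unfolding laplace_exists_def e set_integrable_def by (simp only: complex_of_real_integrable_eq)
  qed
  show "laplace (\<lambda>t. of_real (g t)) (of_real s) = of_real (LBINT t:{0..}. exp (- (s * t)) * g t)"
    unfolding laplace_def e by (rule set_integral_complex_of_real)
qed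

text \<open>On a bounded interval the exponential weight can be divided out. Local integrability is
  what \<open>continuous_on_conv\<close> asks of a kernel.\<close>

lemma laplace_exists_imp_integrable:
  assumes "laplace_exists k s"
  shows "set_integrable lborel {0..T} k"
proof -
  define g where "g = (\<lambda>t. exp (- (s * of_real t)) * k t)"
  have g: "set_integrable lborel {0..T} g"
    by (rule set_integrable_subset[of lborel "{0..}"])
       (use assms in \<open>auto simp: laplace_exists_def g_def\<close>)
  define B where "B = exp (\<bar>Re s\<bar> * \<bar>T\<bar>)"
  have "set_integrable lborel {0..T} (\<lambda>t. of_real B * g t)"
    using g by simp
  then have "set_integrable lborel {0..T} (\<lambda>t. exp (s * of_real t) * g t)"
  proof (rule set_integrable_bound)
    have "(\<lambda>t. exp (s * of_real t) * (indicator {0..T} t *\<^sub>R g t)) \<in> borel_measurable lborel"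
      using g unfolding set_integrable_def
      by (intro borel_measurable_times borel_measurable_continuous_onI continuous_intros) auto
    then show "set_borel_measurable lborel {0..T} (\<lambda>t. exp (s * of_real t) * g t)"
      unfolding set_borel_measurable_def by simp
    show "AE t in lborel. t \<in> {0..T} \<longrightarrow> norm (exp (s * of_real t) * g t) \<le> norm (of_real B * g t)"
    proof (intro AE_I2 impI)
      fix t assume t: "t \<in> {0..T}"
      have "Re s * t \<le> \<bar>Re s\<bar> * \<bar>T\<bar>"
        using t by (intro mult_mono) auto
      then show "norm (exp (s * of_real t) * g t) \<le> norm (of_real B * g t)"
        by (simp add: norm_mult B_def mult_right_mono)
    qed
  qed
  moreover have "exp (s * of_real t) * g t = k t" for t
    by (simp add: g_def exp_minus field_simps)
  ultimately show ?thesis by simp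
qed

section \<open>The Laplace transform of the variation of constants formula\<close>

text \<open>This norm dominates every row sum, so its k-th power dominates the entries of A^k. It
  serves as the threshold for s^\<alpha>.\<close>

definition mat_bound :: "real^'n^'n \<Rightarrow> real" where
  "mat_bound A = (\<Sum>i\<in>UNIV. \<Sum>j\<in>UNIV. \<bar>A $ i $ j\<bar>)"

lemma row_le_mat_bound: "(\<Sum>j\<in>UNIV. \<bar>A $ i $ j\<bar>) \<le> mat_bound A"
  unfolding mat_bound_def by (rule member_le_sum) (auto intro!: sum_nonneg)

lemma mat_bound_nonneg: "mat_bound A \<ge> 0"
  unfolding mat_bound_def by (intro sum_nonneg) auto

lemma mat_pow_entry_bound: "\<bar>mat_pow A k $ i $ j\<bar> \<le> mat_bound A ^ k"
proof (induction k arbitrary: i)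
  case 0
  then show ?case by (simp add: mat_def)
next
  case (Suc k)
  have "\<bar>mat_pow A (Suc k) $ i $ j\<bar> \<le> (\<Sum>l\<in>UNIV. \<bar>A $ i $ l\<bar> * \<bar>mat_pow A k $ l $ j\<bar>)"
    by (auto simp: matrix_matrix_mult_def abs_mult intro!: order_trans[OF sum_abs])
  also have "\<dots> \<le> (\<Sum>l\<in>UNIV. \<bar>A $ i $ l\<bar> * mat_bound A ^ k)"
    by (intro sum_mono mult_left_mono Suc.IH) auto
  also have "\<dots> \<le> mat_bound A * mat_bound A ^ k"
    unfolding sum_distrib_right[symmetric]
    by (intro mult_right_mono row_le_mat_bound) (simp add: mat_bound_nonneg)
  finally show ?case by simp
qed

lemma mat_pow_scaleR: "mat_pow (c *\<^sub>R A) k = c ^ k *\<^sub>R mat_pow A k"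
  by (induction k)
     (auto simp: matrix_matrix_mult_def vec_eq_iff sum_distrib_left mult_ac scaleR_sum_right)

lemma mittag_leffler_mat_entry:
  fixes A :: "real^'n^'n"
  assumes a: "a > 0" and b: "b > 0"
  shows "mittag_leffler_mat a b (x *\<^sub>R A) $ i $ j = ml_series a b (\<lambda>k. mat_pow A k $ i $ j) x"
proof -
  define M where "M = (\<lambda>k. (1 / Gamma (a * real k + b)) *\<^sub>R mat_pow (x *\<^sub>R A) k)"
  have Mij: "M k $ i $ j = mat_pow A k $ i $ j / Gamma (a * real k + b) * x ^ k" for k i j
    by (simp add: M_def mat_pow_scaleR)
  have "summable M"
  proof (rule summable_norm_cancel, rule summable_comparison_test')
    show "summable (\<lambda>k. \<Sum>i\<in>UNIV. \<Sum>j\<in>UNIV. \<bar>M k $ i $ j\<bar>)"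
      unfolding Mij by (intro summable_sum ml_series_summable[OF a b mat_pow_entry_bound])
    have "norm (M k) \<le> (\<Sum>i\<in>UNIV. \<Sum>j\<in>UNIV. \<bar>M k $ i $ j\<bar>)" for k
      unfolding norm_vec_def[of "M k"]
      by (intro order_trans[OF L2_set_le_sum] sum_mono norm_le_l1_cart) auto
    then show "norm (norm (M k)) \<le> (\<Sum>i\<in>UNIV. \<Sum>j\<in>UNIV. \<bar>M k $ i $ j\<bar>)" for k
      by simp
  qed
  then have "(\<lambda>k. M k $ i $ j) sums (suminf M $ i $ j)"
    by (intro bounded_linear.sums[OF bounded_linear_vec_nth] summable_sums)
  then have "(\<Sum>k. M k $ i $ j) = suminf M $ i $ j"
    by (rule sums_unique[symmetric])
  then show ?thesis
    by (simp add: mittag_leffler_mat_def ml_series_def M_def[symmetric] Mij)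
qed

text \<open>Entries of $t^{\alpha-1}E_{\alpha,\alpha}(t^\alpha A)$.\<close>
definition kernel :: "real \<Rightarrow> real^'n^'n \<Rightarrow> 'n \<Rightarrow> 'n \<Rightarrow> real \<Rightarrow> real" where
  "kernel a A i j t = t powr (a - 1) * ml_series a a (\<lambda>k. mat_pow A k $ i $ j) (t powr a)"

text \<open>Entries of $(s^\alpha - A)^{-1}$, as a Neumann series.\<close>
definition resolvent :: "real \<Rightarrow> real^'n^'n \<Rightarrow> real \<Rightarrow> 'n \<Rightarrow> 'n \<Rightarrow> real" where
  "resolvent a A s i j = (\<Sum>k. mat_pow A k $ i $ j / s powr (a * real k + a))"

context
  fixes a :: real and A :: "real^'n^'n" and s :: real
  assumes a: "a > 0" and s: "s > 0" and sA: "s powr a > mat_bound A"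
begin

lemma laplace_kernel:
  "laplace_exists (\<lambda>t. of_real (kernel a A i j t)) (of_real s)"
  "laplace (\<lambda>t. of_real (kernel a A i j t)) (of_real s) = of_real (resolvent a A s i j)"
  using integral_exp_ml_series(1)[OF a a s sA mat_pow_entry_bound[of A _ i j]]
    sums_unique[OF integral_exp_ml_series(2)[OF a a s sA mat_pow_entry_bound[of A _ i j]]]
  unfolding laplace_of_real kernel_def resolvent_def by simp_all

lemma resolvent_sums:
  "(\<lambda>k. mat_pow A k $ i $ j / s powr (a * real k + a)) sums resolvent a A s i j"
  unfolding resolvent_def
  by (rule summable_sums, rule sums_summable[OF integral_exp_ml_series(2)[OF a a s sA mat_pow_entry_bound[of A _ i j]]])

text \<open>Multiplying the Neumann series by A shifts its index by one; the missing first term is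
  the identity matrix.\<close>

lemma resolvent_eq:
  "s powr a * resolvent a A s i j = (if i = j then 1 else 0) + (\<Sum>l\<in>UNIV. A $ i $ l * resolvent a A s l j)"
proof -
  define r where "r = (\<lambda>i k. mat_pow A k $ i $ j / s powr (a * real k + a))"
  have sp: "s powr a > 0" using s by simp
  have r: "r i sums resolvent a A s i j" for i
    unfolding r_def by (rule resolvent_sums)
  have "(\<lambda>k. \<Sum>l\<in>UNIV. A $ i $ l * r l k) sums (\<Sum>l\<in>UNIV. A $ i $ l * resolvent a A s l j)"
    by (intro sums_sum sums_mult r)
  also have "(\<lambda>k. \<Sum>l\<in>UNIV. A $ i $ l * r l k) = (\<lambda>k. s powr a * r i (Suc k))"
  proof
    fix k
    have "s powr (a * real (Suc k) + a) = s powr a * s powr (a * real k + a)"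
      by (simp add: powr_add[symmetric] algebra_simps)
    then show "(\<Sum>l\<in>UNIV. A $ i $ l * r l k) = s powr a * r i (Suc k)"
      using sp by (simp add: r_def matrix_matrix_mult_def sum_divide_distrib sum_distrib_left)
  qed
  finally have 1: "(\<lambda>k. s powr a * r i (Suc k)) sums (\<Sum>l\<in>UNIV. A $ i $ l * resolvent a A s l j)" .
  have "(\<lambda>k. s powr a * r i k) sums (s powr a * resolvent a A s i j)"
    by (intro sums_mult r)
  then have 2: "(\<lambda>k. s powr a * r i (Suc k)) sums (s powr a * resolvent a A s i j - s powr a * r i 0)"
    by (subst sums_Suc_iff) simp
  have "s powr a * r i 0 = (if i = j then 1 else 0)"
    using sp by (simp add: r_def mat_def)
  then show ?thesis using sums_unique2[OF 1 2] by simp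
qed

lemma laplace_mittag_leffler:
  "laplace_exists (\<lambda>t. of_real (mittag_leffler_mat a 1 ((t powr a) *\<^sub>R A) $ i $ j)) (of_real s)"
  "laplace (\<lambda>t. of_real (mittag_leffler_mat a 1 ((t powr a) *\<^sub>R A) $ i $ j)) (of_real s)
    = of_real (s powr (a - 1) * resolvent a A s i j)"
proof -
  define g where "g = (\<lambda>t. ml_series a 1 (\<lambda>k. mat_pow A k $ i $ j) (t powr a))"
  have g: "mittag_leffler_mat a 1 ((t powr a) *\<^sub>R A) $ i $ j = g t" for t
    unfolding g_def by (rule mittag_leffler_mat_entry) (use a in auto)
  have gm [measurable]: "g \<in> borel_measurable borel"
  proof -
    have "ml_series a 1 (\<lambda>k. mat_pow A k $ i $ j) \<in> borel_measurable borel"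
      by (rule borel_measurable_continuous_onI, rule continuous_on_ml_series[OF a _ mat_pow_entry_bound]) simp
    then show ?thesis unfolding g_def by measurable
  qed
  \<comment> \<open>As \<open>0 powr 0\<close> is 0, the factor with exponent 1 - 1 changes the
    integrand at t = 0 only.\<close>
  have ae: "AE t in lborel. indicator {0..} t *\<^sub>R (exp (- (s * t)) * (t powr (1 - 1) * g t))
      = indicator {0..} t *\<^sub>R (exp (- (s * t)) * g t)"
    by (rule eventually_mono[OF AE_lborel_singleton[of 0]]) auto
  have *: "set_integrable lborel {0..} (\<lambda>t. exp (- (s * t)) * (t powr (1 - 1) * g t))
      \<longleftrightarrow> set_integrable lborel {0..} (\<lambda>t. exp (- (s * t)) * g t)"
    "(LBINT t:{0..}. exp (- (s * t)) * (t powr (1 - 1) * g t)) = (LBINT t:{0..}. exp (- (s * t)) * g t)"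
    unfolding set_integrable_def set_lebesgue_integral_def
    by (rule integrable_cong_AE[OF _ _ ae] integral_cong_AE[OF _ _ ae]; measurable)+
  have g': "ml_series a 1 (\<lambda>k. mat_pow A k $ i $ j) (t powr a) = g t" for t
    by (simp add: g_def)
  note L = integral_exp_ml_series[OF a zero_less_one s sA mat_pow_entry_bound[of A _ i j], unfolded g']
  \<comment> \<open>The second parameter is 1 here, and s^{-(ak+1)} = s^{a-1} s^{-(ak+a)} reduces
    this series to that of the resolvent.\<close>
  have "(\<lambda>k. s powr (a - 1) * (mat_pow A k $ i $ j / s powr (a * real k + a))) sums
      (s powr (a - 1) * resolvent a A s i j)"
    by (intro sums_mult resolvent_sums)
  also have "(\<lambda>k. s powr (a - 1) * (mat_pow A k $ i $ j / s powr (a * real k + a)))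
      = (\<lambda>k. mat_pow A k $ i $ j / s powr (a * real k + 1))"
    using s by (auto simp: fun_eq_iff powr_add powr_diff field_simps)
  finally have "(LBINT t:{0..}. exp (- (s * t)) * g t) = s powr (a - 1) * resolvent a A s i j"
    unfolding *(2)[symmetric] by (rule sums_unique2[OF L(2)])
  then show "laplace_exists (\<lambda>t. of_real (mittag_leffler_mat a 1 ((t powr a) *\<^sub>R A) $ i $ j)) (of_real s)"
  "laplace (\<lambda>t. of_real (mittag_leffler_mat a 1 ((t powr a) *\<^sub>R A) $ i $ j)) (of_real s)
    = of_real (s powr (a - 1) * resolvent a A s i j)"
    unfolding g laplace_of_real using L(1) * by auto
qed

end

lemma ex_powr_gt:
  fixes a C :: real
  assumes "a > 0"
  obtains s0 where "s0 > 0" "\<And>s. s \<ge> s0 \<Longrightarrow> s powr a > C"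
proof
  define s0 where "s0 = (\<bar>C\<bar> + 1) powr (1 / a)"
  show "s0 > 0" by (simp add: s0_def)
  fix s assume s: "s \<ge> s0"
  have "C < \<bar>C\<bar> + 1" by simp
  also have "\<dots> = s0 powr a" using assms by (simp add: s0_def powr_powr)
  also have "\<dots> \<le> s powr a" using s assms by (intro powr_mono2) (auto simp: s0_def)
  finally show "s powr a > C" .
qed

lemma kernel_integrable:
  assumes a: "a > 0"
  shows "set_integrable lborel {0..T} (\<lambda>t. complex_of_real (kernel a A i j t))"
proof -
  obtain s0 where "s0 > 0" "\<And>s. s \<ge> s0 \<Longrightarrow> s powr a > mat_bound A"
    using ex_powr_gt[OF a] by blast
  then have "laplace_exists (\<lambda>t. of_real (kernel a A i j t)) (of_real s0)"
    by (intro laplace_kernel[OF a]) auto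
  then show ?thesis by (rule laplace_exists_imp_integrable)
qed

text \<open>Passes from the gauge integral over \<tau> to Lebesgue convolutions of scalar entries
  over u = t - \<tau>, the form in which the convolution theorem applies.\<close>

lemma frac_sol_entry:
  fixes A :: "real^'n^'n" and f :: "real \<Rightarrow> real^'n"
  assumes a: "a > 0" and f: "continuous_on {0..} f" and t: "t \<ge> 0"
  shows "complex_of_real (frac_sol a A f x0 t $ i) =
    (\<Sum>j\<in>UNIV. of_real (x0 $ j) * of_real (mittag_leffler_mat a 1 ((t powr a) *\<^sub>R A) $ i $ j))
    + (\<Sum>j\<in>UNIV. conv (\<lambda>t. of_real (kernel a A i j t)) (\<lambda>t. of_real (f t $ j)) t)"
proof -
  define h where "h = (\<lambda>i j u. kernel a A i j u * f (t - u) $ j)"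
  have fc: "continuous_on {0..} (\<lambda>t. complex_of_real (f t $ j))" for j
    by (intro continuous_intros f)
  have h: "set_integrable lborel {0..t} (h i j)" for i j
  proof -
    have "set_integrable lborel {0..t} (\<lambda>u. complex_of_real (kernel a A i j u) * complex_of_real (f (t - u) $ j))"
      by (rule conv_integrable[OF kernel_integrable[OF a] fc])
    then have "set_integrable lborel {0..t} (\<lambda>u. complex_of_real (h i j u))"
      by (simp add: h_def)
    then have "integrable lborel (\<lambda>u. complex_of_real (indicator {0..t} u *\<^sub>R h i j u))"
      unfolding set_integrable_def by (simp add: scaleR_conv_of_real)
    then show ?thesis
      unfolding set_integrable_def by (simp only: complex_of_real_integrable_eq)
  qed
  have hI: "conv (\<lambda>t. of_real (kernel a A i j t)) (\<lambda>t. of_real (f t $ j)) t = of_real (integral {0..t} (h i j))" for i j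
    unfolding conv_def of_real_mult[symmetric] set_integral_complex_of_real
    using set_borel_integral_eq_integral(2)[OF h] by (simp add: h_def)
  have refl: "((\<lambda>u. h i j (t - u)) has_integral integral {0..t} (h i j)) {0..t}" for i j
  proof -
    have "(h i j has_integral integral {0..t} (h i j)) {0..t}"
      using set_borel_integral_eq_integral(1)[OF h] by (rule integrable_integral)
    then have "((\<lambda>x. h i j (-1 *\<^sub>R x + t)) has_integral (1 / \<bar>-1\<bar> ^ 1) *\<^sub>R integral {0..t} (h i j))
        ((\<lambda>x. (1 / -1) *\<^sub>R x + - ((1 / -1) *\<^sub>R t)) ` cbox 0 t)"
      using has_integral_affinity[of "h i j" "integral {0..t} (h i j)" 0 t "-1" t] by simp
    moreover have "((\<lambda>x. (1 / -1) *\<^sub>R x + - ((1 / -1) *\<^sub>R t)) ` cbox 0 t) = {0..t}"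
      by (auto simp: image_iff intro!: bexI[of _ "t - _"])
    ultimately show ?thesis by (simp add: algebra_simps)
  qed
  define v where "v = (\<chi> i. \<Sum>j\<in>UNIV. integral {0..t} (h i j))"
  \<comment> \<open>\<open>has_integral\<close> establishes integrability as well as the value;
    \<open>integral\<close> alone would be a default 0 for a non-integrable function.\<close>
  have "((\<lambda>\<tau>. ((t - \<tau>) powr (a - 1)) *\<^sub>R (mittag_leffler_mat a a (((t - \<tau>) powr a) *\<^sub>R A) *v f \<tau>)) has_integral v) {0..t}"
    unfolding has_integral_componentwise_iff[where y = v]
  proof
    fix b :: "real^'n" assume "b \<in> Basis"
    then obtain i where b: "b = axis i 1" by (auto simp: Basis_vec_def)
    have "((\<lambda>u. \<Sum>j\<in>UNIV. h i j (t - u)) has_integral v $ i) {0..t}"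
      unfolding v_def by (auto intro!: has_integral_sum refl)
    then show "((\<lambda>\<tau>. (((t - \<tau>) powr (a - 1)) *\<^sub>R (mittag_leffler_mat a a (((t - \<tau>) powr a) *\<^sub>R A) *v f \<tau>)) \<bullet> b) has_integral v \<bullet> b) {0..t}"
      by (simp add: b inner_axis h_def kernel_def matrix_vector_mult_def mittag_leffler_mat_entry[OF a a] sum_distrib_left mult.assoc)
  qed
  then have "integral {0..t} (\<lambda>\<tau>. ((t - \<tau>) powr (a - 1)) *\<^sub>R (mittag_leffler_mat a a (((t - \<tau>) powr a) *\<^sub>R A) *v f \<tau>)) = v"
    by (rule integral_unique)
  then show ?thesis
    unfolding frac_sol_def hI by (simp add: v_def matrix_vector_mult_def mult.commute)
qed

lemma bounded_components:
  fixes f :: "real \<Rightarrow> real^'n"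
  assumes "bounded (f ` {0..})"
  obtains M where "\<And>t j. t \<ge> 0 \<Longrightarrow> norm (complex_of_real (f t $ j)) \<le> M"
proof -
  obtain M where "\<And>t. t \<ge> 0 \<Longrightarrow> norm (f t) \<le> M"
    using assms by (auto simp: bounded_iff)
  then show ?thesis
    using that[of M] component_le_norm_cart order_trans by (metis norm_of_real real_norm_def)
qed

lemma continuous_on_frac_sol:
  fixes A :: "real^'n^'n" and f :: "real \<Rightarrow> real^'n"
  assumes a: "a > 0" and f: "continuous_on {0..} f"
  shows "continuous_on {0..} (\<lambda>t. complex_of_real (frac_sol a A f x0 t $ i))"
proof -
  have 1: "continuous_on {0..} (\<lambda>t. mittag_leffler_mat a 1 ((t powr a) *\<^sub>R A) $ i $ j)" for j
    unfolding mittag_leffler_mat_entry[OF a zero_less_one]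
    by (rule continuous_on_compose2[OF continuous_on_ml_series[OF a zero_less_one mat_pow_entry_bound]])
       (use a in \<open>auto intro!: continuous_intros continuous_on_powr'\<close>)
  have 2: "continuous_on {0..} (conv (\<lambda>t. of_real (kernel a A i j t)) (\<lambda>t. of_real (f t $ j)))" for j
    by (rule continuous_on_conv[OF kernel_integrable[OF a]]) (auto intro!: continuous_intros f)
  show ?thesis
    by (subst continuous_on_cong[OF refl frac_sol_entry[OF a f]])
       (auto intro!: continuous_intros 1 2)
qed

text \<open>The transform is the resolvent applied to s^{a-1} x0 + F(s), and
  \<open>resolvent_eq\<close> turns this into a linear system. In that form it can be paired with an
  eigenvector and used to compare two solutions.\<close>

lemma laplace_frac_sol:
  fixes A :: "real^'n^'n" and f :: "real \<Rightarrow> real^'n" and x0 :: "real^'n"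
  assumes a: "a > 0" and f: "continuous_on {0..} f" and b: "bounded (f ` {0..})"
    and s: "s > 0" and sA: "s powr a > mat_bound A"
  defines "X \<equiv> \<lambda>i. laplace (\<lambda>t. of_real (frac_sol a A f x0 t $ i)) (of_real s)"
  shows "laplace_exists (\<lambda>t. of_real (frac_sol a A f x0 t $ i)) (of_real s)"
    and "of_real (s powr a) * X i - (\<Sum>j\<in>UNIV. of_real (A $ i $ j) * X j)
      = of_real (s powr (a - 1)) * of_real (x0 $ i) + laplace (\<lambda>t. of_real (f t $ i)) (of_real s)"
proof -
  obtain M where M: "\<And>t j. t \<ge> 0 \<Longrightarrow> norm (complex_of_real (f t $ j)) \<le> M"
    using bounded_components[OF b] by blast
  define B where "B = (\<lambda>j. of_real (s powr (a - 1)) * of_real (x0 $ j) + laplace (\<lambda>t. of_real (f t $ j)) (of_real s))"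
  define R where "R = (\<lambda>i j. complex_of_real (resolvent a A s i j))"
  have fl: "laplace_exists (\<lambda>t. of_real (f t $ j)) (of_real s)" for j
    by (rule laplace_bounded(1)[OF _ M]) (use s in \<open>auto intro!: continuous_intros f\<close>)
  note Ll = laplace_mittag_leffler[OF a s sA] laplace_kernel[OF a s sA]
  note L1 = laplace_cmult[OF Ll(1)] laplace_conv[OF Ll(3) fl]
  note L2 = laplace_sum[of UNIV "\<lambda>j t. of_real (x0 $ j) * of_real (mittag_leffler_mat a 1 ((t powr a) *\<^sub>R A) $ i $ j)" "of_real s" for i]
    laplace_sum[of UNIV "\<lambda>j. conv (\<lambda>t. of_real (kernel a A i j t)) (\<lambda>t. of_real (f t $ j))" "of_real s" for i]
  note L3 = laplace_add[OF L2(1) L2(3)]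
  show "laplace_exists (\<lambda>t. of_real (frac_sol a A f x0 t $ i)) (of_real s)" for i
    by (subst laplace_cong(1)[OF frac_sol_entry[OF a f]]) (use L1 L3 in auto)
  have X: "X i = (\<Sum>j\<in>UNIV. R i j * B j)" for i
    unfolding X_def
  proof -
    have "laplace (\<lambda>t. of_real (frac_sol a A f x0 t $ i)) (of_real s)
        = (\<Sum>j\<in>UNIV. of_real (x0 $ j) * of_real (s powr (a - 1) * resolvent a A s i j))
        + (\<Sum>j\<in>UNIV. of_real (resolvent a A s i j) * laplace (\<lambda>t. of_real (f t $ j)) (of_real s))"
      by (subst laplace_cong(2)[OF frac_sol_entry[OF a f]], assumption)
         (simp only: L3(2)[OF L1(1) L1(3)] L2(2)[OF L1(1)] L2(4)[OF L1(3)] L1(2,4) Ll(2,4))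
    also have "\<dots> = (\<Sum>j\<in>UNIV. R i j * B j)"
      by (simp add: R_def B_def sum.distrib[symmetric] ring_distribs mult_ac)
    finally show "laplace (\<lambda>t. of_real (frac_sol a A f x0 t $ i)) (of_real s) = (\<Sum>j\<in>UNIV. R i j * B j)" .
  qed
  have R: "of_real (s powr a) * R i j = (if i = j then 1 else 0) + (\<Sum>l\<in>UNIV. of_real (A $ i $ l) * R l j)" for i j
    using arg_cong[OF resolvent_eq[OF a s sA, of i j], of complex_of_real]
    by (simp add: R_def if_distrib cong: if_cong)
  have "of_real (s powr a) * X i = (\<Sum>j\<in>UNIV. ((if i = j then 1 else 0) + (\<Sum>l\<in>UNIV. of_real (A $ i $ l) * R l j)) * B j)"
    by (simp only: X sum_distrib_left mult.assoc[symmetric] R)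
  also have "\<dots> = B i + (\<Sum>j\<in>UNIV. \<Sum>l\<in>UNIV. of_real (A $ i $ l) * R l j * B j)"
    by (simp add: ring_distribs sum.distrib sum_distrib_right if_distrib[of "\<lambda>x. x * _"] cong: if_cong)
  also have "(\<Sum>j\<in>UNIV. \<Sum>l\<in>UNIV. of_real (A $ i $ l) * R l j * B j) = (\<Sum>l\<in>UNIV. of_real (A $ i $ l) * X l)"
    unfolding X sum_distrib_left by (subst sum.swap) (simp add: mult.assoc)
  finally show "of_real (s powr a) * X i - (\<Sum>j\<in>UNIV. of_real (A $ i $ j) * X j)
      = of_real (s powr (a - 1)) * of_real (x0 $ i) + laplace (\<lambda>t. of_real (f t $ i)) (of_real s)"
    by (simp add: B_def)
qed

section \<open>Necessity\<close>

text \<open>The truncated transforms are entire, and \<open>laplace_split\<close> bounds the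
  truncation error by M e^{-N Re s} / Re s, uniformly on closed discs inside the half-plane.\<close>

lemma holomorphic_on_laplace:
  assumes y: "continuous_on {0..} y" and M: "\<And>t. t \<ge> 0 \<Longrightarrow> norm (y t) \<le> M"
  shows "laplace y holomorphic_on {s. Re s > 0}"
proof -
  define Y where "Y = (\<lambda>(N::nat) s. integral (cbox 0 (real N)) (\<lambda>t. exp (- (s * of_real t)) * y t))"
  have yc: "continuous_on {0..real N} y" for N
    by (rule continuous_on_subset[OF y]) auto
  have hol: "Y N holomorphic_on UNIV" for N
    unfolding Y_def
  proof (rule leibniz_rule_holomorphic)
    show "((\<lambda>s. exp (- (s * of_real t)) * y t) has_field_derivative
        - of_real t * exp (- (s * of_real t)) * y t) (at s within UNIV)" for s t
      by (auto intro!: derivative_eq_intros)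
    show "(\<lambda>t. exp (- (s * of_real t)) * y t) integrable_on cbox 0 (real N)" for s
      unfolding cbox_interval by (rule integrable_continuous_interval) (intro continuous_intros yc)
    have "continuous_on (UNIV \<times> {0..real N}) (\<lambda>x. y (snd x))"
      by (rule continuous_on_compose2[OF yc]) (auto intro!: continuous_intros)
    then show "continuous_on (UNIV \<times> cbox 0 (real N)) (\<lambda>(s, t). - of_real t * exp (- (s * of_real t)) * y t)"
      by (auto simp: case_prod_unfold intro!: continuous_intros)
  qed auto
  have op: "open {s. Re s > 0}" by (rule open_halfspace_Re_gt)
  have M0: "M \<ge> 0" using M[of 0] norm_ge_zero order_trans by blast
  have Y_eq: "Y N s = (LBINT t:{0..real N}. exp (- (s * of_real t)) * y t)" for N s
    unfolding Y_def cbox_interval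
    by (rule set_borel_integral_eq_integral(2)[symmetric])
       (auto intro!: borel_integrable_atLeastAtMost' continuous_intros yc)
  have bound: "norm (Y N s - laplace y s) \<le> M * exp (- (Re s * real N)) / Re s" if s: "Re s > 0" for N s
  proof -
    have "norm (Y N s - laplace y s) = norm (exp (- (s * of_real (real N))) * laplace (\<lambda>t. y (real N + t)) s)"
      unfolding Y_eq by (subst laplace_split[OF y M s, of "real N"]) simp_all
    also have "norm (exp (- (s * of_real (real N))) * laplace (\<lambda>t. y (real N + t)) s) \<le> exp (- (Re s * real N)) * (M / Re s)"
      unfolding norm_mult
      by (intro mult_mono laplace_bounded(2) s continuous_on_compose2[OF y] M)
         (auto intro!: continuous_intros)
    finally show ?thesis by (simp add: mult.commute)
  qed
  show ?thesis
  proof (rule holomorphic_uniform_sequence[OF op])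
    show "Y N holomorphic_on {s. Re s > 0}" for N
      by (rule holomorphic_on_subset[OF hol]) auto
    fix s assume "s \<in> {s. Re s > 0}"
    define d where "d = Re s / 2"
    have d: "d > 0" using \<open>s \<in> _\<close> by (simp add: d_def)
    have Re_ge: "Re x \<ge> d" if "x \<in> cball s d" for x
      using that complex_Re_le_cmod[of "s - x"] by (simp add: d_def dist_norm)
    have lim: "(\<lambda>N. M / d * exp (- (d * real N))) \<longlonglongrightarrow> 0"
      using d by real_asymp
    have le: "dist (Y N x) (laplace y x) \<le> M / d * exp (- (d * real N))" if x: "x \<in> cball s d" for N x
    proof -
      have "norm (Y N x - laplace y x) \<le> M * exp (- (Re x * real N)) / Re x"
        using Re_ge[OF x] d by (intro bound) auto
      also have "\<dots> \<le> M * exp (- (d * real N)) / d"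
        using Re_ge[OF x] d M0 by (intro frac_le mult_left_mono) (auto simp: mult_right_mono)
      finally show ?thesis by (simp add: dist_norm)
    qed
    have "uniform_limit (cball s d) Y (laplace y) sequentially"
    proof (rule uniform_limitI)
      fix e :: real assume "e > 0"
      show "\<forall>\<^sub>F N in sequentially. \<forall>x\<in>cball s d. dist (Y N x) (laplace y x) < e"
        by (rule eventually_mono[OF order_tendstoD(2)[OF lim \<open>e > 0\<close>]]) (use le le_less_trans in blast)
    qed
    then show "\<exists>d>0. cball s d \<subseteq> {s. Re s > 0} \<and> uniform_limit (cball s d) Y (laplace y) sequentially"
      using d Re_ge by (intro exI[of _ d]) force
  qed
qed

text \<open>The spectrum is defined by right eigenvectors. A square matrix with nontrivial kernel
  has no inverse, hence dependent rows, and a relation among the rows of A - z is a left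
  eigenvector.\<close>

lemma left_eigenvector:
  fixes A :: "real^'n^'n"
  assumes "z \<in> cspectrum A"
  obtains c where "\<exists>i. c i \<noteq> 0" "\<And>j. (\<Sum>i\<in>UNIV. c i * complex_of_real (A $ i $ j)) = z * c j"
proof -
  obtain v :: "complex^'n" where v: "v \<noteq> 0" "map_matrix complex_of_real A *v v = z *s v"
    using assms by (auto simp: cspectrum_def)
  define B :: "complex^'n^'n" where "B = map_matrix complex_of_real A - mat z"
  have "B *v v = 0"
    using v(2) by (simp add: B_def matrix_vector_mult_diff_rdistrib vec_eq_iff matrix_vector_mult_def
        mat_def left_diff_distrib sum_subtractf if_distrib[of "\<lambda>x. x * _"] cong: if_cong)
  then have "\<not> (\<exists>C. C ** B = mat 1)"
    using v(1) matrix_left_invertible_ker by blast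
  then have "\<not> (\<exists>C. B ** C = mat 1)"
    using matrix_left_right_inverse by blast
  then obtain c where c: "(\<Sum>i\<in>UNIV. c i *s row i B) = 0" "\<exists>i. c i \<noteq> 0"
    unfolding matrix_right_invertible_independent_rows by blast
  have "(\<Sum>i\<in>UNIV. c i * complex_of_real (A $ i $ j)) = z * c j" for j
  proof -
    have "(\<Sum>i\<in>UNIV. c i *s row i B) $ j = 0" using c(1) by simp
    then have "(\<Sum>i\<in>UNIV. c i * complex_of_real (A $ i $ j)) - (\<Sum>i\<in>UNIV. if i = j then c i * z else 0) = 0"
      by (simp add: row_def B_def mat_def right_diff_distrib sum_subtractf map_matrix_def if_distrib[of "\<lambda>x. _ * x"] cong: if_cong)
    then show ?thesis by (simp add: mult.commute)
  qed
  with c(2) show ?thesis using that by blast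
qed

text \<open>The principal power s^\<alpha> maps the imaginary axis without 0 onto the two critical
  rays, so \<omega> comes from the preimage w = exp (Ln z / \<alpha>). The second limit makes the
  initial-value term disappear after multiplication by Re s; for z = 0 it reads x^\<alpha> -> 0,
  although s^{\<alpha>-1} is unbounded there.\<close>

lemma boundary_frequency:
  fixes \<alpha> :: real
  assumes \<alpha>: "0 < \<alpha>" "\<alpha> < 1" and z: "z = 0 \<or> \<bar>Arg z\<bar> = \<alpha> * pi / 2"
  obtains \<omega> where "((\<lambda>x. Complex x \<omega> powr of_real \<alpha>) \<longlongrightarrow> z) (at_right 0)"
    "((\<lambda>x. of_real x * Complex x \<omega> powr of_real (\<alpha> - 1)) \<longlongrightarrow> 0) (at_right 0)"
proof (cases "z = 0")
  case True
  have eq: "Complex x 0 powr of_real a = of_real (x powr a)" if "x > 0" for x a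
    using that by (simp add: complex_eq_iff powr_of_real flip: complex_of_real_def)
  show ?thesis
  proof (rule that[of 0])
    have "((\<lambda>x. complex_of_real (x powr \<alpha>)) \<longlongrightarrow> of_real 0) (at_right 0)"
      using \<alpha> by (intro tendsto_of_real) real_asymp
    then show "((\<lambda>x. Complex x 0 powr of_real \<alpha>) \<longlongrightarrow> z) (at_right 0)"
      unfolding True of_real_0
      by (rule Lim_transform_eventually) (auto simp: eq intro!: eventually_at_right_less eventually_mono[OF eventually_at_right_less])
    have "((\<lambda>x. complex_of_real (x * x powr (\<alpha> - 1))) \<longlongrightarrow> of_real 0) (at_right 0)"
      using \<alpha> by (intro tendsto_of_real) real_asymp
    then show "((\<lambda>x. of_real x * Complex x 0 powr of_real (\<alpha> - 1)) \<longlongrightarrow> 0) (at_right 0)"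
      unfolding of_real_0
      by (rule Lim_transform_eventually)
         (use eq[of _ "\<alpha> - 1"] in \<open>auto intro!: eventually_mono[OF eventually_at_right_less]\<close>)
  qed
next
  case False
  define p where "p = Ln z / of_real \<alpha>"
  have Imp: "\<bar>Im p\<bar> = pi / 2"
    using z False \<alpha> by (auto simp: p_def Arg_eq_Im_Ln[symmetric] abs_mult field_simps)
  define w where "w = exp p"
  have "cos (Im p) = cos \<bar>Im p\<bar>" by (simp add: abs_if)
  then have Rew: "Re w = 0" by (simp add: w_def Re_exp Imp)
  have w0: "w \<noteq> 0" by (simp add: w_def)
  \<comment> \<open>Off the branch cut the principal power is continuous at w.\<close>
  have nw: "w \<notin> \<real>\<^sub>\<le>\<^sub>0"
    using w0 Rew by (auto simp: complex_nonpos_Reals_iff complex_eq_iff)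
  have Lnw: "Ln w = p"
    unfolding w_def by (rule Ln_exp) (use Imp pi_gt_zero in linarith)+
  have wz: "w powr of_real \<alpha> = z"
    using w0 \<alpha> False by (simp add: powr_def Lnw p_def)
  have C: "((\<lambda>x. Complex x (Im w)) \<longlongrightarrow> w) (at_right 0)"
  proof -
    have "((\<lambda>x. Complex x (Im w)) \<longlongrightarrow> Complex 0 (Im w)) (at_right 0)"
      by (intro tendsto_intros)
    then show ?thesis using Rew by (metis complex_surj)
  qed
  show ?thesis
  proof (rule that[of "Im w"])
    show "((\<lambda>x. Complex x (Im w) powr of_real \<alpha>) \<longlongrightarrow> z) (at_right 0)"
      using tendsto_powr_complex[OF nw C tendsto_const[of "of_real \<alpha>"]] by (simp add: wz)
    have "((\<lambda>x. of_real x * Complex x (Im w) powr of_real (\<alpha> - 1)) \<longlongrightarrow> of_real 0 * w powr of_real (\<alpha> - 1)) (at_right 0)"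
      by (intro tendsto_intros tendsto_powr_complex[OF nw C])
    then show "((\<lambda>x. of_real x * Complex x (Im w) powr of_real (\<alpha> - 1)) \<longlongrightarrow> 0) (at_right 0)"
      by simp
  qed
qed

lemma laplace_cos:
  assumes "Re s > 0"
  shows "laplace (\<lambda>t. complex_of_real (cos (\<omega> * t))) s
    = (1 / (s - \<i> * of_real \<omega>) + 1 / (s + \<i> * of_real \<omega>)) / 2"
proof -
  have eq: "complex_of_real (cos (\<omega> * t)) = 1/2 * exp ((\<i> * of_real \<omega>) * of_real t) + 1/2 * exp ((- \<i> * of_real \<omega>) * of_real t)" for t
    by (simp add: cos_of_real[symmetric] cos_exp_eq mult.assoc add_divide_distrib del: cos_of_real)
  have 1: "Re (s - \<i> * of_real \<omega>) > 0" "Re (s - (- \<i> * of_real \<omega>)) > 0" using assms by auto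
  note L = laplace_cmult[OF laplace_exp(1)[OF 1(1)], of "1/2"] laplace_cmult[OF laplace_exp(1)[OF 1(2)], of "1/2"]
  show ?thesis
    unfolding eq laplace_add(2)[OF L(1,3)] L(2,4) laplace_exp(2)[OF 1(1)] laplace_exp(2)[OF 1(2)]
    by (simp add: add_divide_distrib mult.commute)
qed

theorem bounded_solvable_imp_spectrum:
  fixes \<alpha> :: real and A :: "real^'n^'n"
  assumes \<alpha>: "0 < \<alpha>" "\<alpha> < 1"
    and solvable: "\<And>f :: real \<Rightarrow> real^'n. continuous_on {0..} f \<Longrightarrow> bounded (f ` {0..}) \<Longrightarrow>
            \<exists>x0. bounded (frac_sol \<alpha> A f x0 ` {0..})"
    and z: "z \<in> cspectrum A"
  shows "z \<in> Lambda_u \<alpha> \<union> Lambda_s \<alpha>"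
proof (rule ccontr)
  assume "z \<notin> Lambda_u \<alpha> \<union> Lambda_s \<alpha>"
  then have z': "z = 0 \<or> \<bar>Arg z\<bar> = \<alpha> * pi / 2"
    by (auto simp: Lambda_u_def Lambda_s_def)
  obtain \<omega> where \<omega>: "((\<lambda>x. Complex x \<omega> powr of_real \<alpha>) \<longlongrightarrow> z) (at_right 0)"
    "((\<lambda>x. of_real x * Complex x \<omega> powr of_real (\<alpha> - 1)) \<longlongrightarrow> 0) (at_right 0)"
    using boundary_frequency[OF \<alpha> z'] by blast
  obtain w i0 where w: "w i0 \<noteq> 0" "\<And>j. (\<Sum>i\<in>UNIV. w i * complex_of_real (A $ i $ j)) = z * w j"
    using left_eigenvector[OF z] by blast
  \<comment> \<open>Resonant forcing, real because f must be, in a coordinate that the left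
    eigenvector sees. For \<omega> = 0 it is constant.\<close>
  define f :: "real \<Rightarrow> real^'n" where "f = (\<lambda>t. cos (\<omega> * t) *\<^sub>R axis i0 1)"
  have f: "continuous_on {0..} f" unfolding f_def by (intro continuous_intros)
  have fb: "bounded (f ` {0..})"
    unfolding bounded_iff f_def by (intro exI[of _ 1]) (auto simp: norm_axis_1)
  obtain x0 where x0: "bounded (frac_sol \<alpha> A f x0 ` {0..})" using solvable[OF f fb] by blast
  define x where "x = (\<lambda>i t. complex_of_real (frac_sol \<alpha> A f x0 t $ i))"
  obtain B where B: "\<And>t i. t \<ge> 0 \<Longrightarrow> norm (x i t) \<le> B"
    using bounded_components[OF x0] unfolding x_def by blast
  have xc: "continuous_on {0..} (x i)" for i
    unfolding x_def by (rule continuous_on_frac_sol[OF \<alpha>(1) f])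
  define y where "y = (\<lambda>t. \<Sum>i\<in>UNIV. w i * x i t)"
  define M where "M = (\<Sum>i\<in>UNIV. norm (w i) * B)"
  define y0 where "y0 = (\<Sum>i\<in>UNIV. w i * complex_of_real (x0 $ i))"
  have yc: "continuous_on {0..} y" unfolding y_def by (intro continuous_intros xc)
  have yM: "norm (y t) \<le> M" if "t \<ge> 0" for t
    unfolding y_def M_def using B[OF that]
    by (auto intro!: order_trans[OF norm_sum] sum_mono mult_left_mono simp: norm_mult)
  define \<Phi> where "\<Phi> = (\<lambda>s. (1 / (s - \<i> * of_real \<omega>) + 1 / (s + \<i> * of_real \<omega>)) / 2)"
  \<comment> \<open>The defect of the scalar equation obtained by pairing with \<open>w\<close>. It
    vanishes for large real s; boundedness of y makes \<open>laplace y\<close> holomorphic for Re s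
    > 0, which carries the identity to the whole half-plane.\<close>
  define G where "G = (\<lambda>s. (s powr of_real \<alpha> - z) * laplace y s - s powr of_real (\<alpha> - 1) * y0 - w i0 * \<Phi> s)"
  define H where "H = {s. Re s > 0}"
  obtain s0 where s0: "s0 > 0" "\<And>s. s \<ge> s0 \<Longrightarrow> s powr \<alpha> > mat_bound A"
    using ex_powr_gt[OF \<alpha>(1)] by blast
  have Greal: "G (of_real s) = 0" if s: "s \<ge> s0" for s
  proof -
    have sp: "s > 0" using s s0 by linarith
    note L = laplace_frac_sol[OF \<alpha>(1) f fb sp s0(2)[OF s], of x0]
    define X where "X = (\<lambda>i. laplace (x i) (of_real s))"
    have Y: "laplace y (of_real s) = (\<Sum>i\<in>UNIV. w i * X i)"
    proof -
      have "laplace_exists (x i) (of_real s)" for i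
        using L(1)[of i] by (simp add: x_def)
      note Lx = laplace_cmult[OF this]
      show ?thesis
        unfolding y_def X_def by (subst laplace_sum(2)) (simp_all add: Lx)
    qed
    have "(\<Sum>i\<in>UNIV. w i * (of_real (s powr \<alpha>) * X i - (\<Sum>j\<in>UNIV. of_real (A $ i $ j) * X j)))
        = (\<Sum>i\<in>UNIV. w i * (of_real (s powr (\<alpha> - 1)) * of_real (x0 $ i) + laplace (\<lambda>t. of_real (f t $ i)) (of_real s)))"
      using L(2) unfolding X_def x_def by simp
    also have "(\<Sum>i\<in>UNIV. w i * (of_real (s powr \<alpha>) * X i - (\<Sum>j\<in>UNIV. of_real (A $ i $ j) * X j)))
        = of_real (s powr \<alpha>) * laplace y (of_real s) - (\<Sum>i\<in>UNIV. \<Sum>j\<in>UNIV. w i * of_real (A $ i $ j) * X j)"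
      by (simp add: Y sum_distrib_left right_diff_distrib sum_subtractf mult_ac)
    also have "(\<Sum>i\<in>UNIV. \<Sum>j\<in>UNIV. w i * of_real (A $ i $ j) * X j) = z * laplace y (of_real s)"
    proof -
      have "(\<Sum>i\<in>UNIV. w i * of_real (A $ i $ j) * X j) = z * (w j * X j)" for j
      proof -
        have "(\<Sum>i\<in>UNIV. w i * of_real (A $ i $ j) * X j) = (\<Sum>i\<in>UNIV. w i * of_real (A $ i $ j)) * X j"
          by (simp only: sum_distrib_right)
        then show ?thesis by (simp only: w(2) mult.assoc)
      qed
      then show ?thesis by (subst sum.swap) (simp add: Y sum_distrib_left)
    qed
    also have "(\<Sum>i\<in>UNIV. w i * (of_real (s powr (\<alpha> - 1)) * of_real (x0 $ i) + laplace (\<lambda>t. of_real (f t $ i)) (of_real s)))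
        = of_real (s powr (\<alpha> - 1)) * y0 + w i0 * \<Phi> (of_real s)"
    proof -
      have "laplace (\<lambda>t. of_real (f t $ i)) (of_real s) = (if i = i0 then \<Phi> (of_real s) else 0)" for i
        using laplace_cos[of "of_real s" \<omega>] sp
        by (auto simp: f_def axis_def \<Phi>_def laplace_def)
      then show ?thesis
        by (simp add: y0_def ring_distribs sum.distrib sum_distrib_left mult_ac if_distrib[of "\<lambda>x. _ * x"] cong: if_cong)
    qed
    finally show ?thesis
      using sp by (simp add: G_def powr_of_real[symmetric] algebra_simps)
  qed
  have G0: "G s = 0" if "s \<in> H" for s
  proof (rule analytic_continuation[of G H "of_real ` {s0<..}" "of_real (s0 + 1)"])
    have "laplace y holomorphic_on H" unfolding H_def by (rule holomorphic_on_laplace[OF yc yM])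
    then show "G holomorphic_on H"
      unfolding G_def \<Phi>_def
      by (intro holomorphic_intros) (auto simp: H_def complex_nonpos_Reals_iff complex_eq_iff)
    show "open H" "connected H" unfolding H_def
      by (auto intro: open_halfspace_Re_gt convex_connected convex_halfspace_Re_gt)
    show "of_real ` {s0<..} \<subseteq> H" "of_real (s0 + 1) \<in> H" using s0 by (auto simp: H_def)
    show "complex_of_real (s0 + 1) islimpt of_real ` {s0<..}"
      unfolding islimpt_sequential
    proof (intro exI[of _ "\<lambda>n. complex_of_real (s0 + 1 + 1 / real (Suc n))"] conjI allI)
      fix n
      define r where "r = 1 / real (Suc n)"
      have "r > 0" by (simp add: r_def)
      then have "s0 + 1 + r \<in> {s0<..}" "s0 + 1 + r \<noteq> s0 + 1" by simp_all
      then show "complex_of_real (s0 + 1 + 1 / real (Suc n)) \<in> of_real ` {s0<..} - {complex_of_real (s0 + 1)}"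
        unfolding r_def[symmetric] using of_real_eq_iff by blast
      have "(\<lambda>n. s0 + 1 + 1 / real (Suc n)) \<longlonglongrightarrow> s0 + 1" by real_asymp
      then show "(\<lambda>n. complex_of_real (s0 + 1 + 1 / real (Suc n))) \<longlonglongrightarrow> complex_of_real (s0 + 1)"
        by (rule tendsto_of_real)
    qed
  qed (use that Greal in auto)
  \<comment> \<open>At s = x + i\<omega>, multiplying the identity by x turns the pole of the
    forcing into a factor of size at least 1/2, while x times the transform of y stays below
    M.\<close>
  have ineq: "norm (w i0) / 2 \<le> norm (Complex x \<omega> powr of_real \<alpha> - z) * M
      + norm (of_real x * Complex x \<omega> powr of_real (\<alpha> - 1)) * norm y0" if x: "x > 0" for x
  proof -
    define s where "s = Complex x \<omega>"
    have s: "s \<in> H" "Re s = x" using x by (auto simp: s_def H_def)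
    have "norm (of_real x * \<Phi> s) \<ge> 1 / 2"
    proof -
      have "s - \<i> * of_real \<omega> = of_real x" "s + \<i> * of_real \<omega> = Complex x (2 * \<omega>)"
        by (auto simp: s_def complex_eq_iff)
      then have eq: "of_real x * \<Phi> s = (1 + of_real x / Complex x (2 * \<omega>)) / 2"
        using x by (simp add: \<Phi>_def field_simps)
      \<comment> \<open>The mirror pole cannot cancel the resonant one, since its contribution has
        nonnegative real part.\<close>
      have "Re (of_real x / Complex x (2 * \<omega>)) \<ge> 0"
        using x by (auto simp: Re_divide)
      then have "Re (of_real x * \<Phi> s) \<ge> 1 / 2" unfolding eq by simp
      then show ?thesis using complex_Re_le_cmod order_trans by blast
    qed
    then have "norm (w i0) * (1 / 2) \<le> norm (w i0) * norm (of_real x * \<Phi> s)"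
      by (rule mult_left_mono) simp
    also have "\<dots> = norm (of_real x * (w i0 * \<Phi> s))" by (simp add: norm_mult)
    also have "w i0 * \<Phi> s = (s powr of_real \<alpha> - z) * laplace y s - s powr of_real (\<alpha> - 1) * y0"
      using G0[OF s(1)] by (simp add: G_def)
    also have "of_real x * \<dots> = (s powr of_real \<alpha> - z) * (of_real x * laplace y s) - of_real x * s powr of_real (\<alpha> - 1) * y0"
      by (simp add: algebra_simps)
    also have "norm \<dots> \<le> norm (s powr of_real \<alpha> - z) * norm (of_real x * laplace y s)
        + norm (of_real x * s powr of_real (\<alpha> - 1)) * norm y0"
      using norm_triangle_ineq4 by (metis norm_mult)
    also have "norm (of_real x * laplace y s) \<le> M"
      using laplace_bounded(2)[OF yc yM, of s] s x by (simp add: norm_mult field_simps H_def)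
    finally show ?thesis by (simp add: s_def mult_left_mono)
  qed
  have "((\<lambda>x. norm (Complex x \<omega> powr of_real \<alpha> - z) * M
      + norm (of_real x * Complex x \<omega> powr of_real (\<alpha> - 1)) * norm y0) \<longlongrightarrow> norm (z - z) * M + norm (0::complex) * norm y0) (at_right 0)"
    by (intro tendsto_intros \<omega>)
  then have "norm (w i0) / 2 \<le> norm (z - z) * M + norm (0::complex) * norm y0"
  proof (rule tendsto_lowerbound)
    show "\<forall>\<^sub>F x in at_right 0. norm (w i0) / 2 \<le> norm (Complex x \<omega> powr of_real \<alpha> - z) * M
      + norm (of_real x * Complex x \<omega> powr of_real (\<alpha> - 1)) * norm y0"
      by (rule eventually_mono[OF eventually_at_right_less[of 0]]) (rule ineq)
  qed simp
  then show False using w(1) by simp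
qed

section \<open>Inverse Laplace transforms as contour integrals\<close>

lemma integrable_exp_abs:
  fixes a :: real
  assumes "a > 0"
  shows "integrable lborel (\<lambda>x. exp (- (a * \<bar>x\<bar>)))"
proof -
  define g where "g = (\<lambda>x. indicator {0..} x *\<^sub>R exp (- (a * x)))"
  have 1: "integrable lborel g"
    using integral_exp_decay(1)[OF assms] by (simp add: set_integrable_def g_def)
  have 2: "integrable lborel (\<lambda>x. g (0 + (-1) * x))"
    by (rule lborel_integrable_real_affine[OF 1]) simp
  have "integrable lborel (\<lambda>x. g x + g (0 + (-1) * x))"
    by (rule Bochner_Integration.integrable_add[OF 1 2])
  then show ?thesis
    by (rule Bochner_Integration.integrable_bound) (auto simp: g_def indicator_def)
qed

text \<open>The ray is parametrized by r = e^x, so e^x is the Jacobian. Integrating |exp (r u t)|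
  over t first gives 1 / (-r Re u), which cancels the Jacobian; the decay of \<open>m\<close> at
  both ends then makes the double integral absolutely convergent.\<close>

lemma laplace_ray_integral:
  fixes m :: "real \<Rightarrow> complex" and u :: complex
  assumes u: "norm u = 1" "Re u < 0" and m: "m \<in> borel_measurable borel"
    and bound: "\<And>x. norm (m x) \<le> C * exp (- (a * \<bar>x\<bar>))" and a: "a > 0"
  defines "Q \<equiv> \<lambda>t. LBINT x. exp (of_real (t * exp x) * u) * (of_real (exp x) * u * m x)"
  shows "set_integrable lborel {0..} Q"
    and "s > 0 \<Longrightarrow> integrable lborel (\<lambda>x. of_real (exp x) * u * m x / (of_real s - of_real (exp x) * u))"
    and "s > 0 \<Longrightarrow> laplace Q (of_real s) = (LBINT x. of_real (exp x) * u * m x / (of_real s - of_real (exp x) * u))"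
proof -
  note [measurable] = m
  define \<kappa> where "\<kappa> = - Re u"
  have \<kappa>: "\<kappa> > 0" using u by (simp add: \<kappa>_def)
  \<comment> \<open>The case s = 0 yields integrability of Q itself, s > 0 its transform.\<close>
  have main: "integrable (lborel \<Otimes>\<^sub>M lborel)
      (\<lambda>(x, t). indicator {0..} t *\<^sub>R (exp (- (of_real s * of_real t)) * (exp (of_real (t * exp x) * u) * (of_real (exp x) * u * m x))))"
    if s: "s \<ge> 0" for s :: real
  proof -
    define f where "f = (\<lambda>x t. indicator {0..} t *\<^sub>R (exp (- (complex_of_real s * of_real t)) * (exp (of_real (t * exp x) * u) * (of_real (exp x) * u * m x))))"
    have fm: "(\<lambda>(x, t). f x t) \<in> borel_measurable (lborel \<Otimes>\<^sub>M lborel)"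
      unfolding f_def by measurable
    have pos: "s + \<kappa> * exp x > 0" for x using s \<kappa> by (simp add: add_nonneg_pos)
    have nf: "norm (f x t) = (exp x * norm (m x)) * (indicator {0..} t *\<^sub>R exp (- ((s + \<kappa> * exp x) * t)))" for x t
      using u(1) by (simp add: f_def norm_mult \<kappa>_def exp_add[symmetric] algebra_simps)
    have fi: "integrable lborel (\<lambda>t. f x t)" for x
    proof -
      have "integrable lborel (\<lambda>t. norm (f x t))"
        unfolding nf using integral_exp_decay(1)[OF pos[of x]]
        by (intro integrable_mult_right) (simp add: set_integrable_def)
      moreover have "f x \<in> borel_measurable lborel" unfolding f_def by measurable
      ultimately show ?thesis by (simp add: integrable_norm_iff)
    qed
    have fI: "(LBINT t. norm (f x t)) = exp x * norm (m x) / (s + \<kappa> * exp x)" for x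
      unfolding nf using integral_exp_decay(2)[OF pos[of x]] by (simp add: set_lebesgue_integral_def)
    have "integrable lborel (\<lambda>x. LBINT t. norm (f x t))"
      unfolding fI
    proof (rule Bochner_Integration.integrable_bound)
      show "integrable lborel (\<lambda>x. C / \<kappa> * exp (- (a * \<bar>x\<bar>)))"
        by (rule integrable_mult_right, rule integrable_exp_abs[OF a])
      show "AE x in lborel. norm (exp x * norm (m x) / (s + \<kappa> * exp x)) \<le> norm (C / \<kappa> * exp (- (a * \<bar>x\<bar>)))"
      proof (rule AE_I2)
        fix x
        have "exp x * norm (m x) / (s + \<kappa> * exp x) \<le> exp x * norm (m x) / (\<kappa> * exp x)"
          using s \<kappa> pos[of x] by (intro divide_left_mono mult_pos_pos) auto
        also have "\<dots> = norm (m x) / \<kappa>" by simp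
        also have "\<dots> \<le> C / \<kappa> * exp (- (a * \<bar>x\<bar>))"
          using bound[of x] \<kappa> by (simp add: divide_right_mono)
        also have "\<dots> \<le> norm (C / \<kappa> * exp (- (a * \<bar>x\<bar>)))"
          unfolding real_norm_def by (rule abs_ge_self)
        finally show "norm (exp x * norm (m x) / (s + \<kappa> * exp x)) \<le> norm (C / \<kappa> * exp (- (a * \<bar>x\<bar>)))"
          using pos[of x] by (subst real_norm_def, subst abs_of_nonneg) auto
      qed
    qed measurable
    then have "integrable (lborel \<Otimes>\<^sub>M lborel) (\<lambda>(x, t). f x t)"
      by (intro lborel_pair.Fubini_integrable[OF fm]) (use fi in auto)
    then show ?thesis by (simp add: f_def)
  qed
  show "set_integrable lborel {0..} Q"
    using lborel_pair.integrable_snd[OF main[of 0]]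
    by (simp add: set_integrable_def Q_def)
  show "integrable lborel (\<lambda>x. of_real (exp x) * u * m x / (of_real s - of_real (exp x) * u))"
    and "laplace Q (of_real s) = (LBINT x. of_real (exp x) * u * m x / (of_real s - of_real (exp x) * u))"
    if s: "s > 0"
  proof -
    have inner: "(LBINT t. indicator {0..} t *\<^sub>R (exp (- (of_real s * of_real t)) * (exp (of_real (t * exp x) * u) * (of_real (exp x) * u * m x))))
      = of_real (exp x) * u * m x / (of_real s - of_real (exp x) * u)" for x
    proof -
      have Re: "Re (of_real s - of_real (exp x) * u) > 0"
        using s u(2) mult_pos_neg[of "exp x" "Re u"] by simp
      have "(LBINT t. indicator {0..} t *\<^sub>R (exp (- (of_real s * of_real t)) * (exp (of_real (t * exp x) * u) * (of_real (exp x) * u * m x))))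
        = (LBINT t. (of_real (exp x) * u * m x) * (indicator {0..} t *\<^sub>R (exp (- (of_real s * of_real t)) * exp (of_real (exp x) * u * of_real t))))"
        by (rule Bochner_Integration.integral_cong) (simp_all add: mult_ac)
      also have "\<dots> = (of_real (exp x) * u * m x) * laplace (\<lambda>t. exp (of_real (exp x) * u * of_real t)) (of_real s)"
        unfolding laplace_def set_lebesgue_integral_def by (rule integral_mult_right_zero)
      finally show ?thesis using laplace_exp(2)[OF Re] by simp
    qed
    show "integrable lborel (\<lambda>x. of_real (exp x) * u * m x / (of_real s - of_real (exp x) * u))"
      using lborel_pair.integrable_fst[OF main[of s]] s unfolding inner by simp
    have "laplace Q (of_real s) = (LBINT t. LBINT x. indicator {0..} t *\<^sub>R (exp (- (of_real s * of_real t)) * (exp (of_real (t * exp x) * u) * (of_real (exp x) * u * m x))))"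
      unfolding laplace_def set_lebesgue_integral_def Q_def by simp
    also have "\<dots> = (LBINT x. of_real (exp x) * u * m x / (of_real s - of_real (exp x) * u))"
      using lborel_pair.Fubini_integral[OF main[of s]] s unfolding inner by simp
    finally show "laplace Q (of_real s) = (LBINT x. of_real (exp x) * u * m x / (of_real s - of_real (exp x) * u))" .
  qed
qed

lemma contour_integral_horizontal:
  fixes h :: "complex \<Rightarrow> complex" and a b y :: real
  assumes "a < b"
  shows "contour_integral (linepath (Complex a y) (Complex b y)) h = integral {a..b} (\<lambda>x. h (Complex x y))"
proof -
  have "contour_integral (linepath (Complex a y) (Complex b y)) h =
      (Complex b y - Complex a y) * integral {0..1} (\<lambda>x. h (linepath (Complex a y) (Complex b y) x))"
    by (simp add: contour_integral_integral)
  also have "Complex b y - Complex a y = of_real (b - a)"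
    by (simp add: complex_eq_iff)
  also have "integral {0..1} (\<lambda>x. h (linepath (Complex a y) (Complex b y) x)) =
      integral {0..(b - a) / (b - a)} (\<lambda>x. h (Complex (a + (b - a) * x) y))"
    using assms by (simp add: linepath_def Complex_eq scaleR_conv_of_real algebra_simps)
  also have "{0..(b - a) / (b - a)} = (\<lambda>x. x / (b - a)) ` {0..b - a}"
    using assms by simp
  also have "integral \<dots> (\<lambda>x. h (Complex (a + (b - a) * x) y)) =
      integral {a-a..b-a} (\<lambda>x. h (Complex (x + a) y)) / of_real (b - a)"
    using assms by (subst integral_stretch_real) (auto simp: scaleR_conv_of_real add_ac)
  also have "\<dots> = integral {a..b} (\<lambda>x. h (Complex x y)) / of_real (b - a)"
    by (subst integral_shift_real_ivl) simp_all
  finally show ?thesis using assms by simp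
qed

text \<open>Residue theorem on the rectangle [-N, N] x [-\<theta>, \<theta>], counterclockwise, so
  the lower line counts positively and the upper one negatively. The vertical sides have fixed
  length 2\<theta>, and b1, b2 make their contribution vanish.\<close>

lemma line_integral_difference:
  fixes h :: "complex \<Rightarrow> complex" and \<theta> \<theta>' :: real
  assumes \<theta>: "0 < \<theta>" "\<theta> < \<theta>'" and P: "finite P" "\<And>p. p \<in> P \<Longrightarrow> \<bar>Im p\<bar> < \<theta>"
    and hol: "h holomorphic_on {w. \<bar>Im w\<bar> < \<theta>'} - P"
    and int: "integrable lborel (\<lambda>x. h (Complex x \<theta>))" "integrable lborel (\<lambda>x. h (Complex x (- \<theta>)))"
    and b: "(b1 \<longlongrightarrow> 0) at_top" "(b2 \<longlongrightarrow> 0) at_top"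
    and bound: "\<forall>\<^sub>F x in at_top. \<forall>y. \<bar>y\<bar> \<le> \<theta> \<longrightarrow> norm (h (Complex x y)) \<le> b1 x"
      "\<forall>\<^sub>F x in at_top. \<forall>y. \<bar>y\<bar> \<le> \<theta> \<longrightarrow> norm (h (Complex (- x) y)) \<le> b2 x"
  shows "(LBINT x. h (Complex x (- \<theta>))) - (LBINT x. h (Complex x \<theta>)) = 2 * pi * \<i> * (\<Sum>p\<in>P. residue h p)"
proof -
  define S where "S = {w. \<bar>Im w\<bar> < \<theta>'}"
  have S_eq: "S = {w. Im w < \<theta>'} \<inter> {w. Im w > - \<theta>'}" by (auto simp: S_def)
  have opS: "open S" unfolding S_eq by (intro open_Int open_halfspace_Im_lt open_halfspace_Im_gt)
  have cvS: "convex S" unfolding S_eq by (intro convex_Int convex_halfspace_Im_lt convex_halfspace_Im_gt)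
  obtain R where R: "\<And>p. p \<in> P \<Longrightarrow> \<bar>Re p\<bar> < R"
  proof (rule that[of "(\<Sum>p\<in>P. \<bar>Re p\<bar>) + 1"])
    fix p assume "p \<in> P"
    then have "\<bar>Re p\<bar> \<le> (\<Sum>p\<in>P. \<bar>Re p\<bar>)" by (intro member_le_sum P) auto
    then show "\<bar>Re p\<bar> < (\<Sum>p\<in>P. \<bar>Re p\<bar>) + 1" by simp
  qed
  define F where "F = (\<lambda>N::nat. integral {- real N..real N} (\<lambda>x. h (Complex x (- \<theta>)))
      - integral {- real N..real N} (\<lambda>x. h (Complex x \<theta>)))"
  define K where "K = 2 * pi * \<i> * (\<Sum>p\<in>P. residue h p)"
  have rect: "norm (F N - K) \<le> (b1 (real N) + b2 (real N)) * (2 * \<theta>)"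
    if N: "real N > R" "N > 0" and bN: "\<And>y. \<bar>y\<bar> \<le> \<theta> \<Longrightarrow> norm (h (Complex (real N) y)) \<le> b1 (real N)"
      "\<And>y. \<bar>y\<bar> \<le> \<theta> \<Longrightarrow> norm (h (Complex (- real N) y)) \<le> b2 (real N)" for N
  proof -
    define n where "n = real N"
    have n: "n > 0" "n > R" using N by (auto simp: n_def)
    define a1 a2 a3 a4 where "a1 = Complex (- n) (- \<theta>)" "a2 = Complex n (- \<theta>)" "a3 = Complex n \<theta>" "a4 = Complex (- n) \<theta>"
    note a_defs = a1_a2_a3_a4_def
    define g where "g = rectpath a1 a3"
    have g_eq: "g = linepath a1 a2 +++ linepath a2 a3 +++ linepath a3 a4 +++ linepath a4 a1"
      by (simp add: g_def rectpath_def a_defs Let_def)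
    have img: "path_image g \<subseteq> S - P"
      unfolding g_def
      by (subst path_image_rectpath) (use n \<theta> R P(2) in \<open>force simp: a_defs S_def\<close>)+
    have segs: "closed_segment a1 a2 \<subseteq> S - P" "closed_segment a2 a3 \<subseteq> S - P"
      "closed_segment a3 a4 \<subseteq> S - P" "closed_segment a4 a1 \<subseteq> S - P"
      using img unfolding g_eq by (auto simp: path_image_join)
    have hc: "continuous_on (S - P) h"
      using hol unfolding S_def by (rule holomorphic_on_imp_continuous_on)
    have ci: "h contour_integrable_on linepath a1 a2" "h contour_integrable_on linepath a2 a3"
      "h contour_integrable_on linepath a3 a4" "h contour_integrable_on linepath a4 a1"
      using segs by (auto intro!: contour_integrable_continuous_linepath continuous_on_subset[OF hc])
    have sub: "path_image g \<subseteq> S" using img by auto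
    have "contour_integral g h = 2 * pi * \<i> * (\<Sum>p\<in>P. winding_number g p * residue h p)"
    proof (rule Residue_theorem[OF opS convex_connected[OF cvS] P(1) _ _ _ img])
      show "h holomorphic_on S - P" using hol by (simp add: S_def)
      show "\<forall>z. z \<notin> S \<longrightarrow> winding_number g z = 0"
        using winding_number_zero_outside[OF _ cvS _ _ sub] by (auto simp: g_def)
    qed (auto simp: g_def)
    also have "(\<Sum>p\<in>P. winding_number g p * residue h p) = (\<Sum>p\<in>P. residue h p)"
    proof (rule sum.cong[OF refl])
      fix p assume "p \<in> P"
      then have "\<bar>Re p\<bar> < n" "\<bar>Im p\<bar> < \<theta>" using R[of p] P(2)[of p] n by auto
      then have "p \<in> box a1 a3" by (auto simp: in_box_complex_iff a_defs)
      then show "winding_number g p * residue h p = residue h p"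
        by (simp add: g_def winding_number_rectpath)
    qed
    finally have 1: "contour_integral g h = K" by (simp add: K_def)
    have "contour_integral g h = contour_integral (linepath a1 a2) h + contour_integral (linepath a2 a3) h
        + contour_integral (linepath a3 a4) h + contour_integral (linepath a4 a1) h"
      unfolding g_eq using ci by (simp add: contour_integral_join contour_integrable_joinI add.assoc)
    also have "contour_integral (linepath a1 a2) h = integral {- n..n} (\<lambda>x. h (Complex x (- \<theta>)))"
      unfolding a_defs by (rule contour_integral_horizontal) (use n in simp)
    also have "contour_integral (linepath a3 a4) h = - contour_integral (linepath a4 a3) h"
      using contour_integral_reversepath[of "linepath a4 a3" h] by simp
    also have "contour_integral (linepath a4 a3) h = integral {- n..n} (\<lambda>x. h (Complex x \<theta>))"
      unfolding a_defs by (rule contour_integral_horizontal) (use n in simp)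
    finally have 2: "F N - K = - (contour_integral (linepath a2 a3) h + contour_integral (linepath a4 a1) h)"
      using 1 by (simp add: F_def n_def)
    have "norm (contour_integral (linepath a2 a3) h) \<le> b1 n * norm (a3 - a2)"
    proof (rule contour_integral_bound_linepath[OF ci(2)])
      show "0 \<le> b1 n" using order_trans[OF norm_ge_zero bN(1)[of 0]] \<theta> by (simp add: n_def)
      show "norm (h x) \<le> b1 n" if "x \<in> closed_segment a2 a3" for x
        using that bN(1)[of "Im x"] \<theta>
        by (cases x) (auto simp: a_defs closed_segment_same_Re closed_segment_eq_real_ivl n_def)
    qed
    also have "a3 - a2 = \<i> * of_real (2 * \<theta>)" by (simp add: a_defs complex_eq_iff)
    also have "norm \<dots> = 2 * \<theta>" using \<theta> by (simp add: norm_mult)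
    finally have 3: "norm (contour_integral (linepath a2 a3) h) \<le> b1 n * (2 * \<theta>)" .
    have "norm (contour_integral (linepath a4 a1) h) \<le> b2 n * norm (a1 - a4)"
    proof (rule contour_integral_bound_linepath[OF ci(4)])
      show "0 \<le> b2 n" using order_trans[OF norm_ge_zero bN(2)[of 0]] \<theta> by (simp add: n_def)
      show "norm (h x) \<le> b2 n" if "x \<in> closed_segment a4 a1" for x
        using that bN(2)[of "Im x"] \<theta>
        by (cases x) (auto simp: a_defs closed_segment_same_Re closed_segment_eq_real_ivl n_def)
    qed
    also have "a1 - a4 = - (\<i> * of_real (2 * \<theta>))" by (simp add: a_defs complex_eq_iff)
    also have "norm \<dots> = 2 * \<theta>" using \<theta> by (simp add: norm_mult)
    finally have 4: "norm (contour_integral (linepath a4 a1) h) \<le> b2 n * (2 * \<theta>)" .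
    show ?thesis
      unfolding 2 norm_minus_cancel using norm_triangle_mono[OF 3 4] by (simp add: n_def ring_distribs)
  qed
  have "F \<longlonglongrightarrow> K"
  proof (rule LIM_zero_cancel, rule Lim_null_comparison)
    have ev: "\<forall>\<^sub>F x in at_top. x > R \<and> x > 0 \<and> (\<forall>y. \<bar>y\<bar> \<le> \<theta> \<longrightarrow> norm (h (Complex x y)) \<le> b1 x)
       \<and> (\<forall>y. \<bar>y\<bar> \<le> \<theta> \<longrightarrow> norm (h (Complex (- x) y)) \<le> b2 x)"
      by (intro eventually_conj bound eventually_gt_at_top)
    show "\<forall>\<^sub>F N in sequentially. norm (F N - K) \<le> (b1 (real N) + b2 (real N)) * (2 * \<theta>)"
      by (rule eventually_mono[OF eventually_compose_filterlim[OF ev filterlim_real_sequentially]])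
         (auto intro!: rect)
    have "((\<lambda>x. (b1 x + b2 x) * (2 * \<theta>)) \<longlongrightarrow> (0 + 0) * (2 * \<theta>)) at_top"
      by (intro tendsto_intros b)
    then show "(\<lambda>N. (b1 (real N) + b2 (real N)) * (2 * \<theta>)) \<longlonglongrightarrow> 0"
      using filterlim_compose[OF _ filterlim_real_sequentially] by simp
  qed
  moreover have "F \<longlonglongrightarrow> (LBINT x. h (Complex x (- \<theta>))) - (LBINT x. h (Complex x \<theta>))"
  proof -
    have lim: "(\<lambda>N. integral {- real N..real N} f) \<longlonglongrightarrow> integral\<^sup>L lborel f" 
      if f: "integrable lborel f" for f :: "real \<Rightarrow> complex"
    proof -
      have U: "(\<Union>N. {- real N..real N}) = (UNIV :: real set)"
      proof (intro set_eqI iffI UNIV_I)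
        fix x :: real
        obtain N where "\<bar>x\<bar> \<le> real N" using real_arch_simple by blast
        then show "x \<in> (\<Union>N. {- real N..real N})" by (auto intro!: exI[of _ N])
      qed
      have fU: "set_integrable lborel UNIV f" using f by (simp add: set_integrable_def)
      have "(\<lambda>N. LBINT x:{- real N..real N}. f x) \<longlonglongrightarrow> (LBINT x:UNIV. f x)"
        using set_integral_cont_up[of "\<lambda>N. {- real N..real N}" lborel f] fU unfolding U
        by (auto simp: incseq_def)
      moreover have "(LBINT x:{- real N..real N}. f x) = integral {- real N..real N} f" for N
        by (rule set_borel_integral_eq_integral(2)) (auto intro!: set_integrable_subset[OF fU])
      ultimately show ?thesis by (simp add: set_lebesgue_integral_def)
    qed
    show ?thesis unfolding F_def by (intro tendsto_diff lim int)
  qed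
  ultimately show ?thesis unfolding K_def by (rule LIMSEQ_unique[symmetric])
qed

section \<open>Integrable kernels for 1 / (s^\<alpha> - \<zeta>)\<close>

lemma ray_distance:
  fixes \<zeta> :: complex
  assumes "\<And>r. r \<ge> 0 \<Longrightarrow> of_real r \<noteq> \<zeta>"
  obtains \<delta> where "\<delta> > 0" "\<And>r. r \<ge> 0 \<Longrightarrow> norm (of_real r - \<zeta>) \<ge> \<delta> * (1 + r)"
proof -
  obtain d where d: "d > 0" "\<And>r. r \<ge> 0 \<Longrightarrow> norm (of_real r - \<zeta>) \<ge> d"
  proof (cases "Im \<zeta> = 0")
    case True
    then have "Re \<zeta> < 0"
      using assms[of "Re \<zeta>"] by (force simp: complex_eq_iff)
    moreover have "norm (of_real r - \<zeta>) \<ge> - Re \<zeta>" if "r \<ge> 0" for r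
      using complex_Re_le_cmod[of "of_real r - \<zeta>"] that by simp
    ultimately show ?thesis using that[of "- Re \<zeta>"] by simp
  next
    case False
    have "norm (of_real r - \<zeta>) \<ge> \<bar>Im \<zeta>\<bar>" for r
      using abs_Im_le_cmod[of "of_real r - \<zeta>"] by simp
    then show ?thesis using that[of "\<bar>Im \<zeta>\<bar>"] False by simp
  qed
  \<comment> \<open>With n the distance to be bounded: 1 \<le> n / d, r \<le> n + |\<zeta>| and
    |\<zeta>| \<le> n |\<zeta>| / d. Adding up gives K.\<close>
  define K where "K = 1 / d + 1 + norm \<zeta> / d"
  have K: "K > 0" using d(1) by (simp add: K_def add_pos_nonneg)
  have "1 + r \<le> norm (of_real r - \<zeta>) * K" if r: "r \<ge> 0" for r
  proof -
    define n where "n = norm (of_real r - \<zeta>)"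
    have n: "n \<ge> d" unfolding n_def by (rule d(2)[OF r])
    have "r \<le> n + norm \<zeta>"
      using norm_triangle_ineq[of "of_real r - \<zeta>" \<zeta>] r by (simp add: n_def)
    moreover have "norm \<zeta> \<le> n * (norm \<zeta> / d)"
      using n d(1) mult_right_mono[OF n, of "norm \<zeta> / d"] by simp
    moreover have "1 \<le> n * (1 / d)" using n d(1) by simp
    ultimately show ?thesis unfolding n_def[symmetric] K_def by (simp add: ring_distribs)
  qed
  then show ?thesis
    using that[of "1 / K"] K by (simp add: field_simps)
qed

lemma tendsto_quotient_simple_zero:
  fixes g :: "complex \<Rightarrow> complex"
  assumes "(g has_field_derivative D) (at z)" "g z = 0" "D \<noteq> 0"
  shows "((\<lambda>w. (w - z) / g w) \<longlongrightarrow> 1 / D) (at z)"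
proof -
  have "((\<lambda>w. g w / (w - z)) \<longlongrightarrow> D) (at z)"
    using assms(1,2) by (simp add: has_field_derivative_iff)
  then have "((\<lambda>w. inverse (g w / (w - z))) \<longlongrightarrow> inverse D) (at z)"
    using assms(3) by (rule tendsto_inverse)
  then show ?thesis by (simp add: inverse_eq_divide)
qed

lemma exp_eq_imp_Ln:
  assumes "exp v = z" "\<bar>Im v\<bar> < pi"
  shows "v = Ln z"
  using Ln_exp[of v] assms by auto

text \<open>\<theta> > pi/2 makes exponentials decay along the rays. \<open>\<theta>'\<close>
  provides an open strip around the closed rectangles, and its bound pi keeps exp injective there.
  \<open>pole\<close> keeps the singularity Ln \<zeta> / \<alpha> off the integration lines: it lies
  strictly between them or outside the open strip.\<close>

context
  fixes \<alpha> :: real and \<zeta> :: complex and \<theta> \<theta>' :: real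
  assumes \<alpha>: "0 < \<alpha>" "\<alpha> < 1" and \<zeta>: "\<zeta> \<noteq> 0"
    and \<theta>: "pi / 2 < \<theta>" "\<theta> < \<theta>'" "\<theta>' \<le> pi"
    and pole: "\<bar>Im (Ln \<zeta> / of_real \<alpha>)\<bar> < \<theta> \<or> \<bar>Im (Ln \<zeta> / of_real \<alpha>)\<bar> \<ge> \<theta>'"
begin

text \<open>Its exponential is the root of s^\<alpha> = \<zeta> on the principal branch, if there is
  one.\<close>

definition "branch_pole = Ln \<zeta> / of_real \<alpha>"

text \<open>With $s = e^w$ the rays become the lines $\mathrm{Im}\, w = \pm\theta$ and the contour arcs
  the sides of a rectangle. The second summand, the transform of $e^{-t}/\zeta$, cancels the limit
  $-1/\zeta$ at $s = 0$: the sum decays at both ends of each line, so its inverse transform is in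
  $L^1$.\<close>
definition ray_density :: "complex \<Rightarrow> complex" where
  "ray_density w = 1 / (exp (of_real \<alpha> * w) - \<zeta>) + 1 / (\<zeta> * (1 + exp w))"

text \<open>The Cauchy kernel in the logarithmic variable: with \<sigma> = e^w this is the density
  times d\<sigma> / (s - \<sigma>), and \<open>exp w\<close> is the Jacobian.\<close>

definition line_integrand :: "real \<Rightarrow> complex \<Rightarrow> complex" where
  "line_integrand s w = exp w * ray_density w / (of_real s - exp w)"

lemma exp_branch_pole: "exp (of_real \<alpha> * branch_pole) = \<zeta>"
  using \<alpha> \<zeta> by (simp add: branch_pole_def)

text \<open>As \<alpha> < 1, the imaginary part of \<alpha> w stays below pi in modulus, where Ln
  inverts exp. The gap in \<open>pole\<close> then lowers the bound from \<open>\<theta>'\<close> to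
  \<open>\<theta>\<close>.\<close>

lemma exp_alpha_eq:
  assumes "\<bar>Im w\<bar> < \<theta>'" "exp (of_real \<alpha> * w) = \<zeta>"
  shows "w = branch_pole" "\<bar>Im branch_pole\<bar> < \<theta>"
proof -
  have "\<bar>Im (of_real \<alpha> * w)\<bar> < pi"
  proof -
    have "\<alpha> * \<bar>Im w\<bar> \<le> 1 * \<bar>Im w\<bar>" using \<alpha> by (intro mult_right_mono) auto
    then show ?thesis using assms(1) \<theta> \<alpha> by (simp add: abs_mult)
  qed
  then have "of_real \<alpha> * w = Ln \<zeta>" using exp_eq_imp_Ln assms(2) by blast
  then show "w = branch_pole" using \<alpha> by (auto simp: branch_pole_def field_simps)
  then show "\<bar>Im branch_pole\<bar> < \<theta>" using assms(1) pole by (auto simp: branch_pole_def)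
qed

text \<open>The auxiliary pole at s = -1 corresponds to |Im w| \<ge> pi, outside the open
  strip.\<close>

lemma one_plus_exp_nz:
  assumes "\<bar>Im w\<bar> < \<theta>'"
  shows "1 + exp w \<noteq> 0"
proof
  assume "1 + exp w = 0"
  then have "exp w = - 1" by (simp add: add_eq_0_iff)
  then have "w = Ln (- 1)" using exp_eq_imp_Ln[of w "- 1"] assms \<theta> by simp
  then show False using assms \<theta> by simp
qed

lemma exp_eq_real:
  assumes "\<bar>Im w\<bar> < \<theta>'" "exp w = of_real s" "s > 0"
  shows "w = of_real (ln s)"
  using exp_eq_imp_Ln[of w "of_real s"] assms \<theta> by (simp add: Ln_of_real)

definition strip_poles :: "real \<Rightarrow> complex set" where
  "strip_poles s = insert (of_real (ln s)) (if \<bar>Im branch_pole\<bar> < \<theta> then {branch_pole} else {})"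

lemma holomorphic_on_line_integrand:
  assumes "s > 0"
  shows "line_integrand s holomorphic_on {w. \<bar>Im w\<bar> < \<theta>'} - strip_poles s"
proof -
  let ?S = "{w. \<bar>Im w\<bar> < \<theta>'} - strip_poles s"
  have 1: "exp (of_real \<alpha> * w) - \<zeta> \<noteq> 0" if "w \<in> ?S" for w
    using exp_alpha_eq[of w] that by (auto simp: strip_poles_def)
  have 2: "\<zeta> * (1 + exp w) \<noteq> 0" if "w \<in> ?S" for w
    using one_plus_exp_nz[of w] that \<zeta> by simp
  have 3: "of_real s - exp w \<noteq> 0" if "w \<in> ?S" for w
  proof
    assume "of_real s - exp w = 0"
    then have "w = of_real (ln s)" using exp_eq_real[of w s] that assms by simp
    then show False using that by (simp add: strip_poles_def)
  qed
  show ?thesis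
    unfolding line_integrand_def ray_density_def by (intro holomorphic_intros) (use 1 2 3 in blast)+
qed

text \<open>\<open>ne\<close> separates this pole from \<open>branch_pole\<close>, so it is simple.
  The derivative of s - e^w there is -s, which cancels the factor e^w = s up to sign.\<close>

lemma residue_line_integrand_real:
  assumes s: "s > 0" and ne: "exp (of_real \<alpha> * of_real (ln s)) \<noteq> \<zeta>"
  shows "residue (line_integrand s) (of_real (ln s)) = - ray_density (of_real (ln s))"
proof (rule residue_simple')
  let ?z = "complex_of_real (ln s)"
  let ?S = "{w. Im w < \<theta>'} \<inter> {w. Im w > - \<theta>'} - {branch_pole}"
  show "open ?S" by (intro open_Int open_delete open_halfspace_Im_lt open_halfspace_Im_gt)
  have zpt: "?z \<noteq> branch_pole" using ne exp_branch_pole by auto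
  then show "?z \<in> ?S" using \<theta> pi_gt_zero by auto
  show "line_integrand s holomorphic_on ?S - {?z}"
    by (rule holomorphic_on_subset[OF holomorphic_on_line_integrand[OF s]]) (auto simp: strip_poles_def abs_less_iff split: if_splits)
  have ez: "exp ?z = of_real s" using s by (simp add: exp_of_real)
  have "((\<lambda>w. of_real s - exp w) has_field_derivative - of_real s) (at ?z)"
    by (auto intro!: derivative_eq_intros simp: ez)
  then have 1: "((\<lambda>w. (w - ?z) / (of_real s - exp w)) \<longlongrightarrow> 1 / (- of_real s)) (at ?z)"
    by (rule tendsto_quotient_simple_zero) (use s ez in auto)
  have "isCont (\<lambda>w. exp w * ray_density w) ?z"
    unfolding ray_density_def using ne \<zeta> one_plus_exp_nz[of ?z] \<theta> pi_gt_zero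
    by (intro continuous_intros) auto
  then have "((\<lambda>w. exp w * ray_density w) \<longlongrightarrow> of_real s * ray_density ?z) (at ?z)"
    by (simp add: isCont_def ez)
  from tendsto_mult[OF this 1] show "((\<lambda>w. line_integrand s w * (w - ?z)) \<longlongrightarrow> - ray_density ?z) (at ?z)"
    using s by (simp add: line_integrand_def)
qed

text \<open>Only the first summand of the density is singular here, and the derivative of exp
  (\<alpha> w) at the pole is \<alpha> \<zeta>.\<close>

lemma residue_line_integrand_branch_pole:
  assumes s: "s > 0" and ne: "exp (of_real \<alpha> * of_real (ln s)) \<noteq> \<zeta>" and branch_pole: "\<bar>Im branch_pole\<bar> < \<theta>"
  shows "residue (line_integrand s) branch_pole = exp branch_pole / (of_real \<alpha> * \<zeta>) / (of_real s - exp branch_pole)"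
proof (rule residue_simple')
  let ?z = "complex_of_real (ln s)"
  let ?S = "{w. Im w < \<theta>'} \<inter> {w. Im w > - \<theta>'} - {?z}"
  have ptT: "\<bar>Im branch_pole\<bar> < \<theta>'" using branch_pole \<theta> by simp
  show "open ?S" by (intro open_Int open_delete open_halfspace_Im_lt open_halfspace_Im_gt)
  have zpt: "?z \<noteq> branch_pole" using ne exp_branch_pole by auto
  then show "branch_pole \<in> ?S" using ptT by (auto simp: abs_less_iff)
  show "line_integrand s holomorphic_on ?S - {branch_pole}"
    by (rule holomorphic_on_subset[OF holomorphic_on_line_integrand[OF s]]) (auto simp: strip_poles_def abs_less_iff split: if_splits)
  have sn: "of_real s \<noteq> exp branch_pole" using exp_eq_real[OF ptT _ s] zpt by metis
  have "((\<lambda>w. exp (of_real \<alpha> * w) - \<zeta>) has_field_derivative of_real \<alpha> * \<zeta>) (at branch_pole)"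
    by (auto intro!: derivative_eq_intros simp: exp_branch_pole)
  then have 1: "((\<lambda>w. (w - branch_pole) / (exp (of_real \<alpha> * w) - \<zeta>)) \<longlongrightarrow> 1 / (of_real \<alpha> * \<zeta>)) (at branch_pole)"
    by (rule tendsto_quotient_simple_zero) (use \<alpha> \<zeta> exp_branch_pole in auto)
  have 2: "((\<lambda>w. exp w / (of_real s - exp w)) \<longlongrightarrow> exp branch_pole / (of_real s - exp branch_pole)) (at branch_pole)"
    by (intro tendsto_intros) (use sn in auto)
  have 3: "((\<lambda>w. (w - branch_pole) / (\<zeta> * (1 + exp w))) \<longlongrightarrow> (branch_pole - branch_pole) / (\<zeta> * (1 + exp branch_pole))) (at branch_pole)"
    by (intro tendsto_intros) (use \<zeta> one_plus_exp_nz[OF ptT] in auto)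
  from tendsto_mult[OF 2 tendsto_add[OF 1 3]]
  show "((\<lambda>w. line_integrand s w * (w - branch_pole)) \<longlongrightarrow> exp branch_pole / (of_real \<alpha> * \<zeta>) / (of_real s - exp branch_pole)) (at branch_pole)"
    by (simp add: line_integrand_def ray_density_def ring_distribs add_divide_distrib divide_divide_eq_left mult_ac)
qed

lemma exp_Complex: "exp (Complex x y) = of_real (exp x) * cis y"
  using exp_eq_polar[of "Complex x y"] by (simp only: complex.sel)

lemma exp_alpha_Complex: "exp (of_real \<alpha> * Complex x y) = of_real (exp (\<alpha> * x)) * cis (\<alpha> * y)"
  unfolding exp_eq_polar[of "of_real \<alpha> * Complex x y"] by simp

text \<open>Over a common denominator the constants \<zeta> and -\<zeta> cancel, leaving the
  numerator \<zeta> e^w + e^{\<alpha> w}. At the left end, where neither summand decays alone, it is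
  of order e^{\<alpha> x}; at the right end it is of order e^x against a denominator of order
  e^{(1+\<alpha>) x}.\<close>

lemma ray_density_bound:
  assumes y: "\<bar>y\<bar> = \<theta>"
  obtains C where "\<And>x. norm (ray_density (Complex x y)) \<le> C * exp (- (\<alpha> * \<bar>x\<bar>))"
proof -
  have yT: "\<bar>y\<bar> < \<theta>'" using y \<theta> by simp
  \<comment> \<open>A hit would be a zero of exp (\<alpha> w) - \<zeta> with |Im w| = \<theta>, but
    \<open>exp_alpha_eq\<close> puts such zeros strictly between the lines.\<close>
  have 1: "of_real r \<noteq> \<zeta> / cis (\<alpha> * y)" if r: "r \<ge> 0" for r
  proof
    assume *: "of_real r = \<zeta> / cis (\<alpha> * y)"
    then have "r \<noteq> 0" using \<zeta> by auto
    with r have r0: "r > 0" by simp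
    have "exp (of_real \<alpha> * Complex (ln r / \<alpha>) y) = of_real r * cis (\<alpha> * y)"
      unfolding exp_alpha_Complex using \<alpha> r0 by simp
    also have "\<dots> = \<zeta>" using * by simp
    finally have e: "exp (of_real \<alpha> * Complex (ln r / \<alpha>) y) = \<zeta>" .
    have "Complex (ln r / \<alpha>) y = branch_pole" "\<bar>Im branch_pole\<bar> < \<theta>"
      by (rule exp_alpha_eq[OF _ e], simp add: yT)+
    then show False using y by (metis complex.sel(2) less_irrefl)
  qed
  have 2: "of_real r \<noteq> - 1 / cis y" if r: "r \<ge> 0" for r
  proof
    assume *: "of_real r = - 1 / cis y"
    then have "r \<noteq> 0" by auto
    with r have r0: "r > 0" by simp
    have "1 + exp (Complex (ln r) y) = 0"
      unfolding exp_Complex using r0 * by simp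
    then show False using one_plus_exp_nz[of "Complex (ln r) y"] yT by simp
  qed
  obtain d1 where d1: "d1 > 0" "\<And>r. r \<ge> 0 \<Longrightarrow> norm (of_real r - \<zeta> / cis (\<alpha> * y)) \<ge> d1 * (1 + r)"
    using ray_distance[OF 1] by blast
  obtain d2 where d2: "d2 > 0" "\<And>r. r \<ge> 0 \<Longrightarrow> norm (of_real r - - 1 / cis y) \<ge> d2 * (1 + r)"
    using ray_distance[OF 2] by blast
  define L where "L = norm \<zeta>"
  have L: "L > 0" using \<zeta> by (simp add: L_def)
  have "norm (ray_density (Complex x y)) \<le> (L + 1) / (L * d1 * d2) * exp (- (\<alpha> * \<bar>x\<bar>))" for x
  proof -
    define E where "E = exp (\<alpha> * x)"
    define X where "X = exp x"
    have pos: "E > 0" "X > 0" by (simp_all add: E_def X_def)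
    define u where "u = exp (of_real \<alpha> * Complex x y) - \<zeta>"
    define v where "v = 1 + exp (Complex x y)"
    have "u = cis (\<alpha> * y) * (of_real E - \<zeta> / cis (\<alpha> * y))"
      by (simp add: u_def exp_alpha_Complex E_def right_diff_distrib mult.commute)
    then have u: "norm u \<ge> d1 * (1 + E)"
      using d1(2)[of E] pos by (simp add: norm_mult)
    have "v = cis y * (of_real X - - 1 / cis y)"
      by (simp add: v_def exp_Complex X_def field_simps)
    then have v: "norm v \<ge> d2 * (1 + X)"
      using d2(2)[of X] pos by (simp add: norm_mult)
    have up: "d1 * (1 + E) > 0" and vp: "d2 * (1 + X) > 0" using d1 d2 pos by auto
    have nz: "u \<noteq> 0" "v \<noteq> 0" using u v up vp by auto
    have "ray_density (Complex x y) = 1 / u + 1 / (\<zeta> * v)" by (simp add: ray_density_def u_def v_def)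
    also have "\<dots> = (\<zeta> * v + u) / (\<zeta> * u * v)"
      using nz \<zeta> by (simp add: field_simps)
    also have "\<zeta> * v + u = \<zeta> * exp (Complex x y) + exp (of_real \<alpha> * Complex x y)"
      by (simp add: u_def v_def ring_distribs)
    also have "norm (\<dots> / (\<zeta> * u * v)) \<le> (L * X + E) / (L * (d1 * (1 + E)) * (d2 * (1 + X)))"
      unfolding norm_divide norm_mult L_def[symmetric]
    proof (intro frac_le mult_mono)
      show "norm (\<zeta> * exp (Complex x y) + exp (of_real \<alpha> * Complex x y)) \<le> L * X + E"
        by (rule norm_triangle_le) (simp add: norm_mult L_def X_def E_def)
    qed (use u v up vp L pos in auto)
    also have "\<dots> = 1 / (L * d1 * d2) * ((L * X + E) / ((1 + E) * (1 + X)))"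
      by (simp add: divide_simps)
    finally have 1: "norm (ray_density (Complex x y)) \<le> 1 / (L * d1 * d2) * ((L * X + E) / ((1 + E) * (1 + X)))" .
    have "(L * X + E) / ((1 + E) * (1 + X)) \<le> (L + 1) * exp (- (\<alpha> * \<bar>x\<bar>))"
    proof (cases "x \<ge> 0")
      case True
      have "E \<le> X" using True \<alpha> by (simp add: E_def X_def mult_left_le_one_le)
      have "(L * X + E) / ((1 + E) * (1 + X)) \<le> (L * X + X) / (E * X)"
        using pos L \<open>E \<le> X\<close> by (intro frac_le mult_mono) auto
      also have "\<dots> = (L + 1) / E" using pos by (simp add: field_simps)
      finally show ?thesis using True by (simp add: E_def exp_minus divide_inverse)
    next
      case False
      have "X \<le> E" using False \<alpha> by (simp add: E_def X_def)
      have "1 * 1 \<le> (1 + E) * (1 + X)" using pos by (intro mult_mono) auto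
      then have "(L * X + E) / ((1 + E) * (1 + X)) \<le> (L * E + E) / 1"
        using pos L \<open>X \<le> E\<close> by (intro frac_le) auto
      also have "\<dots> = (L + 1) * E" by (simp add: ring_distribs)
      finally show ?thesis using False by (simp add: E_def)
    qed
    then have "1 / (L * d1 * d2) * ((L * X + E) / ((1 + E) * (1 + X)))
        \<le> 1 / (L * d1 * d2) * ((L + 1) * exp (- (\<alpha> * \<bar>x\<bar>)))"
      by (rule mult_left_mono) (use L d1 d2 in simp)
    with 1 show ?thesis by simp
  qed
  then show ?thesis using that by blast
qed

text \<open>Right vertical side: the quotient e^w / (s - e^w) has modulus tending to 1, so the decay
  comes from the density. The triangle inequality gives a bound independent of y.\<close>

lemma line_integrand_decay_right:
  assumes s: "s > 0"
  defines "b \<equiv> \<lambda>x. exp x * (1 / (exp (\<alpha> * x) - norm \<zeta>) + 1 / (norm \<zeta> * (exp x - 1))) / (exp x - s)"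
  shows "(b \<longlongrightarrow> 0) at_top" "\<forall>\<^sub>F x in at_top. \<forall>y. norm (line_integrand s (Complex x y)) \<le> b x"
proof -
  have L: "norm \<zeta> > 0" using \<zeta> by simp
  show "(b \<longlongrightarrow> 0) at_top" unfolding b_def using \<alpha> L s by real_asymp
  have "\<forall>\<^sub>F x in at_top. exp (\<alpha> * x) - norm \<zeta> > 0" using \<alpha> by real_asymp
  moreover have "\<forall>\<^sub>F x::real in at_top. exp x - 1 > 0" by real_asymp
  moreover have "\<forall>\<^sub>F x in at_top. exp x - s > 0" by real_asymp
  ultimately show "\<forall>\<^sub>F x in at_top. \<forall>y. norm (line_integrand s (Complex x y)) \<le> b x"
  proof eventually_elim
    case (elim x)
    show ?case
    proof
      fix y
      let ?w = "Complex x y"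
      have n: "norm (exp ?w) = exp x" "norm (exp (of_real \<alpha> * ?w)) = exp (\<alpha> * x)" by simp_all
      have 1: "norm (exp (of_real \<alpha> * ?w) - \<zeta>) \<ge> exp (\<alpha> * x) - norm \<zeta>"
        using norm_triangle_ineq2[of "exp (of_real \<alpha> * ?w)" \<zeta>] n by simp
      have 2: "norm (1 + exp ?w) \<ge> exp x - 1"
        using norm_triangle_ineq2[of "exp ?w" "- 1"] n by (simp add: add.commute)
      have 3: "norm (of_real s - exp ?w) \<ge> exp x - s"
        using norm_triangle_ineq2[of "exp ?w" "of_real s"] n s by (simp add: norm_minus_commute)
      have "norm (ray_density ?w) \<le> 1 / (exp (\<alpha> * x) - norm \<zeta>) + 1 / (norm \<zeta> * (exp x - 1))"
        unfolding ray_density_def using 1 2 elim L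
        by (intro norm_triangle_mono) (auto simp: norm_divide norm_mult intro!: frac_le mult_left_mono)
      then show "norm (line_integrand s ?w) \<le> b x"
        unfolding line_integrand_def b_def norm_divide norm_mult n using 3 elim L
        by (intro frac_le mult_left_mono mult_nonneg_nonneg) (auto intro!: add_nonneg_nonneg)
    qed
  qed
qed

text \<open>Left vertical side: the Jacobian e^{-x} supplies the decay, the other factors staying
  bounded.\<close>

lemma line_integrand_decay_left:
  assumes s: "s > 0"
  defines "b \<equiv> \<lambda>x. exp (- x) * (1 / (norm \<zeta> - exp (- (\<alpha> * x))) + 1 / (norm \<zeta> * (1 - exp (- x)))) / (s - exp (- x))"
  shows "(b \<longlongrightarrow> 0) at_top" "\<forall>\<^sub>F x in at_top. \<forall>y. norm (line_integrand s (Complex (- x) y)) \<le> b x"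
proof -
  have L: "norm \<zeta> > 0" using \<zeta> by simp
  show "(b \<longlongrightarrow> 0) at_top" unfolding b_def using \<alpha> L s by real_asymp
  have "\<forall>\<^sub>F x in at_top. norm \<zeta> - exp (- (\<alpha> * x)) > 0" using \<alpha> L by real_asymp
  moreover have "\<forall>\<^sub>F x::real in at_top. 1 - exp (- x) > 0" by real_asymp
  moreover have "\<forall>\<^sub>F x in at_top. s - exp (- x) > 0" using s by real_asymp
  ultimately show "\<forall>\<^sub>F x in at_top. \<forall>y. norm (line_integrand s (Complex (- x) y)) \<le> b x"
  proof eventually_elim
    case (elim x)
    show ?case
    proof
      fix y
      let ?w = "Complex (- x) y"
      have n: "norm (exp ?w) = exp (- x)" "norm (exp (of_real \<alpha> * ?w)) = exp (- (\<alpha> * x))" by simp_all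
      have 1: "norm (exp (of_real \<alpha> * ?w) - \<zeta>) \<ge> norm \<zeta> - exp (- (\<alpha> * x))"
        using norm_triangle_ineq2[of \<zeta> "exp (of_real \<alpha> * ?w)"] n by (simp add: norm_minus_commute)
      have 2: "norm (1 + exp ?w) \<ge> 1 - exp (- x)"
        using norm_triangle_ineq2[of 1 "- exp ?w"] n by simp
      have 3: "norm (of_real s - exp ?w) \<ge> s - exp (- x)"
        using norm_triangle_ineq2[of "of_real s" "exp ?w"] n s by simp
      have "norm (ray_density ?w) \<le> 1 / (norm \<zeta> - exp (- (\<alpha> * x))) + 1 / (norm \<zeta> * (1 - exp (- x)))"
        unfolding ray_density_def using 1 2 elim L
        by (intro norm_triangle_mono) (auto simp: norm_divide norm_mult intro!: frac_le mult_left_mono)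
      then show "norm (line_integrand s ?w) \<le> b x"
        unfolding line_integrand_def b_def norm_divide norm_mult n using 3 elim L
        by (intro frac_le mult_left_mono mult_nonneg_nonneg) (auto intro!: add_nonneg_nonneg)
    qed
  qed
qed

text \<open>Cauchy's formula over the two lines: the residue at ln s returns the density at s, the
  one at \<open>branch_pole\<close> the rational term. Solving for 1 / (s^\<alpha> - \<zeta>) leaves
  the auxiliary summand of the density to be subtracted.\<close>

lemma kernel_exists:
  "\<exists>q. set_integrable lborel {0..} q \<and> (\<forall>s. s > 0 \<longrightarrow> of_real (s powr \<alpha>) \<noteq> \<zeta> \<longrightarrow>
      1 / (of_real (s powr \<alpha>) - \<zeta>) = laplace q (of_real s)
        + (if \<bar>Im branch_pole\<bar> < \<theta> then exp branch_pole / (of_real \<alpha> * \<zeta>) / (of_real s - exp branch_pole) else 0))"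
proof -
  define Q where "Q = (\<lambda>y t. LBINT x. exp (of_real (t * exp x) * cis y) * (of_real (exp x) * cis y * ray_density (Complex x y)))"
  have line: "set_integrable lborel {0..} (Q y)"
    "s > 0 \<Longrightarrow> integrable lborel (\<lambda>x. line_integrand s (Complex x y))"
    "s > 0 \<Longrightarrow> laplace (Q y) (of_real s) = (LBINT x. line_integrand s (Complex x y))"
    if y: "\<bar>y\<bar> = \<theta>" for y s
  proof -
    obtain C where C: "\<And>x. norm (ray_density (Complex x y)) \<le> C * exp (- (\<alpha> * \<bar>x\<bar>))"
      using ray_density_bound[OF y] by blast
    \<comment> \<open>The rays lie in the left half-plane because pi/2 < \<theta> < pi.\<close>
    have cy: "cos y < 0"
    proof -
      have "cos (pi - \<theta>) > 0" using \<theta> by (intro cos_gt_zero) auto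
      then have "cos \<bar>y\<bar> < 0" unfolding y by (simp add: cos_pi_minus)
      then show ?thesis by (simp add: abs_if split: if_splits)
    qed
    have mm: "(\<lambda>x. ray_density (Complex x y)) \<in> borel_measurable borel"
      unfolding ray_density_def exp_Complex exp_alpha_Complex by measurable
    have u: "norm (cis y) = 1" "Re (cis y) < 0" using cy by auto
    note ray = laplace_ray_integral[OF u mm C \<alpha>(1), folded Q_def]
    have hh: "line_integrand s (Complex x y) = of_real (exp x) * cis y * ray_density (Complex x y) / (of_real s - of_real (exp x) * cis y)" for x
      by (simp add: line_integrand_def exp_Complex)
    show "set_integrable lborel {0..} (Q y)"
      "s > 0 \<Longrightarrow> integrable lborel (\<lambda>x. line_integrand s (Complex x y))"
      "s > 0 \<Longrightarrow> laplace (Q y) (of_real s) = (LBINT x. line_integrand s (Complex x y))"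
      unfolding hh using ray by (auto simp: Q_def)
  qed
  have \<theta>0: "\<theta> > 0" using \<theta> pi_gt_zero by linarith
  have yy: "\<bar>\<theta>\<bar> = \<theta>" "\<bar>- \<theta>\<bar> = \<theta>" using \<theta>0 by auto
  \<comment> \<open>The contour runs in along one ray and out along the other, hence the opposite
    signs; the last term removes the auxiliary summand.\<close>
  define q where "q = (\<lambda>t. 1 / (2 * pi * \<i>) * Q \<theta> t + (- 1 / (2 * pi * \<i>)) * Q (- \<theta>) t + (- 1 / \<zeta>) * exp (- 1 * of_real t))"
  have e1: "set_integrable lborel {0..} (\<lambda>t. exp (- 1 * complex_of_real t))"
  proof -
    have "laplace_exists (\<lambda>_. 1) 1"
      by (rule laplace_bounded[where M = 1]) auto
    then show ?thesis by (simp add: laplace_exists_def)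
  qed
  have "set_integrable lborel {0..} q"
    unfolding q_def
    by (intro set_integral_add(1) set_integrable_mult_right line(1)[OF yy(1)] line(1)[OF yy(2)] e1)
  moreover have "1 / (of_real (s powr \<alpha>) - \<zeta>) = laplace q (of_real s)
        + (if \<bar>Im branch_pole\<bar> < \<theta> then exp branch_pole / (of_real \<alpha> * \<zeta>) / (of_real s - exp branch_pole) else 0)"
    if s: "s > 0" and ne: "of_real (s powr \<alpha>) \<noteq> \<zeta>" for s
  proof -
    let ?z = "complex_of_real (ln s)"
    have ez: "exp (of_real \<alpha> * ?z) = of_real (s powr \<alpha>)"
      using s by (simp add: powr_def exp_of_real flip: of_real_mult)
    have ne': "exp (of_real \<alpha> * ?z) \<noteq> \<zeta>" using ne ez by simp
    have zpt: "?z \<noteq> branch_pole" using ne' exp_branch_pole by auto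
    define c where "c = (if \<bar>Im branch_pole\<bar> < \<theta> then exp branch_pole / (of_real \<alpha> * \<zeta>) / (of_real s - exp branch_pole) else 0)"
    have mz: "ray_density ?z = 1 / (of_real (s powr \<alpha>) - \<zeta>) + 1 / (\<zeta> * (1 + of_real s))"
      using s by (simp add: ray_density_def ez exp_of_real)
    have dec1: "\<forall>\<^sub>F x in at_top. \<forall>y. \<bar>y\<bar> \<le> \<theta> \<longrightarrow> norm (line_integrand s (Complex x y)) \<le> exp x * (1 / (exp (\<alpha> * x) - norm \<zeta>) + 1 / (norm \<zeta> * (exp x - 1))) / (exp x - s)"
      using line_integrand_decay_right(2)[OF s] by (rule eventually_mono) auto
    have dec2: "\<forall>\<^sub>F x in at_top. \<forall>y. \<bar>y\<bar> \<le> \<theta> \<longrightarrow> norm (line_integrand s (Complex (- x) y)) \<le> exp (- x) * (1 / (norm \<zeta> - exp (- (\<alpha> * x))) + 1 / (norm \<zeta> * (1 - exp (- x)))) / (s - exp (- x))"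
      using line_integrand_decay_left(2)[OF s] by (rule eventually_mono) auto
    have "(LBINT x. line_integrand s (Complex x (- \<theta>))) - (LBINT x. line_integrand s (Complex x \<theta>)) = 2 * pi * \<i> * (\<Sum>p\<in>strip_poles s. residue (line_integrand s) p)"
      by (rule line_integral_difference[OF \<theta>0 \<theta>(2) _ _ holomorphic_on_line_integrand[OF s] line(2)[OF yy(1) s] line(2)[OF yy(2) s]
            line_integrand_decay_right(1)[OF s] line_integrand_decay_left(1)[OF s] dec1 dec2])
         (use \<theta>0 in \<open>auto simp: strip_poles_def split: if_splits\<close>)
    also have "(\<Sum>p\<in>strip_poles s. residue (line_integrand s) p) = - ray_density ?z + c"
      using zpt by (auto simp: strip_poles_def c_def residue_line_integrand_real[OF s ne'] residue_line_integrand_branch_pole[OF s ne'])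
    finally have D: "laplace (Q (- \<theta>)) (of_real s) - laplace (Q \<theta>) (of_real s) = 2 * pi * \<i> * (- ray_density ?z + c)"
      by (simp add: line(3)[OF yy(1) s] line(3)[OF yy(2) s])
    have ex: "laplace_exists (Q \<theta>) (of_real s)" "laplace_exists (Q (- \<theta>)) (of_real s)"
      using line(1) yy s by (auto intro: laplace_L1)
    have Re1: "Re (complex_of_real s - - 1) > 0" using s by simp
    note M = laplace_cmult[OF ex(1), of "1 / (2 * pi * \<i>)"] laplace_cmult[OF ex(2), of "- 1 / (2 * pi * \<i>)"]
      laplace_cmult[OF laplace_exp(1)[OF Re1], of "- 1 / \<zeta>"]
    note A = laplace_add[OF M(1) M(3)]
    note A2 = laplace_add[OF A(1) M(5)]
    have "laplace q (of_real s) = 1 / (2 * pi * \<i>) * laplace (Q \<theta>) (of_real s) + (- 1 / (2 * pi * \<i>)) * laplace (Q (- \<theta>)) (of_real s)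
        + (- 1 / \<zeta>) * (1 / (of_real s - - 1))"
      unfolding q_def A2(2) A(2) M(2,4,6) laplace_exp(2)[OF Re1] ..
    also have "1 / (2 * pi * \<i>) * laplace (Q \<theta>) (of_real s) + (- 1 / (2 * pi * \<i>)) * laplace (Q (- \<theta>)) (of_real s)
        = - 1 / (2 * pi * \<i>) * (laplace (Q (- \<theta>)) (of_real s) - laplace (Q \<theta>) (of_real s))"
      by (simp add: right_diff_distrib diff_divide_distrib)
    also have "\<dots> = ray_density ?z - c" unfolding D by simp
    finally have "laplace q (of_real s) = ray_density ?z - c - 1 / (\<zeta> * (1 + of_real s))"
      by (simp add: add.commute)
    then show ?thesis unfolding mz c_def[symmetric] by simp
  qed
  ultimately show ?thesis by blast
qed

end

text \<open>A principal root of s^\<alpha> = \<zeta> has argument Arg \<zeta> / \<alpha>. Below the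
  critical angle it lies in the open right half-plane and contributes the rational term; above it,
  the rays can be placed so that no root is enclosed.\<close>

theorem resolvent_kernel:
  fixes \<alpha> :: real and \<zeta> :: complex
  assumes \<alpha>: "0 < \<alpha>" "\<alpha> < 1" and \<zeta>: "\<zeta> \<noteq> 0" and arg: "\<bar>Arg \<zeta>\<bar> \<noteq> \<alpha> * pi / 2"
  shows "\<exists>q c \<mu>. set_integrable lborel {0..} q \<and> Re \<mu> > 0 \<and>
    (\<forall>s. s > 0 \<longrightarrow> of_real (s powr \<alpha>) \<noteq> \<zeta> \<longrightarrow>
      1 / (of_real (s powr \<alpha>) - \<zeta>) = laplace q (of_real s) + c / (of_real s - \<mu>))"
proof -
  define p where "p = Ln \<zeta> / of_real \<alpha>"
  have Imp: "\<bar>Im p\<bar> = \<bar>Arg \<zeta>\<bar> / \<alpha>" using \<alpha> \<zeta> by (simp add: p_def Arg_eq_Im_Ln)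
  show ?thesis
  proof (cases "\<bar>Arg \<zeta>\<bar> < \<alpha> * pi / 2")
    case True
    then have p2: "\<bar>Im p\<bar> < pi / 2" using \<alpha> by (simp add: Imp field_simps)
    \<comment> \<open>Any angle strictly between pi/2 and pi encloses the pole, since |Im p| <
      pi/2.\<close>
    have \<theta>: "pi / 2 < 3 * pi / 4" "3 * pi / 4 < pi" "pi \<le> pi" using pi_gt_zero by linarith+
    have pole: "\<bar>Im p\<bar> < 3 * pi / 4 \<or> \<bar>Im p\<bar> \<ge> pi" using p2 \<theta> by linarith
    have pole': "branch_pole \<alpha> \<zeta> = p" by (simp add: branch_pole_def[OF \<alpha> \<zeta> \<theta> pole[unfolded p_def]] p_def)
    obtain q where q: "set_integrable lborel {0..} q"
      "\<forall>s. s > 0 \<longrightarrow> of_real (s powr \<alpha>) \<noteq> \<zeta> \<longrightarrow>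
        1 / (of_real (s powr \<alpha>) - \<zeta>) = laplace q (of_real s)
        + (if \<bar>Im p\<bar> < 3 * pi / 4 then exp p / (of_real \<alpha> * \<zeta>) / (of_real s - exp p) else 0)"
      using kernel_exists[OF \<alpha> \<zeta> \<theta> pole[unfolded p_def], unfolded pole'] by blast
    have "Re (exp p) > 0"
      unfolding Re_exp using p2 by (intro mult_pos_pos cos_gt_zero_pi) (auto simp: abs_less_iff)
    moreover have "\<bar>Im p\<bar> < 3 * pi / 4" using p2 \<theta> by linarith
    ultimately show ?thesis
      using q by (intro exI[of _ q] exI[of _ "exp p / (of_real \<alpha> * \<zeta>)"] exI[of _ "exp p"]) simp
  next
    case False
    then have p2: "\<bar>Im p\<bar> > pi / 2" using \<alpha> arg by (simp add: Imp field_simps)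
    \<comment> \<open>The pole is now beyond pi/2, which leaves room for rays in the left half-plane
      that exclude it. The strip ends at the pole or at pi, and \<theta> is the midpoint between
      pi/2 and that end.\<close>
    define \<theta>' where "\<theta>' = min pi \<bar>Im p\<bar>"
    define \<theta> where "\<theta> = (pi / 2 + \<theta>') / 2"
    have \<theta>': "\<theta>' > pi / 2" using p2 pi_gt_zero by (simp add: \<theta>'_def)
    have "\<theta>' \<le> \<bar>Im p\<bar>" "\<theta>' \<le> pi" by (simp_all add: \<theta>'_def)
    moreover have "pi / 2 < \<theta>" using \<theta>' by (simp add: \<theta>_def)
    moreover have "\<theta> < \<theta>'" using \<theta>' by (simp add: \<theta>_def)
    ultimately have \<theta>: "pi / 2 < \<theta>" "\<theta> < \<theta>'" "\<theta>' \<le> pi" and "\<theta>' \<le> \<bar>Im p\<bar>" by auto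
    have pole: "\<bar>Im p\<bar> < \<theta> \<or> \<bar>Im p\<bar> \<ge> \<theta>'" using \<open>\<theta>' \<le> \<bar>Im p\<bar>\<close> by simp
    have pole': "branch_pole \<alpha> \<zeta> = p" by (simp add: branch_pole_def[OF \<alpha> \<zeta> \<theta> pole[unfolded p_def]] p_def)
    obtain q where q: "set_integrable lborel {0..} q"
      "\<forall>s. s > 0 \<longrightarrow> of_real (s powr \<alpha>) \<noteq> \<zeta> \<longrightarrow>
        1 / (of_real (s powr \<alpha>) - \<zeta>) = laplace q (of_real s)
        + (if \<bar>Im p\<bar> < \<theta> then exp p / (of_real \<alpha> * \<zeta>) / (of_real s - exp p) else 0)"
      using kernel_exists[OF \<alpha> \<zeta> \<theta> pole[unfolded p_def], unfolded pole'] by blast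
    have "\<not> \<bar>Im p\<bar> < \<theta>" using \<theta>(2) \<open>\<theta>' \<le> \<bar>Im p\<bar>\<close> by linarith
    \<comment> \<open>No pole is enclosed: c = 0, and 1 is a dummy value for \<mu>.\<close>
    then show ?thesis using q by (intro exI[of _ q] exI[of _ 0] exI[of _ 1]) simp
  qed
qed

section \<open>Sufficiency\<close>

lemma laplace_const:
  assumes "Re s > 0"
  shows "laplace_exists (\<lambda>_. k) s" "laplace (\<lambda>_. k) s = k / s"
proof -
  have "Re (s - 0) > 0" using assms by simp
  note E = laplace_exp[OF this]
  show "laplace_exists (\<lambda>_. k) s" "laplace (\<lambda>_. k) s = k / s"
    using laplace_cmult[OF E(1), of k] E(2) by simp_all
qed

text \<open>The transform identity is that of \<psi>' = \<mu> \<psi> + \<phi>, whose solutions grow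
  like e^{\<mu> t} except for one. That one starts at minus the transform of \<phi> at \<mu>, so
  \<psi> 0 is an output and cannot be prescribed.\<close>

lemma unstable_bounded_solution:
  fixes \<phi> :: "real \<Rightarrow> complex"
  assumes \<mu>: "Re \<mu> > 0" and \<phi>: "continuous_on {0..} \<phi>" and M: "\<And>t. t \<ge> 0 \<Longrightarrow> norm (\<phi> t) \<le> M"
  obtains \<psi> N where "continuous_on {0..} \<psi>" "\<And>t. t \<ge> 0 \<Longrightarrow> norm (\<psi> t) \<le> N"
    "\<And>s. Re s > Re \<mu> \<Longrightarrow> laplace \<psi> s = (laplace \<phi> s + \<psi> 0) / (s - \<mu>)"
proof -
  \<comment> \<open>\<psi>(t) is minus the integral of e^{\<mu>(t-u)} \<phi>(u) over u \<ge> t: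
    integration from infinity instead of from 0.\<close>
  define \<psi> where "\<psi> = (\<lambda>t. - laplace (\<lambda>u. \<phi> (t + u)) \<mu>)"
  have bnd: "norm (\<psi> t) \<le> M / Re \<mu>" if "t \<ge> 0" for t
    unfolding \<psi>_def norm_minus_cancel
    by (rule laplace_bounded(2)) (use that \<mu> in \<open>auto intro!: continuous_intros continuous_on_compose2[OF \<phi>] M\<close>)
  define e where "e = (\<lambda>t. exp (\<mu> * complex_of_real t))"
  have ec: "continuous_on {0..} e" unfolding e_def by (intro continuous_intros)
  have eq: "\<psi> t = \<psi> 0 * e t + conv \<phi> e t" if t: "t \<ge> 0" for t
  proof -
    have "conv \<phi> e t = (LBINT u:{0..t}. e t * (exp (- (\<mu> * of_real u)) * \<phi> u))"
      unfolding conv_def e_def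
      by (rule arg_cong2[where f = "set_lebesgue_integral lborel"])
         (auto simp: fun_eq_iff exp_add[symmetric] exp_diff exp_minus field_simps)
    also have "\<dots> = e t * (LBINT u:{0..t}. exp (- (\<mu> * of_real u)) * \<phi> u)" by simp
    finally have C: "conv \<phi> e t = e t * (LBINT u:{0..t}. exp (- (\<mu> * of_real u)) * \<phi> u)" .
    have "\<psi> 0 + (LBINT u:{0..t}. exp (- (\<mu> * of_real u)) * \<phi> u) = exp (- (\<mu> * of_real t)) * \<psi> t"
      using laplace_split[OF \<phi> M \<mu> t] by (simp add: \<psi>_def)
    then have "e t * (\<psi> 0 + (LBINT u:{0..t}. exp (- (\<mu> * of_real u)) * \<phi> u)) = \<psi> t"
      by (simp add: e_def exp_minus)
    then show ?thesis unfolding C by (simp only: ring_distribs mult.commute)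
  qed
  have \<phi>i: "set_integrable lborel {0..T} \<phi>" for T
    by (rule laplace_exists_imp_integrable[of _ 1], rule laplace_bounded(1)[OF \<phi> M]) auto
  have \<psi>c: "continuous_on {0..} \<psi>"
    by (subst continuous_on_cong[OF refl eq]) (auto intro!: continuous_intros ec continuous_on_conv \<phi>i \<phi>)
  have "laplace \<psi> s = (laplace \<phi> s + \<psi> 0) / (s - \<mu>)" if s: "Re s > Re \<mu>" for s
  proof -
    have "Re (s - \<mu>) > 0" using s by simp
    note E = laplace_exp[OF this, folded e_def]
    have ex: "laplace_exists \<phi> s"
      by (rule laplace_bounded(1)[OF \<phi> M]) (use s \<mu> in auto)
    note C = laplace_conv[OF ex E(1)] laplace_cmult[OF E(1), of "\<psi> 0"]
    have "laplace \<psi> s = laplace (\<lambda>t. \<psi> 0 * e t + conv \<phi> e t) s"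
      by (rule laplace_cong(2)[OF eq])
    then show ?thesis
      unfolding laplace_add(2)[OF C(3,1)] C(2,4) E(2) by (simp add: add_divide_distrib)
  qed
  with \<psi>c bnd show ?thesis using that by blast
qed

text \<open>With F the transform of \<phi>, the solution has transform y0 / s + (F + \<zeta> y0 / s)
  / (s^\<alpha> - \<zeta>). The integrable part of the kernel preserves boundedness, and only its
  part c / (s - \<mu>) can produce growth. The freedom in y0 is spent on that part.\<close>

lemma scalar_bounded_solution:
  fixes \<alpha> :: real and \<zeta> :: complex and \<phi> :: "real \<Rightarrow> complex"
  assumes \<alpha>: "0 < \<alpha>" "\<alpha> < 1" and \<zeta>: "\<zeta> \<noteq> 0" and arg: "\<bar>Arg \<zeta>\<bar> \<noteq> \<alpha> * pi / 2"
    and \<phi>: "continuous_on {0..} \<phi>" and M: "\<And>t. t \<ge> 0 \<Longrightarrow> norm (\<phi> t) \<le> M"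
  shows "\<exists>y y0 N s0. continuous_on {0..} y \<and> (\<forall>t\<ge>0. norm (y t) \<le> N) \<and>
    (\<forall>s\<ge>s0. (of_real (s powr \<alpha>) - \<zeta>) * laplace y (of_real s) = of_real (s powr (\<alpha> - 1)) * y0 + laplace \<phi> (of_real s))"
proof -
  obtain q c \<mu> where q: "set_integrable lborel {0..} q" and \<mu>: "Re \<mu> > 0"
    and R: "\<forall>s. s > 0 \<longrightarrow> of_real (s powr \<alpha>) \<noteq> \<zeta> \<longrightarrow>
      1 / (of_real (s powr \<alpha>) - \<zeta>) = laplace q (of_real s) + c / (of_real s - \<mu>)"
    using resolvent_kernel[OF \<alpha> \<zeta> arg] by blast
  obtain \<psi> N where \<psi>: "continuous_on {0..} \<psi>" "\<And>t. t \<ge> 0 \<Longrightarrow> norm (\<psi> t) \<le> N"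
    "\<And>s. Re s > Re \<mu> \<Longrightarrow> laplace \<psi> s = (laplace \<phi> s + \<psi> 0) / (s - \<mu>)"
    using unstable_bounded_solution[OF \<mu> \<phi> M] by blast
  obtain s1 where s1: "s1 > 0" "\<And>s. s \<ge> s1 \<Longrightarrow> s powr \<alpha> > norm \<zeta>"
    using ex_powr_gt[OF \<alpha>(1)] by blast
  \<comment> \<open>By partial fractions, \<zeta> y0 / (s (s - \<mu>)) is \<zeta> y0 / \<mu> times
    the difference of 1 / (s - \<mu>) and 1 / s. The choice \<zeta> y0 / \<mu> = \<psi> 0 makes the
    first piece the initial value that the bounded \<psi> demands; the second piece, times c, and y0
    itself form the constant k.\<close>
  define y0 where "y0 = \<psi> 0 * \<mu> / \<zeta>"
  define k where "k = y0 * (1 - c * \<zeta> / \<mu>)"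
  define g where "g = (\<lambda>t. \<phi> t + \<zeta> * y0)"
  define y where "y = (\<lambda>t. conv q g t + c * \<psi> t + k)"
  have \<mu>0: "\<mu> \<noteq> 0" using \<mu> by auto
  have \<psi>0: "\<psi> 0 = y0 * \<zeta> / \<mu>" using \<zeta> \<mu>0 by (simp add: y0_def)
  have g: "continuous_on {0..} g" unfolding g_def by (intro continuous_intros \<phi>)
  have gM: "norm (g t) \<le> M + norm (\<zeta> * y0)" if "t \<ge> 0" for t
    unfolding g_def by (rule norm_triangle_mono[OF M[OF that] order_refl])
  have qi: "set_integrable lborel {0..T} q" for T
    by (rule set_integrable_subset[OF q]) auto
  have yc: "continuous_on {0..} y"
    unfolding y_def by (intro continuous_intros continuous_on_conv qi g \<psi>(1))
  have "norm (y t) \<le> (M + norm (\<zeta> * y0)) * (LBINT u:{0..}. norm (q u)) + norm c * N + norm k" if t: "t \<ge> 0" for t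
    unfolding y_def
    by (intro norm_triangle_mono conv_L1_bounded[OF q g gM t] order_refl)
       (use \<psi>(2)[OF t] in \<open>auto simp: norm_mult mult_left_mono\<close>)
  then have yN: "\<exists>N. \<forall>t\<ge>0. norm (y t) \<le> N" by blast
  have "(of_real (s powr \<alpha>) - \<zeta>) * laplace y (of_real s) = of_real (s powr (\<alpha> - 1)) * y0 + laplace \<phi> (of_real s)"
    if s: "s \<ge> max s1 (Re \<mu> + 1)" for s
  proof -
    have s0: "s > 0" "s > Re \<mu>" "s powr \<alpha> > norm \<zeta>" using s s1 by auto
    have Sn: "of_real (s powr \<alpha>) \<noteq> \<zeta>" using s0(3) by auto
    define w where "w = complex_of_real s"
    define S where "S = complex_of_real (s powr \<alpha>)"
    have w: "Re w > 0" "Re w > Re \<mu>" "w \<noteq> 0" "w - \<mu> \<noteq> 0" using s0 by (auto simp: w_def)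
    have Sw: "of_real (s powr (\<alpha> - 1)) = S / w"
      using s0 by (simp add: S_def w_def powr_diff)
    have S\<zeta>: "S - \<zeta> \<noteq> 0" using Sn by (simp add: S_def)
    have ex\<phi>: "laplace_exists \<phi> w" by (rule laplace_bounded(1)[OF \<phi> M w(1)])
    have exg: "laplace_exists g w" "laplace g w = laplace \<phi> w + \<zeta> * y0 / w"
      unfolding g_def using laplace_add[OF ex\<phi> laplace_const(1)[OF w(1), of "\<zeta> * y0"]] laplace_const(2)[OF w(1), of "\<zeta> * y0"] by simp_all
    have exq: "laplace_exists q w" by (rule laplace_L1[OF q]) (use w in simp)
    have ex\<psi>: "laplace_exists \<psi> w" by (rule laplace_bounded(1)[OF \<psi>(1,2) w(1)])
    note C = laplace_conv[OF exq exg(1)] laplace_cmult[OF ex\<psi>, of c] laplace_const[OF w(1), of k]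
    note A = laplace_add[OF C(1,3)]
    have Ly: "laplace y w = laplace q w * (laplace \<phi> w + \<zeta> * y0 / w) + c * ((laplace \<phi> w + \<psi> 0) / (w - \<mu>)) + k / w"
      unfolding y_def laplace_add(2)[OF A(1) C(5)] A(2) C(2,4,6) exg(2) \<psi>(3)[OF w(2)] ..
    have Lq: "laplace q w = 1 / (S - \<zeta>) - c / (w - \<mu>)"
      using R s0(1) Sn by (simp add: w_def S_def)
    have "laplace y w = laplace \<phi> w / (S - \<zeta>) + y0 / w * (\<zeta> / (S - \<zeta>) + 1)
       + c * \<zeta> * y0 * (1 / (\<mu> * (w - \<mu>)) - 1 / (w * (w - \<mu>)) - 1 / (\<mu> * w))"
      unfolding Ly Lq \<psi>0 k_def
      by (simp add: ring_distribs add_divide_distrib diff_divide_distrib mult_ac)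
    also have "1 / (\<mu> * (w - \<mu>)) - 1 / (w * (w - \<mu>)) - 1 / (\<mu> * w) = 0"
      using w \<mu>0 by (simp add: divide_simps)
    also have "\<zeta> / (S - \<zeta>) + 1 = S / (S - \<zeta>)" using S\<zeta> by (simp add: divide_simps)
    finally have "(S - \<zeta>) * laplace y w = (S - \<zeta>) * (laplace \<phi> w / (S - \<zeta>) + y0 / w * (S / (S - \<zeta>)))" by simp
    also have "\<dots> = S / w * y0 + laplace \<phi> w"
    proof -
      have "r * (a / r + b / w * (S / r)) = S / w * b + a" if "r \<noteq> 0" for r a b :: complex
        using that by (simp add: distrib_left mult.commute)
      then show ?thesis using S\<zeta> by blast
    qed
    finally show ?thesis by (simp only: Sw) (simp add: S_def w_def)
  qed
  with yc yN show ?thesis by blast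
qed

section \<open>Reduction of the system to scalar equations\<close>

text \<open>\<open>solves_laplace\<close> is the Laplace image of the Caputo system $D^\alpha x = Ax + f$,
  $x(0) = x_0$, required for all large real arguments.\<close>
definition solves_laplace ::
  "real \<Rightarrow> real^'n^'n \<Rightarrow> ('n \<Rightarrow> real \<Rightarrow> complex) \<Rightarrow> ('n \<Rightarrow> complex) \<Rightarrow> ('n \<Rightarrow> real \<Rightarrow> complex) \<Rightarrow> bool" where
  "solves_laplace \<alpha> A f x0 x \<longleftrightarrow>
    (\<forall>i. continuous_on {0..} (x i) \<and> (\<exists>N. \<forall>t\<ge>0. norm (x i t) \<le> N)) \<and>
    (\<exists>s0. \<forall>s\<ge>s0. \<forall>i. of_real (s powr \<alpha>) * laplace (x i) (of_real s)
        - (\<Sum>j\<in>UNIV. of_real (A $ i $ j) * laplace (x j) (of_real s))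
      = of_real (s powr (\<alpha> - 1)) * x0 i + laplace (f i) (of_real s))"

definition cmat :: "real^'n^'n \<Rightarrow> complex^'n^'n" where
  "cmat A = map_matrix complex_of_real A"

text \<open>The head of the list acts first, matching the order in which eigenvalues are split off
  the forcing vector.\<close>

fun annihilate :: "real^'n^'n \<Rightarrow> complex list \<Rightarrow> complex^'n \<Rightarrow> complex^'n" where
  "annihilate A [] v = v"
| "annihilate A (l # ls) v = annihilate A ls (cmat A *v v - l *s v)"

lemma cmat_mult_nth: "(cmat A *v v) $ i = (\<Sum>j\<in>UNIV. of_real (A $ i $ j) * v $ j)"
  by (simp add: cmat_def matrix_vector_mult_def)

text \<open>If $y$ solves the scalar equation with coefficient $\lambda$ and forcing $\varphi$, then
  $x = y v + z$ solves the system with forcing $\varphi v$ exactly when $z$ solves it with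
  forcing $y (A - \lambda) v$.\<close>
lemma annihilated_bounded_solution:
  fixes A :: "real^'n^'n"
  assumes \<alpha>: "0 < \<alpha>" "\<alpha> < 1"
    and ls: "\<And>l. l \<in> set ls \<Longrightarrow> l \<noteq> 0 \<and> \<bar>Arg l\<bar> \<noteq> \<alpha> * pi / 2"
    and v: "annihilate A ls v = 0"
    and \<phi>: "continuous_on {0..} \<phi>" and M: "\<And>t. t \<ge> 0 \<Longrightarrow> norm (\<phi> t) \<le> M"
  shows "\<exists>x0 x. solves_laplace \<alpha> A (\<lambda>i t. v $ i * \<phi> t) x0 x"
  using ls v \<phi> M
proof (induction ls arbitrary: v \<phi> M)
  case Nil
  then have "v = 0" by simp
  then have "solves_laplace \<alpha> A (\<lambda>i t. v $ i * \<phi> t) (\<lambda>_. 0) (\<lambda>_ _. 0)"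
    by (auto simp: solves_laplace_def laplace_def)
  then show ?case by blast
next
  case (Cons l ls)
  define u where "u = cmat A *v v - l *s v"
  have l: "l \<noteq> 0" "\<bar>Arg l\<bar> \<noteq> \<alpha> * pi / 2" using Cons.prems(1)[of l] by auto
  obtain y y0 N s1 where y: "continuous_on {0..} y" "\<And>t. t \<ge> 0 \<Longrightarrow> norm (y t) \<le> N"
    "\<And>s. s \<ge> s1 \<Longrightarrow> (of_real (s powr \<alpha>) - l) * laplace y (of_real s) = of_real (s powr (\<alpha> - 1)) * y0 + laplace \<phi> (of_real s)"
    using scalar_bounded_solution[OF \<alpha> l Cons.prems(3,4)] by blast
  \<comment> \<open>The bounded scalar solution is the forcing of the next stage, hence the
    induction over arbitrary v, \<phi> and M.\<close>
  have "\<exists>x0 x. solves_laplace \<alpha> A (\<lambda>i t. u $ i * y t) x0 x"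
    by (rule Cons.IH[OF _ _ y(1,2)]) (use Cons.prems in \<open>auto simp: u_def\<close>)
  then obtain z0 z where z: "solves_laplace \<alpha> A (\<lambda>i t. u $ i * y t) z0 z" by blast
  obtain s2 where s2: "\<And>s i. s \<ge> s2 \<Longrightarrow> of_real (s powr \<alpha>) * laplace (z i) (of_real s)
        - (\<Sum>j\<in>UNIV. of_real (A $ i $ j) * laplace (z j) (of_real s))
      = of_real (s powr (\<alpha> - 1)) * z0 i + laplace (\<lambda>t. u $ i * y t) (of_real s)"
    using z unfolding solves_laplace_def by blast
  have zc: "continuous_on {0..} (z i)" "\<exists>N. \<forall>t\<ge>0. norm (z i t) \<le> N" for i
    using z unfolding solves_laplace_def by blast+
  define x where "x = (\<lambda>i t. v $ i * y t + z i t)"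
  define x0 where "x0 = (\<lambda>i. v $ i * y0 + z0 i)"
  have "solves_laplace \<alpha> A (\<lambda>i t. v $ i * \<phi> t) x0 x"
    unfolding solves_laplace_def
  proof (intro conjI allI)
    fix i
    show "continuous_on {0..} (x i)" unfolding x_def by (intro continuous_intros y zc)
    obtain N' where N': "\<And>t. t \<ge> 0 \<Longrightarrow> norm (z i t) \<le> N'" using zc(2) by blast
    have "norm (x i t) \<le> norm (v $ i) * N + N'" if "t \<ge> 0" for t
      unfolding x_def using y(2)[OF that] N'[OF that]
      by (intro norm_triangle_mono) (auto simp: norm_mult mult_left_mono)
    then show "\<exists>N. \<forall>t\<ge>0. norm (x i t) \<le> N" by blast
  next
    show "\<exists>s0. \<forall>s\<ge>s0. \<forall>i. of_real (s powr \<alpha>) * laplace (x i) (of_real s)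
        - (\<Sum>j\<in>UNIV. of_real (A $ i $ j) * laplace (x j) (of_real s))
      = of_real (s powr (\<alpha> - 1)) * x0 i + laplace (\<lambda>t. v $ i * \<phi> t) (of_real s)"
    proof (intro exI[of _ "max 1 (max s1 s2)"] allI impI)
      fix s i assume s: "s \<ge> max 1 (max s1 s2)"
      define w where "w = complex_of_real s"
      have w: "Re w > 0" using s by (simp add: w_def)
      define S where "S = complex_of_real (s powr \<alpha>)"
      define P where "P = complex_of_real (s powr (\<alpha> - 1))"
      have exy: "laplace_exists y w" by (rule laplace_bounded(1)[OF y(1,2) w])
      have ex\<phi>: "laplace_exists \<phi> w" by (rule laplace_bounded(1)[OF Cons.prems(3,4) w])
      have exz: "laplace_exists (z i) w" for i
        using zc laplace_bounded(1)[OF _ _ w] by metis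
      have Lx: "laplace (x i) w = v $ i * laplace y w + laplace (z i) w" for i
        unfolding x_def laplace_add(2)[OF laplace_cmult(1)[OF exy] exz] laplace_cmult(2)[OF exy] ..
      have E1: "(S - l) * laplace y w = P * y0 + laplace \<phi> w"
        using y(3)[of s] s by (simp add: S_def P_def w_def)
      have E2: "S * laplace (z i) w - (\<Sum>j\<in>UNIV. of_real (A $ i $ j) * laplace (z j) w)
          = P * z0 i + u $ i * laplace y w"
        using s2[of s i] s laplace_cmult(2)[OF exy] by (simp add: S_def P_def w_def)
      have u: "u $ i = (\<Sum>j\<in>UNIV. of_real (A $ i $ j) * v $ j) - l * v $ i"
        by (simp add: u_def cmat_mult_nth)
      have "S * laplace (x i) w - (\<Sum>j\<in>UNIV. of_real (A $ i $ j) * laplace (x j) w)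
        = S * v $ i * laplace y w - (\<Sum>j\<in>UNIV. of_real (A $ i $ j) * v $ j) * laplace y w
          + (S * laplace (z i) w - (\<Sum>j\<in>UNIV. of_real (A $ i $ j) * laplace (z j) w))"
        unfolding Lx by (simp add: ring_distribs sum.distrib sum_distrib_right mult.assoc)
      also have "\<dots> = v $ i * ((S - l) * laplace y w) + P * z0 i"
        unfolding E2 u by (simp add: algebra_simps)
      also have "\<dots> = P * x0 i + laplace (\<lambda>t. v $ i * \<phi> t) w"
        unfolding E1 x0_def laplace_cmult(2)[OF ex\<phi>] by (simp add: algebra_simps)
      finally show "of_real (s powr \<alpha>) * laplace (x i) (of_real s)
        - (\<Sum>j\<in>UNIV. of_real (A $ i $ j) * laplace (x j) (of_real s))
      = of_real (s powr (\<alpha> - 1)) * x0 i + laplace (\<lambda>t. v $ i * \<phi> t) (of_real s)"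
        by (simp add: S_def P_def w_def)
    qed
  qed
  then show ?case by blast
qed

section \<open>Annihilating polynomials of a vector\<close>

definition orbit :: "real^'n^'n \<Rightarrow> nat \<Rightarrow> complex^'n \<Rightarrow> complex^'n" where
  "orbit A k = ((\<lambda>v. cmat A *v v) ^^ k)"

lemma orbit_Suc: "orbit A (Suc k) v = orbit A k (cmat A *v v)"
  unfolding orbit_def funpow_Suc_right by simp

lemma orbit_diff: "orbit A k (v - l *s w) = orbit A k v - l *s orbit A k w"
  unfolding orbit_def
  by (induction k) (simp_all add: matrix_vector_mult_diff_distrib vector_scalar_commute)

text \<open>This is p(A) v, expressed by iterates of v so that a linear relation among them yields a
  polynomial at once.\<close>

definition poly_orbit :: "real^'n^'n \<Rightarrow> complex poly \<Rightarrow> complex^'n \<Rightarrow> complex^'n" where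
  "poly_orbit A p v = (\<Sum>k\<le>degree p. coeff p k *s orbit A k v)"

lemma poly_orbit_eq:
  assumes "degree p \<le> N"
  shows "poly_orbit A p v = (\<Sum>k\<le>N. coeff p k *s orbit A k v)"
  unfolding poly_orbit_def
  by (rule sum.mono_neutral_left) (use assms in \<open>auto simp: coeff_eq_0\<close>)

lemma poly_orbit_linear_factor:
  "poly_orbit A ([:- l, 1:] * q) v = poly_orbit A q (cmat A *v v - l *s v)"
proof -
  define N where "N = degree q"
  have "degree ([:- l, 1:] * q) \<le> Suc N"
    using degree_mult_le[of "[:- l, 1:]" q] by (simp add: N_def)
  then have "poly_orbit A ([:- l, 1:] * q) v = (\<Sum>k\<le>Suc N. coeff ([:- l, 1:] * q) k *s orbit A k v)"
    by (rule poly_orbit_eq)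
  also have "\<dots> = (\<Sum>k\<le>Suc N. coeff (pCons 0 q) k *s orbit A k v) - (\<Sum>k\<le>Suc N. (l * coeff q k) *s orbit A k v)"
    by (simp add: sum_subtractf[symmetric] vector_sub_rdistrib del: sum.atMost_Suc)
  also have "(\<Sum>k\<le>Suc N. coeff (pCons 0 q) k *s orbit A k v) = (\<Sum>k\<le>N. coeff q k *s orbit A k (cmat A *v v))"
    by (subst sum.atMost_Suc_shift) (simp add: orbit_Suc)
  also have "(\<Sum>k\<le>Suc N. (l * coeff q k) *s orbit A k v) = (\<Sum>k\<le>N. (l * coeff q k) *s orbit A k v)"
    by (simp add: N_def coeff_eq_0)
  also have "(\<Sum>k\<le>N. coeff q k *s orbit A k (cmat A *v v)) - \<dots>
      = (\<Sum>k\<le>N. coeff q k *s orbit A k (cmat A *v v - l *s v))"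
    by (simp add: sum_subtractf[symmetric] orbit_diff vec_eq_iff algebra_simps)
  finally show ?thesis by (simp add: poly_orbit_def N_def)
qed

text \<open>The list v, A v, ..., A^D v has one vector more than the real dimension D of the space,
  so it is linearly dependent, even with real coefficients.\<close>

lemma ex_annihilating_poly:
  fixes A :: "real^'n^'n" and v :: "complex^'n"
  shows "\<exists>p. p \<noteq> 0 \<and> poly_orbit A p v = 0"
proof -
  define D where "D = DIM(complex^'n)"
  define g where "g = (\<lambda>k. orbit A k v)"
  have "\<exists>c :: nat \<Rightarrow> complex. (\<exists>k\<le>D. c k \<noteq> 0) \<and> (\<Sum>k\<le>D. c k *s g k) = 0"
  \<comment> \<open>\<open>dependent\<close> is a property of sets: repeated iterates would shrink
    the set, but then the difference of two equal ones is the relation.\<close>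
  proof (cases "inj_on g {..D}")
    case False
    then obtain i j where ij: "i \<le> D" "j \<le> D" "i \<noteq> j" "g i = g j" by (auto simp: inj_on_def)
    define c :: "nat \<Rightarrow> complex" where "c = (\<lambda>k. (if k = i then 1 else 0) - (if k = j then 1 else 0))"
    have "(\<Sum>k\<le>D. c k *s g k) = (\<Sum>k\<le>D. (if k = i then g i else 0)) - (\<Sum>k\<le>D. (if k = j then g j else 0))"
      unfolding sum_subtractf[symmetric] by (rule sum.cong) (auto simp: c_def)
    also have "\<dots> = 0" using ij by simp
    finally show ?thesis using ij by (intro exI[of _ c]) (auto simp: c_def)
  next
    case True
    then have "card (g ` {..D}) = Suc D" by (simp add: card_image)
    then have "dependent (g ` {..D})" by (intro dependent_biggerset) (simp add: D_def)
    then obtain u where u: "(\<Sum>x\<in>g ` {..D}. u x *\<^sub>R x) = 0" "\<exists>x\<in>g ` {..D}. u x \<noteq> 0"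
      by (subst (asm) dependent_finite) auto
    have "of_real (u x) *s x = u x *\<^sub>R x" for x :: "complex^'n"
      by (simp only: vec_eq_iff vector_scaleR_component vector_smult_component) (simp add: scaleR_conv_of_real)
    then have "(\<Sum>k\<le>D. of_real (u (g k)) *s g k) = 0"
      using u(1) True by (simp add: sum.reindex)
    then show ?thesis using u(2) by (intro exI[of _ "\<lambda>k. of_real (u (g k))"]) auto
  qed
  then obtain c :: "nat \<Rightarrow> complex" and k where c: "k \<le> D" "c k \<noteq> 0" "(\<Sum>k\<le>D. c k *s g k) = 0" by blast
  define p where "p = (\<Sum>k\<le>D. monom (c k) k)"
  have cp: "coeff p i = (if i \<le> D then c i else 0)" for i
    by (simp add: p_def coeff_sum)
  have "degree p \<le> D" by (rule degree_le) (simp add: cp)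
  then have "poly_orbit A p v = (\<Sum>k\<le>D. c k *s g k)"
    by (subst poly_orbit_eq) (auto simp: cp g_def intro!: sum.cong)
  moreover have "p \<noteq> 0" using c cp[of k] by auto
  ultimately show ?thesis using c by auto
qed

text \<open>A - l commutes with every other factor, so it moves from the inside to the
  outside.\<close>

lemma annihilate_shift:
  "annihilate A ls (cmat A *v v - l *s v) = cmat A *v annihilate A ls v - l *s annihilate A ls v"
proof (induction ls arbitrary: v)
  case (Cons a ls)
  define u where "u = cmat A *v v - a *s v"
  have "cmat A *v (cmat A *v v - l *s v) - a *s (cmat A *v v - l *s v) = cmat A *v u - l *s u"
    unfolding u_def
    by (simp add: matrix_vector_mult_diff_distrib vector_scalar_commute vec_eq_iff algebra_simps)
  then show ?case using Cons.IH[of u] by (simp add: u_def)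
qed simp

lemma ex_eigenvalue_annihilator: "\<exists>ls. set ls \<subseteq> cspectrum A \<and> annihilate A ls v = 0"
proof -
  have "\<exists>ls. set ls \<subseteq> cspectrum A \<and> annihilate A ls v = 0"
    if "p \<noteq> 0" "poly_orbit A p v = 0" for p
    using that
  proof (induction "degree p" arbitrary: p v)
    case 0
    then have "coeff p 0 \<noteq> 0" by (metis leading_coeff_0_iff)
    then have "v = 0" using 0 by (simp add: poly_orbit_def orbit_def)
    then show ?case by (intro exI[of _ "[]"]) simp
  next
    case (Suc n)
    obtain l where "poly p l = 0" using alg_closed_imp_poly_has_root[of p] Suc.hyps(2) by auto
    then obtain q where q: "p = [:- l, 1:] * q" by (auto simp: poly_eq_0_iff_dvd elim: dvdE)
    have q0: "q \<noteq> 0" using Suc.prems q by auto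
    have "n = degree q" using Suc.hyps(2) q0 unfolding q by (subst (asm) degree_mult_eq) auto
    then obtain ls where ls: "set ls \<subseteq> cspectrum A" "annihilate A ls (cmat A *v v - l *s v) = 0"
      using Suc.hyps(1)[of q "cmat A *v v - l *s v"] Suc.prems(2) q0 unfolding q poly_orbit_linear_factor by blast
    show ?case
    proof (cases "l \<in> cspectrum A")
      case True
      then show ?thesis using ls by (intro exI[of _ "l # ls"]) simp
    next
      case False
      have "cmat A *v annihilate A ls v = l *s annihilate A ls v"
        using ls(2) by (simp add: annihilate_shift)
      then have "annihilate A ls v = 0"
        using False by (auto simp: cspectrum_def cmat_def)
      then show ?thesis using ls(1) by blast
    qed
  qed
  then show ?thesis using ex_annihilating_poly[of A v] by blast
qed

text \<open>Superposition over the coordinates: each f_k e_k is a scalar function times a fixed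
  vector, which is the form treated before.\<close>

lemma spectrum_imp_solves_laplace:
  fixes \<alpha> :: real and A :: "real^'n^'n" and f :: "real \<Rightarrow> real^'n"
  assumes \<alpha>: "0 < \<alpha>" "\<alpha> < 1" and spec: "cspectrum A \<subseteq> Lambda_u \<alpha> \<union> Lambda_s \<alpha>"
    and f: "continuous_on {0..} f" and fb: "bounded (f ` {0..})"
  obtains x0 x where "solves_laplace \<alpha> A (\<lambda>i t. of_real (f t $ i)) x0 x"
proof -
  define \<phi> where "\<phi> = (\<lambda>k t. complex_of_real (f t $ k))"
  obtain M where M: "\<And>t k. t \<ge> 0 \<Longrightarrow> norm (\<phi> k t) \<le> M"
    using bounded_components[OF fb] unfolding \<phi>_def by blast
  have \<phi>: "continuous_on {0..} (\<phi> k)" for k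
    unfolding \<phi>_def by (intro continuous_intros f)
  have "\<exists>x0 x. solves_laplace \<alpha> A (\<lambda>i t. axis k 1 $ i * \<phi> k t) x0 x" for k
  proof -
    obtain ls where ls: "set ls \<subseteq> cspectrum A" "annihilate A ls (axis k 1) = 0"
      using ex_eigenvalue_annihilator by blast
    have "l \<noteq> 0 \<and> \<bar>Arg l\<bar> \<noteq> \<alpha> * pi / 2" if "l \<in> set ls" for l
      using that ls(1) spec by (fastforce simp: Lambda_u_def Lambda_s_def)
    from annihilated_bounded_solution[OF \<alpha> this ls(2) \<phi> M] show ?thesis .
  qed
  then obtain z0 z where z: "\<And>k. solves_laplace \<alpha> A (\<lambda>i t. axis k 1 $ i * \<phi> k t) (z0 k) (z k)" by metis
  have zc: "continuous_on {0..} (z k i)" "\<exists>N. \<forall>t\<ge>0. norm (z k i t) \<le> N" for k i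
    using z[of k] unfolding solves_laplace_def by blast+
  obtain N where N: "\<And>k i t. t \<ge> 0 \<Longrightarrow> norm (z k i t) \<le> N k i" using zc(2) by metis
  define E where "E = (\<lambda>k s. \<forall>i. of_real (s powr \<alpha>) * laplace (z k i) (of_real s)
        - (\<Sum>j\<in>UNIV. of_real (A $ i $ j) * laplace (z k j) (of_real s))
      = of_real (s powr (\<alpha> - 1)) * z0 k i + laplace (\<lambda>t. axis k 1 $ i * \<phi> k t) (of_real s))"
  have "\<exists>s0. \<forall>s\<ge>s0. E k s" for k
    using z[of k] unfolding solves_laplace_def E_def by blast
  then obtain s1 where s1: "\<And>k s. s \<ge> s1 k \<Longrightarrow> E k s" by metis
  define x where "x = (\<lambda>i t. \<Sum>k\<in>UNIV. z k i t)"
  define x0 where "x0 = (\<lambda>i. \<Sum>k\<in>UNIV. z0 k i)"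
  have "solves_laplace \<alpha> A \<phi> x0 x"
    unfolding solves_laplace_def
  proof (intro conjI allI)
    fix i
    show "continuous_on {0..} (x i)" unfolding x_def by (intro continuous_intros zc)
    have "norm (x i t) \<le> (\<Sum>k\<in>UNIV. N k i)" if "t \<ge> 0" for t
      unfolding x_def by (rule order_trans[OF norm_sum]) (intro sum_mono N that)
    then show "\<exists>N. \<forall>t\<ge>0. norm (x i t) \<le> N" by blast
  next
    show "\<exists>s0. \<forall>s\<ge>s0. \<forall>i. of_real (s powr \<alpha>) * laplace (x i) (of_real s)
        - (\<Sum>j\<in>UNIV. of_real (A $ i $ j) * laplace (x j) (of_real s))
      = of_real (s powr (\<alpha> - 1)) * x0 i + laplace (\<phi> i) (of_real s)"
    proof (intro exI[of _ "Max (insert 1 (range s1))"] allI impI)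
      fix s i assume "s \<ge> Max (insert 1 (range s1))"
      then have s: "s \<ge> 1" "\<And>k. s \<ge> s1 k" by auto
      define w where "w = complex_of_real s"
      have w: "Re w > 0" using s by (simp add: w_def)
      have exz: "laplace_exists (z k i) w" for k i
        by (rule laplace_bounded(1)[OF zc(1) N w])
      have ex\<phi>: "laplace_exists (\<phi> k) w" for k
        by (rule laplace_bounded(1)[OF \<phi> M w])
      have Lx: "laplace (x i) w = (\<Sum>k\<in>UNIV. laplace (z k i) w)" for i
        unfolding x_def by (rule laplace_sum(2)[OF exz])
      have "of_real (s powr \<alpha>) * laplace (x i) w - (\<Sum>j\<in>UNIV. of_real (A $ i $ j) * laplace (x j) w)
        = (\<Sum>k\<in>UNIV. of_real (s powr \<alpha>) * laplace (z k i) w - (\<Sum>j\<in>UNIV. of_real (A $ i $ j) * laplace (z k j) w))"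
        unfolding Lx sum_subtractf sum_distrib_left
        by (subst sum.swap) (rule refl)
      also have "\<dots> = (\<Sum>k\<in>UNIV. of_real (s powr (\<alpha> - 1)) * z0 k i + axis k 1 $ i * laplace (\<phi> k) w)"
        using s1[OF s(2)] unfolding E_def by (simp add: w_def[symmetric] laplace_cmult(2)[OF ex\<phi>])
      also have "\<dots> = of_real (s powr (\<alpha> - 1)) * x0 i + laplace (\<phi> i) w"
        by (simp add: x0_def sum.distrib sum_distrib_left axis_def if_distrib[of "\<lambda>x. x * _"] cong: if_cong)
      finally show "of_real (s powr \<alpha>) * laplace (x i) (of_real s)
        - (\<Sum>j\<in>UNIV. of_real (A $ i $ j) * laplace (x j) (of_real s))
      = of_real (s powr (\<alpha> - 1)) * x0 i + laplace (\<phi> i) (of_real s)"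
        by (simp add: w_def)
    qed
  qed
  then show ?thesis using that by (simp add: \<phi>_def)
qed

section \<open>Identification with the variation of constants formula\<close>

lemma laplace_Re:
  assumes "laplace_exists x (of_real s)"
  shows "laplace_exists (\<lambda>t. of_real (Re (x t))) (of_real s)"
    and "laplace (\<lambda>t. of_real (Re (x t))) (of_real s) = of_real (Re (laplace x (of_real s)))"
proof -
  have eq: "indicator {0..} t *\<^sub>R (exp (- (s * t)) * Re (x t))
      = Re (indicator {0..} t *\<^sub>R (exp (- (complex_of_real s * of_real t)) * x t))" for t
    using exp_of_real[of "- (s * t)", where 'a = complex] by simp
  have i: "integrable lborel (\<lambda>t. indicator {0..} t *\<^sub>R (exp (- (complex_of_real s * of_real t)) * x t))"
    using assms by (simp add: laplace_exists_def set_integrable_def)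
  show "laplace_exists (\<lambda>t. of_real (Re (x t))) (of_real s)"
    unfolding laplace_of_real set_integrable_def eq by (rule integrable_Re[OF i])
  show "laplace (\<lambda>t. of_real (Re (x t))) (of_real s) = of_real (Re (laplace x (of_real s)))"
    unfolding laplace_of_real set_lebesgue_integral_def eq integral_Re[OF i]
    by (simp add: laplace_def set_lebesgue_integral_def)
qed

text \<open>In the row k where |D k| is largest, a nonzero D would force r \<le>
  \<open>mat_bound A\<close>. Hence the transformed system has at most one solution for large
  s.\<close>

lemma eigenvector_bound_zero:
  fixes A :: "real^'n^'n" and D :: "'n \<Rightarrow> complex"
  assumes D: "\<And>i. of_real r * D i = (\<Sum>j\<in>UNIV. of_real (A $ i $ j) * D j)" and r: "r > mat_bound A"
  shows "D i = 0"
proof -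
  have r0: "r > 0" using r mat_bound_nonneg[of A] by linarith
  have "Max (range (\<lambda>i. norm (D i))) \<in> range (\<lambda>i. norm (D i))" by (rule Max_in) auto
  then obtain k where "Max (range (\<lambda>i. norm (D i))) = norm (D k)" by (rule rangeE)
  then have k: "norm (D j) \<le> norm (D k)" for j
    using Max_ge[of "range (\<lambda>i. norm (D i))" "norm (D j)"] by simp
  have "r * norm (D k) = norm (of_real r * D k)" using r0 by (simp add: norm_mult)
  also have "\<dots> \<le> (\<Sum>j\<in>UNIV. \<bar>A $ k $ j\<bar> * norm (D k))"
    unfolding D by (rule order_trans[OF norm_sum]) (auto simp: norm_mult k intro!: sum_mono mult_left_mono)
  also have "\<dots> \<le> mat_bound A * norm (D k)"
    unfolding sum_distrib_right[symmetric] by (intro mult_right_mono row_le_mat_bound) simp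
  finally have "norm (D k) \<le> 0" using r by (simp add: mult_le_cancel_right)
  then show ?thesis using k[of i] by simp
qed

theorem spectrum_imp_bounded_solvable:
  fixes \<alpha> :: real and A :: "real^'n^'n" and f :: "real \<Rightarrow> real^'n"
  assumes \<alpha>: "0 < \<alpha>" "\<alpha> < 1" and spec: "cspectrum A \<subseteq> Lambda_u \<alpha> \<union> Lambda_s \<alpha>"
    and f: "continuous_on {0..} f" and fb: "bounded (f ` {0..})"
  shows "\<exists>x0. bounded (frac_sol \<alpha> A f x0 ` {0..})"
proof -
  obtain z0 z where z: "solves_laplace \<alpha> A (\<lambda>i t. of_real (f t $ i)) z0 z"
    using spectrum_imp_solves_laplace[OF \<alpha> spec f fb] by blast
  have zc: "continuous_on {0..} (z i)" "\<exists>N. \<forall>t\<ge>0. norm (z i t) \<le> N" for i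
    using z unfolding solves_laplace_def by blast+
  obtain N where N: "\<And>i t. t \<ge> 0 \<Longrightarrow> norm (z i t) \<le> N i" using zc(2) by metis
  obtain s1 where s1: "\<And>s i. s \<ge> s1 \<Longrightarrow> of_real (s powr \<alpha>) * laplace (z i) (of_real s)
        - (\<Sum>j\<in>UNIV. of_real (A $ i $ j) * laplace (z j) (of_real s))
      = of_real (s powr (\<alpha> - 1)) * z0 i + laplace (\<lambda>t. of_real (f t $ i)) (of_real s)"
    using z unfolding solves_laplace_def by blast
  obtain s2 where s2: "s2 > 0" "\<And>s. s \<ge> s2 \<Longrightarrow> s powr \<alpha> > mat_bound A"
    using ex_powr_gt[OF \<alpha>(1)] by blast
  \<comment> \<open>A, f and the arguments s are real, so the real part of z satisfies the
    transformed equation with initial value Re z0.\<close>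
  define x0 :: "real^'n" where "x0 = (\<chi> i. Re (z0 i))"
  define d where "d = (\<lambda>i t. Re (z i t) - frac_sol \<alpha> A f x0 t $ i)"
  have fracc: "continuous_on {0..} (\<lambda>t. frac_sol \<alpha> A f x0 t $ i)" for i
    using continuous_on_Re[OF continuous_on_frac_sol[OF \<alpha>(1) f, of A x0 i]] by simp
  have dc: "continuous_on {0..} (d i)" for i
    unfolding d_def by (intro continuous_intros zc fracc)
  \<comment> \<open>Two solutions of the transformed system with the same data differ by a solution
    of the homogeneous one, which is 0.\<close>
  have dL: "laplace_exists (\<lambda>t. of_real (d i t)) (of_real s)" "laplace (\<lambda>t. of_real (d i t)) (of_real s) = 0"
    if s: "s \<ge> max s1 s2" for s i
  proof -
    have sp: "s > 0" using s s2 by simp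
    have sA: "s powr \<alpha> > mat_bound A" using s s2 by simp
    have exz: "laplace_exists (z i) (of_real s)" for i
      by (rule laplace_bounded(1)[OF zc(1) N]) (use sp in auto)
    note F = laplace_frac_sol[OF \<alpha>(1) f fb sp sA, of x0]
    define X where "X = (\<lambda>i. laplace (\<lambda>t. of_real (frac_sol \<alpha> A f x0 t $ i)) (of_real s))"
    define Z where "Z = (\<lambda>i. complex_of_real (Re (laplace (z i) (of_real s))))"
    have deq: "complex_of_real (d i t) = of_real (Re (z i t)) + (- 1) * of_real (frac_sol \<alpha> A f x0 t $ i)" for i t
      by (simp add: d_def)
    note add = laplace_add[OF laplace_Re(1)[OF exz] laplace_cmult(1)[OF F(1), of "- 1"]]
    show "laplace_exists (\<lambda>t. of_real (d i t)) (of_real s)"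
      unfolding deq by (rule add(1))
    have D: "laplace (\<lambda>t. of_real (d i t)) (of_real s) = Z i - X i" for i
      unfolding deq add(2) laplace_Re(2)[OF exz] laplace_cmult(2)[OF F(1), of "- 1"] by (simp add: Z_def X_def)
    have Zeq: "of_real (s powr \<alpha>) * Z i - (\<Sum>j\<in>UNIV. of_real (A $ i $ j) * Z j)
        = of_real (s powr (\<alpha> - 1)) * of_real (x0 $ i) + laplace (\<lambda>t. of_real (f t $ i)) (of_real s)" for i
    proof -
      have "complex_of_real (Re (of_real (s powr \<alpha>) * laplace (z i) (of_real s)
          - (\<Sum>j\<in>UNIV. of_real (A $ i $ j) * laplace (z j) (of_real s))))
        = of_real (Re (of_real (s powr (\<alpha> - 1)) * z0 i + laplace (\<lambda>t. of_real (f t $ i)) (of_real s)))"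
        using s1[of s i] s by simp
      then show ?thesis
        unfolding laplace_of_real by (simp add: Z_def x0_def)
    qed
    have "Z i - X i = 0"
    proof (rule eigenvector_bound_zero[OF _ sA])
      show "of_real (s powr \<alpha>) * (Z i - X i) = (\<Sum>j\<in>UNIV. of_real (A $ i $ j) * (Z j - X j))" for i
      proof -
        have "of_real (s powr \<alpha>) * (Z i - X i) - (\<Sum>j\<in>UNIV. of_real (A $ i $ j) * (Z j - X j))
          = (of_real (s powr \<alpha>) * Z i - (\<Sum>j\<in>UNIV. of_real (A $ i $ j) * Z j))
            - (of_real (s powr \<alpha>) * X i - (\<Sum>j\<in>UNIV. of_real (A $ i $ j) * X j))"
          by (simp add: right_diff_distrib sum_subtractf)
        also have "\<dots> = 0"
          unfolding Zeq using F(2)[of i] by (simp add: X_def)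
        finally show ?thesis by simp
      qed
    qed
    then show "laplace (\<lambda>t. of_real (d i t)) (of_real s) = 0" by (simp add: D)
  qed
  \<comment> \<open>Lerch's theorem identifies the formula with Re z, from which it inherits its
    bound.\<close>
  have d0: "d i t = 0" if "t \<ge> 0" for i t
  proof (rule lerch[OF dc _ _ that])
    show "set_integrable lborel {0..} (\<lambda>t. exp (- (max s1 s2 * t)) * d i t)"
      using dL(1)[of "max s1 s2" i] unfolding laplace_of_real by simp
    show "(LBINT t:{0..}. exp (- (s * t)) * d i t) = 0" if "s \<ge> max s1 s2" for s
      using dL(2)[OF that, of i] unfolding laplace_of_real by simp
  qed
  have "norm (frac_sol \<alpha> A f x0 t) \<le> (\<Sum>i\<in>UNIV. N i)" if t: "t \<ge> 0" for t
  proof -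
    have "norm (frac_sol \<alpha> A f x0 t) \<le> (\<Sum>i\<in>UNIV. \<bar>frac_sol \<alpha> A f x0 t $ i\<bar>)"
      by (rule norm_le_l1_cart)
    also have "\<dots> \<le> (\<Sum>i\<in>UNIV. N i)"
    proof (rule sum_mono)
      fix i
      have "\<bar>frac_sol \<alpha> A f x0 t $ i\<bar> = \<bar>Re (z i t)\<bar>" using d0[OF t, of i] by (simp add: d_def)
      also have "\<dots> \<le> N i" using abs_Re_le_cmod N[OF t] order_trans by blast
      finally show "\<bar>frac_sol \<alpha> A f x0 t $ i\<bar> \<le> N i" .
    qed
    finally show ?thesis .
  qed
  then show ?thesis by (auto simp: bounded_iff)
qed

theorem mainTheorem10:
  fixes \<alpha> :: real and A :: "real^'n^'n"
  assumes "0 < \<alpha>" and "\<alpha> < 1"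
  shows "(\<forall>f :: real \<Rightarrow> real^'n.
            continuous_on {0..} f \<and> bounded (f ` {0..}) \<longrightarrow>
            (\<exists>x0. bounded (frac_sol \<alpha> A f x0 ` {0..})))
         \<longleftrightarrow> cspectrum A \<subseteq> Lambda_u \<alpha> \<union> Lambda_s \<alpha>"
  using bounded_solvable_imp_spectrum[OF assms] spectrum_imp_bounded_solvable[OF assms] by blast

end
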